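(* For every fixed integer $q \geq 3$, the $q$-Coloring problem on graphs with a given set $X$ whose removal leaves a graph of maximum degree at most $1$ (parameterized by $k = |X|$) admits a kernel whose output graph has $O(k^{2q-3})$ vertices and whose output has bit-size $O(k^{2q-3} \cdot \log k)$.
   Context: For a fixed integer $q$, a proper $q$-coloring of a graph assigns one of $q$ colors to each vertex so that adjacent vertices receive different colors; a graph is $q$-colorable if it has a proper $q$-coloring. The problem considered is: the input is a graph $G=(V,E)$ together with a set $X \subseteq V$ such that the graph $G \setminus X$ obtained by deleting $X$ is a disjoint union of edges and isolated vertices (equivalently, has maximum degree at most $1$); the question is whether $G$ is $q$-colorable; the parameter is $k = |X|$. A kernel for a parameterized problem $Q \subseteq \{0,1\}^* \times \mathbb{N}$ is an algorithm that, given an instance $(x,k)$, runs in time polynomial in $|x|+k$ and outputs an instance $(x',k')$ such that $(x,k) \in Q$ if and only if $(x',k') \in Q$, and $|x'|+k' \leq f(k)$ for some computable function $f$, called the bit-size of the kernel. Here the output is again an instance $(G', X')$ of the same problem, and the number of vertices refers to the number of vertices of $G'$. *)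

theory Defs
  imports
    Complex_Main
    "HOL-Library.Landau_Symbols"
    "HOL-Computational_Algebra.Polynomial"
begin

definition simple_graph :: "'a set \<Rightarrow> 'a set set \<Rightarrow> bool" where
  "simple_graph V E \<longleftrightarrow> finite V \<and> (\<forall>e\<in>E. e \<subseteq> V \<and> card e = 2)"

definition proper_coloring :: "nat \<Rightarrow> 'a set \<Rightarrow> 'a set set \<Rightarrow> ('a \<Rightarrow> nat) \<Rightarrow> bool" where
  "proper_coloring q V E c \<longleftrightarrow>
     (\<forall>v\<in>V. c v < q) \<and> (\<forall>u v. {u, v} \<in> E \<longrightarrow> c u \<noteq> c v)"

definition colorable :: "nat \<Rightarrow> 'a set \<Rightarrow> 'a set set \<Rightarrow> bool" where
  "colorable q V E \<longleftrightarrow> (\<exists>c. proper_coloring q V E c)"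

definition degree_in :: "'a set set \<Rightarrow> 'a \<Rightarrow> nat" where
  "degree_in E v = card {e \<in> E. v \<in> e}"

definition delete_edges :: "'a set set \<Rightarrow> 'a set \<Rightarrow> 'a set set" where
  "delete_edges E X = {e \<in> E. e \<inter> X = {}}"

definition deg1_modulator :: "'a set \<Rightarrow> 'a set set \<Rightarrow> 'a set \<Rightarrow> bool" where
  "deg1_modulator V E X \<longleftrightarrow>
     X \<subseteq> V \<and> (\<forall>v \<in> V - X. degree_in (delete_edges E X) v \<le> 1)"

text \<open>The graph of an encoded instance has the vertex set \<open>{..<n}\<close>. The string consists of
  \<open>n\<close> in unary, the characteristic vector of \<open>X\<close>, and a list of edges whose end points are
  written in binary. An edge may be listed repeatedly, in either orientation.\<close>

fun bits :: "nat \<Rightarrow> bool list" where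
  "bits m = (if m = 0 then [] else odd m # bits (m div 2))"

declare bits.simps [simp del]

text \<open>Self-delimiting: each binary digit is preceded by 1, and a 0 ends the number.\<close>

definition nat_code :: "nat \<Rightarrow> bool list" where
  "nat_code m = concat (map (\<lambda>b. [True, b]) (bits m)) @ [False]"

definition instance_code :: "nat \<Rightarrow> nat set \<Rightarrow> (nat \<times> nat) list \<Rightarrow> bool list" where
  "instance_code n X es =
     replicate n True @ [False] @ map (\<lambda>v. v \<in> X) [0..<n] @
     concat (map (\<lambda>(u, v). nat_code u @ nat_code v) es)"

definition encodes :: "bool list \<Rightarrow> nat \<Rightarrow> nat set set \<Rightarrow> nat set \<Rightarrow> bool" where
  "encodes x n E X \<longleftrightarrow>
     (\<exists>es. E = {{u, v} |u v. (u, v) \<in> set es} \<and> x = instance_code n X es)"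

definition is_instance ::
    "bool list \<Rightarrow> nat \<Rightarrow> nat \<Rightarrow> nat set set \<Rightarrow> nat set \<Rightarrow> bool" where
  "is_instance x k n E X \<longleftrightarrow>
     encodes x n E X \<and> simple_graph {..<n} E \<and> deg1_modulator {..<n} E X \<and> k = card X"

definition q_Coloring :: "nat \<Rightarrow> (bool list \<times> nat) set" where
  "q_Coloring q = {(x, k). \<exists>n E X. is_instance x k n E X \<and> colorable q {..<n} E}"

text \<open>Algorithms are structured programs for a unit-cost random access machine over the natural
  numbers with addition and truncated subtraction as its only arithmetic (as in Cook and
  Reckhow). The memory consists of arrays, of which a program addresses only finitely many; cell
  \<open>i\<close> of array \<open>a\<close> is \<open>s a i\<close>. The expressions of a fixed program have
  bounded size and multiplication is not available, so one step adds \<open>O(1)\<close> to the bit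
  length of the largest number, and running times agree with those of Turing machines up to a
  polynomial.\<close>

type_synonym memory = "nat \<Rightarrow> nat \<Rightarrow> nat"

datatype exp = Const nat | Cell nat exp | Add exp exp | Sub exp exp

fun eval_exp :: "exp \<Rightarrow> memory \<Rightarrow> nat" where
  "eval_exp (Const m) s = m"
| "eval_exp (Cell a e) s = s a (eval_exp e s)"
| "eval_exp (Add e1 e2) s = eval_exp e1 s + eval_exp e2 s"
| "eval_exp (Sub e1 e2) s = eval_exp e1 s - eval_exp e2 s"

datatype com =
    Skip
  | Assign nat exp exp
  | Seq com com
  | Cond exp com com
  | Loop exp com

text \<open>\<open>exec c s t s'\<close>: started in \<open>s\<close>, the program \<open>c\<close> terminates in \<open>s'\<close> after
  \<open>t\<close> steps. A test succeeds if the value is nonzero.\<close>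

inductive exec :: "com \<Rightarrow> memory \<Rightarrow> nat \<Rightarrow> memory \<Rightarrow> bool" where
  Skip: "exec Skip s 1 s"
| Assign: "exec (Assign a i e) s 1 (s(a := (s a)(eval_exp i s := eval_exp e s)))"
| Seq: "exec c1 s t1 s1 \<Longrightarrow> exec c2 s1 t2 s2 \<Longrightarrow> exec (Seq c1 c2) s (t1 + t2) s2"
| CondTrue: "eval_exp e s \<noteq> 0 \<Longrightarrow> exec c1 s t s1 \<Longrightarrow> exec (Cond e c1 c2) s (1 + t) s1"
| CondFalse: "eval_exp e s = 0 \<Longrightarrow> exec c2 s t s1 \<Longrightarrow> exec (Cond e c1 c2) s (1 + t) s1"
| LoopFalse: "eval_exp e s = 0 \<Longrightarrow> exec (Loop e c) s 1 s"
| LoopTrue: "eval_exp e s \<noteq> 0 \<Longrightarrow> exec c s t1 s1 \<Longrightarrow> exec (Loop e c) s1 t2 s2 \<Longrightarrow>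
    exec (Loop e c) s (1 + t1 + t2) s2"

inductive_cases exec_SkipE: "exec Skip s t s'"
inductive_cases exec_AssignE: "exec (Assign a i e) s t s'"
inductive_cases exec_SeqE: "exec (Seq c1 c2) s t s'"
inductive_cases exec_CondE: "exec (Cond e c1 c2) s t s'"
inductive_cases exec_LoopE: "exec (Loop e c) s t s'"

lemma exec_deterministic:
  "exec c s t s' \<Longrightarrow> exec c s t' s'' \<Longrightarrow> t' = t \<and> s'' = s'"
proof (induction arbitrary: t' s'' rule: exec.induct)
  case Skip then show ?case by (auto elim: exec_SkipE)
next
  case Assign then show ?case by (auto elim: exec_AssignE)
next
  case (Seq c1 s t1 s1 c2 t2 s2)
  from Seq.prems obtain u1 r u2 where
    "t' = u1 + u2" "exec c1 s u1 r" "exec c2 r u2 s''"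
    by (auto elim: exec_SeqE)
  then show ?case using Seq.IH by metis
next
  case (CondTrue e s c1 t s1 c2)
  from CondTrue.prems CondTrue.hyps(1) obtain u where "t' = 1 + u" "exec c1 s u s''"
    by (auto elim: exec_CondE)
  then show ?case using CondTrue.IH by metis
next
  case (CondFalse e s c2 t s1 c1)
  from CondFalse.prems CondFalse.hyps(1) obtain u where "t' = 1 + u" "exec c2 s u s''"
    by (auto elim: exec_CondE)
  then show ?case using CondFalse.IH by metis
next
  case LoopFalse then show ?case by (auto elim: exec_LoopE)
next
  case (LoopTrue e s c t1 s1 t2 s2)
  from LoopTrue.prems LoopTrue.hyps(1) obtain u1 r u2 where
    "t' = 1 + u1 + u2" "exec c s u1 r" "exec (Loop e c) r u2 s''"
    by (auto elim: exec_LoopE)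
  then show ?case using LoopTrue.IH by metis
qed

text \<open>Input and output convention for a pair \<open>(x, k)\<close>: array 0 holds \<open>length x\<close> and
  \<open>k\<close>, array 1 holds the bits of \<open>x\<close>; on input all other cells are 0.\<close>

definition input_memory :: "bool list \<Rightarrow> nat \<Rightarrow> memory" where
  "input_memory x k =
     (\<lambda>a i. if a = 0 \<and> i = 0 then length x
            else if a = 0 \<and> i = 1 then k
            else if a = 1 \<and> i < length x then of_bool (x ! i)
            else 0)"

definition output_string :: "memory \<Rightarrow> bool list" where
  "output_string s = map (\<lambda>i. s 1 i \<noteq> 0) [0..<s 0 0]"

definition output_param :: "memory \<Rightarrow> nat" where
  "output_param s = s 0 1"

definition runs_to :: "com \<Rightarrow> bool list \<Rightarrow> nat \<Rightarrow> nat \<Rightarrow> bool list \<Rightarrow> nat \<Rightarrow> bool" where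
  "runs_to K x k t x' k' \<longleftrightarrow>
     (\<exists>s. exec K (input_memory x k) t s \<and> output_string s = x' \<and> output_param s = k')"

definition computable :: "(nat \<Rightarrow> nat) \<Rightarrow> bool" where
  "computable f \<longleftrightarrow> (\<exists>K. \<forall>k. \<exists>t x'. runs_to K [] k t x' (f k))"

text \<open>The length of the output string is added to the running time because the machine can
  declare an output length without having written each bit.\<close>

definition is_kernel :: "com \<Rightarrow> (bool list \<times> nat) set \<Rightarrow> (nat \<Rightarrow> nat) \<Rightarrow> bool" where
  "is_kernel K Q f \<longleftrightarrow>
     computable f \<and>
     (\<exists>p :: nat poly. \<forall>x k. \<exists>t x' k'.
        runs_to K x k t x' k' \<and>
        t + length x' \<le> poly p (length x + k) \<and>
        ((x, k) \<in> Q \<longleftrightarrow> (x', k') \<in> Q) \<and>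
        length x' + k' \<le> f k)"

end

theory Submission imports Defs begin

text \<open>A vertex outside \<open>X\<close> forbids that \<open>q\<close> of its neighbours in \<open>X\<close> receive all \<open>q\<close> colours, and an
  edge \<open>uv\<close> outside \<open>X\<close> forbids that \<open>q - 1\<close> neighbours of \<open>u\<close> and \<open>q - 1\<close> neighbours of \<open>v\<close> receive the
  same \<open>q - 1\<close> colours. These constraints characterise the colourings of \<open>X\<close> that extend to \<open>G\<close>, and
  each of them is expressed by a fresh edge attached to \<open>X\<close>. There are at most \<open>k\<^sup>q\<close> constraints of
  the first kind. Those of the second kind are tuples of length \<open>2q - 2\<close>. Fix \<open>x\<^sub>0 \<in> X\<close>. Replacing in a
  tuple at most one entry of each half by \<open>x\<^sub>0\<close> gives a linear relation over the field with two
  elements which expresses the violation of the tuple by the violation of tuples containing \<open>x\<^sub>0\<close>.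
  There are at most \<open>(2q - 2) k\<^bsup>2q - 3\<^esup>\<close> of the latter, hence Gaussian elimination
  selects that many constraints of the second kind which imply all the others.

  The kernel is written in a language of loops with one common number \<open>N\<close> of iterations; its
  programs run in time polynomial in \<open>N\<close> by construction.\<close>

section \<open>Programs with loops of equal length\<close>

text \<open>A relation between constraints must be usable by an algorithm that never sees a
  colouring. The coefficient vectors therefore depend on the tuples alone, while a colouring
  together with two colours \<open>a\<close> \<noteq> \<open>b\<close> is a linear functional on
  them; one elimination serves all colourings at once. The relation stems from lists of
  \<open>q\<close> vertices: among the \<open>q\<close> lists obtained by deleting one entry, the
  number of those whose colours are exactly all but \<open>a\<close> is odd if and only if the whole
  list shows all \<open>q\<close> colours, whatever \<open>a\<close> is. Applied to
  \<open>x0\<close> together with each half of a tuple, this gives a product of two parities that is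
  the same for every missing colour. It still varies with the colouring; adding two colours cancels
  it. Every tuple gets such a relation, but the other terms are tuples that contain
  \<open>x0\<close>, and these are the only coordinates of the vectors, which bounds the rank.
  Constraints of the first kind are all kept, as \<open>q\<close> \<ge> 3 gives \<open>q\<close>
  \<le> \<open>2q - 3\<close>.\<close>

datatype prog =
    PSkip
  | PAsg nat exp exp
  | PSeq prog prog
  | PIf exp prog prog
  | PFor nat prog

fun writes :: "prog \<Rightarrow> nat set" where
  "writes PSkip = {}"
| "writes (PAsg a i e) = {a}"
| "writes (PSeq p1 p2) = writes p1 \<union> writes p2"
| "writes (PIf e p1 p2) = writes p1 \<union> writes p2"
| "writes (PFor v p) = insert v (writes p)"

text \<open>The cell that holds the loop bound survives the whole program, and a body never touches
  its own counter; this makes the iteration count of a compiled \<open>Loop\<close> exact. Counters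
  may be reused by loops that are not nested in each other.\<close>

fun wf_prog :: "nat \<Rightarrow> prog \<Rightarrow> bool" where
  "wf_prog B PSkip = True"
| "wf_prog B (PAsg a i e) = (a \<noteq> B)"
| "wf_prog B (PSeq p1 p2) = (wf_prog B p1 \<and> wf_prog B p2)"
| "wf_prog B (PIf e p1 p2) = (wf_prog B p1 \<and> wf_prog B p2)"
| "wf_prog B (PFor v p) = (v \<noteq> B \<and> v \<notin> writes p \<and> wf_prog B p)"

abbreviation Var :: "nat \<Rightarrow> exp" where "Var a \<equiv> Cell a (Const 0)"

fun compile :: "nat \<Rightarrow> prog \<Rightarrow> com" where
  "compile B PSkip = Skip"
| "compile B (PAsg a i e) = Assign a i e"
| "compile B (PSeq p1 p2) = Seq (compile B p1) (compile B p2)"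
| "compile B (PIf e p1 p2) = Cond e (compile B p1) (compile B p2)"
| "compile B (PFor v p) =
     Seq (Assign v (Const 0) (Const 0))
       (Loop (Sub (Var B) (Var v))
         (Seq (compile B p) (Assign v (Const 0) (Add (Var v) (Const 1)))))"

abbreviation setc :: "nat \<Rightarrow> nat \<Rightarrow> nat \<Rightarrow> memory \<Rightarrow> memory" where
  "setc a i x s \<equiv> s(a := (s a)(i := x))"

text \<open>The iteration count is an argument instead of a memory cell, so the meaning of a program
  is a total function and termination needs no argument; \<open>exec_compile\<close> reconnects it
  with the bound stored in memory.\<close>

fun run :: "nat \<Rightarrow> prog \<Rightarrow> memory \<Rightarrow> memory" where
  "run N PSkip s = s"
| "run N (PAsg a i e) s = setc a (eval_exp i s) (eval_exp e s) s"
| "run N (PSeq p1 p2) s = run N p2 (run N p1 s)"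
| "run N (PIf e p1 p2) s = (if eval_exp e s \<noteq> 0 then run N p1 s else run N p2 s)"
| "run N (PFor v p) s =
     ((\<lambda>s. setc v 0 (Suc (run N p s v 0)) (run N p s)) ^^ N) (setc v 0 0 s)"

text \<open>Both branches of a conditional are charged, so that the bound depends on
  \<open>N\<close> only and is visibly a polynomial in it.\<close>

fun cost :: "nat \<Rightarrow> prog \<Rightarrow> nat" where
  "cost N PSkip = 1"
| "cost N (PAsg a i e) = 1"
| "cost N (PSeq p1 p2) = cost N p1 + cost N p2"
| "cost N (PIf e p1 p2) = 1 + cost N p1 + cost N p2"
| "cost N (PFor v p) = 2 + N * (cost N p + 2)"

lemma run_frame: "a \<notin> writes p \<Longrightarrow> run N p s a = s a"
proof (induction p arbitrary: s)
  case (PFor v p)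
  have "((\<lambda>s. setc v 0 (Suc (run N p s v 0)) (run N p s)) ^^ n) s a = s a" for n s
    using PFor by (induction n) auto
  then show ?case using PFor.prems by auto
qed auto

lemma wf_prog_writes: "wf_prog B p \<Longrightarrow> B \<notin> writes p"
  by (induction p) auto

lemma exec_compile:
  assumes "wf_prog B p" "s B 0 = N"
  shows "\<exists>t\<le>cost N p. exec (compile B p) s t (run N p s)"
  using assms
proof (induction p arbitrary: s)
  case PSkip
  then show ?case using exec.Skip[of s] by force
next
  case (PAsg a i e)
  show ?case unfolding run.simps compile.simps cost.simps using exec.Assign by blast
next
  case (PSeq p1 p2)
  have B: "run N p1 s B 0 = N" using PSeq.prems by (simp add: run_frame wf_prog_writes)
  obtain t1 where t1: "t1 \<le> cost N p1" "exec (compile B p1) s t1 (run N p1 s)"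
    using PSeq.IH(1)[of s] PSeq.prems by auto
  obtain t2 where t2: "t2 \<le> cost N p2" "exec (compile B p2) (run N p1 s) t2 (run N p2 (run N p1 s))"
    using PSeq.IH(2)[of "run N p1 s"] PSeq.prems B by auto
  show ?case
    unfolding compile.simps run.simps cost.simps
    using exec.Seq[OF t1(2) t2(2)] add_mono[OF t1(1) t2(1)] by blast
next
  case (PIf e p1 p2)
  obtain t1 where t1: "t1 \<le> cost N p1" "exec (compile B p1) s t1 (run N p1 s)"
    using PIf.IH(1)[of s] PIf.prems by auto
  obtain t2 where t2: "t2 \<le> cost N p2" "exec (compile B p2) s t2 (run N p2 s)"
    using PIf.IH(2)[of s] PIf.prems by auto
  show ?case
  proof (cases "eval_exp e s = 0")
    case True
    then have "exec (compile B (PIf e p1 p2)) s (1 + t2) (run N (PIf e p1 p2) s)"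
      using exec.CondFalse[OF True t2(2)] by simp
    then show ?thesis using t2(1) by (intro exI[of _ "1 + t2"]) simp
  next
    case False
    then have "exec (compile B (PIf e p1 p2)) s (1 + t1) (run N (PIf e p1 p2) s)"
      using exec.CondTrue[OF False t1(2)] by simp
    then show ?thesis using t1(1) by (intro exI[of _ "1 + t1"]) simp
  qed
next
  case (PFor v p)
  define F where "F = (\<lambda>s. setc v 0 (Suc (run N p s v 0)) (run N p s))"
  define inc where "inc = Assign v (Const 0) (Add (Var v) (Const 1))"
  define L where "L = Loop (Sub (Var B) (Var v)) (Seq (compile B p) inc)"
  have B: "B \<notin> writes p" "v \<noteq> B" "v \<notin> writes p" "wf_prog B p"
    using PFor.prems wf_prog_writes by auto
  have F: "F s B 0 = s B 0" "F s v 0 = Suc (s v 0)" for s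
    using B by (simp_all add: F_def run_frame)
  \<comment> \<open>\<open>j\<close> is the number of iterations left: the guard
    \<open>N - v\<close> is nonzero exactly while \<open>j > 0\<close>.\<close>
  have *: "\<exists>t\<le>1 + j * (cost N p + 2). exec L s t ((F ^^ j) s)"
    if "s B 0 = N" "s v 0 + j = N" for j s
    using that
  proof (induction j arbitrary: s)
    case 0
    then show ?case using exec.LoopFalse[of "Sub (Var B) (Var v)" s] unfolding L_def by force
  next
    case (Suc j)
    obtain t1 where t1: "t1 \<le> cost N p" "exec (compile B p) s t1 (run N p s)"
      using PFor.IH[of s] B Suc.prems by auto
    have "exec inc (run N p s) 1 (F s)"
      using exec.Assign[of v "Const 0" "Add (Var v) (Const 1)" "run N p s"]
      by (simp add: F_def inc_def)
    note body = exec.Seq[OF t1(2) this]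
    obtain t2 where t2: "t2 \<le> 1 + j * (cost N p + 2)" "exec L (F s) t2 ((F ^^ j) (F s))"
      using Suc.IH[of "F s"] Suc.prems F by auto
    have "eval_exp (Sub (Var B) (Var v)) s \<noteq> 0" using Suc.prems by simp
    from exec.LoopTrue[OF this body] t2(2)
    have "exec L s (1 + (t1 + 1) + t2) ((F ^^ Suc j) s)"
      unfolding L_def by (simp add: funpow_swap1)
    moreover have "1 + (t1 + 1) + t2 \<le> 1 + Suc j * (cost N p + 2)" using t1 t2 by simp
    ultimately show ?case by blast
  qed
  obtain t where t: "t \<le> 1 + N * (cost N p + 2)" "exec L (setc v 0 0 s) t ((F ^^ N) (setc v 0 0 s))"
    using *[of "setc v 0 0 s" N] PFor.prems B by auto
  have "exec (compile B (PFor v p)) s (1 + t) (run N (PFor v p) s)"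
    using exec.Seq[OF exec.Assign[of v "Const 0" "Const 0" s], of L] t(2)
    by (simp add: L_def F_def inc_def)
  moreover have "1 + t \<le> cost N (PFor v p)" using t(1) by simp
  ultimately show ?case by blast
qed

lemma cost_poly: "\<exists>P :: nat poly. \<forall>N. cost N p = poly P N"
proof (induction p)
  case (PSeq p1 p2)
  then show ?case by (metis cost.simps(3) poly_add)
next
  case (PIf e p1 p2)
  then obtain P1 P2 where "\<forall>N. cost N p1 = poly P1 N" "\<forall>N. cost N p2 = poly P2 N" by auto
  then show ?case by (intro exI[of _ "1 + P1 + P2"]) auto
next
  case (PFor v p)
  then obtain P where "\<forall>N. cost N p = poly P N" by auto
  then show ?case by (intro exI[of _ "2 + [:0,1:] * (P + 2)"]) (auto simp: numeral_poly)
qed (auto intro: exI[of _ "1 :: nat poly"])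

text \<open>The invariant at \<open>i\<close> speaks about the state in which the counter holds
  \<open>i\<close>. Its step also receives that all arrays outside the body's reach are as before
  the loop, so that invariants need not carry frame conditions.\<close>

lemma for_rule:
  assumes "v \<notin> writes p"
    and "I 0 (setc v 0 0 s)"
    and "\<And>i s'. i < N \<Longrightarrow> I i s' \<Longrightarrow> s' v 0 = i \<Longrightarrow>
      (\<And>a. a \<notin> writes p \<Longrightarrow> a \<noteq> v \<Longrightarrow> s' a = s a) \<Longrightarrow> I (Suc i) (setc v 0 (Suc i) (run N p s'))"
  shows "I N (run N (PFor v p) s)"
proof -
  define F where "F = (\<lambda>s. setc v 0 (Suc (run N p s v 0)) (run N p s))"
  have F_app: "F s' = setc v 0 (Suc (run N p s' v 0)) (run N p s')" for s'
    by (simp add: F_def)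
  define s0 where "s0 = setc v 0 0 s"
  have s0: "I 0 s0" "s0 v 0 = 0" "\<And>a. a \<noteq> v \<Longrightarrow> s0 a = s a"
    using assms(2) by (simp_all add: s0_def)
  have "I j ((F ^^ j) s0) \<and> (F ^^ j) s0 v 0 = j \<and>
      (\<forall>a. a \<notin> writes p \<and> a \<noteq> v \<longrightarrow> (F ^^ j) s0 a = s a)" if "j \<le> N" for j
    using that
  proof (induction j)
    case 0
    then show ?case using s0 by simp
  next
    case (Suc j)
    let ?s = "(F ^^ j) s0"
    have s: "I j ?s" "?s v 0 = j" "\<And>a. a \<notin> writes p \<Longrightarrow> a \<noteq> v \<Longrightarrow> ?s a = s a" using Suc by simp_all
    have v: "run N p ?s v 0 = j" using s(2) assms(1) by (simp add: run_frame)
    define G where "G = setc v 0 (Suc j) (run N p ?s)"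
    have eq: "(F ^^ Suc j) s0 = G"
      by (simp only: funpow.simps comp_apply F_app v G_def)
    have "j < N" using Suc.prems by simp
    have "I (Suc j) G"
      unfolding G_def by (rule assms(3)[OF \<open>j < N\<close> s(1,2)]) (rule s(3))
    moreover have "G a = s a" if "a \<notin> writes p" "a \<noteq> v" for a
      using that s(3) by (simp add: run_frame G_def)
    moreover have "G v 0 = Suc j" by (simp add: G_def)
    ultimately show ?case by (simp only: eq) simp
  qed
  from this[of N] show ?thesis by (simp add: s0_def F_def)
qed

text \<open>Truncated subtraction is the only source of tests: \<open>1 - e\<close> is negation, and
  \<open>b - a\<close> is nonzero exactly if \<open>a < b\<close>.\<close>

definition NotE :: "exp \<Rightarrow> exp" where "NotE e = Sub (Const 1) e"
definition AndE :: "exp \<Rightarrow> exp \<Rightarrow> exp" where "AndE a b = NotE (Add (NotE a) (NotE b))"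
definition LessE :: "exp \<Rightarrow> exp \<Rightarrow> exp" where "LessE a b = NotE (NotE (Sub b a))"
definition EqE :: "exp \<Rightarrow> exp \<Rightarrow> exp" where "EqE a b = NotE (Add (Sub a b) (Sub b a))"
definition AllE :: "exp list \<Rightarrow> exp" where "AllE es = foldr AndE es (Const 1)"
definition SumE :: "exp list \<Rightarrow> exp" where "SumE es = foldr Add es (Const 0)"

lemma eval_NotE [simp]: "eval_exp (NotE e) s = of_bool (eval_exp e s = 0)"
  by (auto simp: NotE_def)

lemma eval_AndE [simp]: "eval_exp (AndE a b) s = of_bool (eval_exp a s \<noteq> 0 \<and> eval_exp b s \<noteq> 0)"
  by (auto simp: AndE_def)

lemma eval_LessE [simp]: "eval_exp (LessE a b) s = of_bool (eval_exp a s < eval_exp b s)"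
  by (auto simp: LessE_def)

lemma eval_EqE [simp]: "eval_exp (EqE a b) s = of_bool (eval_exp a s = eval_exp b s)"
  by (auto simp: EqE_def)

lemma eval_AllE [simp]: "eval_exp (AllE es) s = of_bool (\<forall>e\<in>set es. eval_exp e s \<noteq> 0)"
  unfolding AllE_def by (induction es) auto

lemma eval_SumE [simp]: "eval_exp (SumE es) s = sum_list (map (\<lambda>e. eval_exp e s) es)"
  unfolding SumE_def by (induction es) auto

fun reads :: "exp \<Rightarrow> nat set" where
  "reads (Const m) = {}"
| "reads (Cell a e) = insert a (reads e)"
| "reads (Add e1 e2) = reads e1 \<union> reads e2"
| "reads (Sub e1 e2) = reads e1 \<union> reads e2"

lemma eval_cong: "(\<And>a. a \<in> reads e \<Longrightarrow> s a = s' a) \<Longrightarrow> eval_exp e s = eval_exp e s'"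
  by (induction e) auto

fun seqs :: "prog list \<Rightarrow> prog" where
  "seqs [] = PSkip"
| "seqs [p] = p"
| "seqs (p # ps) = PSeq p (seqs ps)"

lemma writes_seqs [simp]: "writes (seqs ps) = (\<Union>p\<in>set ps. writes p)"
  by (induction ps rule: seqs.induct) auto

lemma wf_seqs [simp]: "wf_prog B (seqs ps) = (\<forall>p\<in>set ps. wf_prog B p)"
  by (induction ps rule: seqs.induct) auto

lemma run_seqs_Cons [simp]: "run N (seqs (p # ps)) s = run N (seqs ps) (run N p s)"
  by (cases ps) auto

section \<open>Colour constraints and their relations\<close>

text \<open>If \<open>f\<close> permutes the colours, exactly one deletion works, that of the
  preimage of \<open>a\<close>. Otherwise a deletion of \<open>j0\<close> that works makes
  \<open>f\<close> injective on the rest, and \<open>f j0\<close> \<noteq> \<open>a\<close>, so the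
  value \<open>f j0\<close> is repeated at a unique \<open>j1\<close>; then deleting
  \<open>j0\<close> or \<open>j1\<close> works and nothing else does. The count is 1 in the first
  case and 0 or 2 in the second.\<close>

lemma odd_card_deletions:
  fixes f :: "nat \<Rightarrow> nat" and q a :: nat
  assumes f: "f ` {..<q} \<subseteq> {..<q}" and a: "a < q"
  shows "odd (card {j. j < q \<and> f ` ({..<q} - {j}) = {..<q} - {a}}) \<longleftrightarrow> f ` {..<q} = {..<q}"
proof (cases "f ` {..<q} = {..<q}")
  case True
  then have inj: "inj_on f {..<q}" by (simp add: eq_card_imp_inj_on)
  obtain j0 where j0: "j0 < q" "f j0 = a" using True a by (metis imageE lessThan_iff)
  have "f ` ({..<q} - {j}) = {..<q} - {f j}" if "j < q" for j
    using inj_on_image_set_diff[OF inj, of "{..<q}" "{j}"] that True by auto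
  then have "{j. j < q \<and> f ` ({..<q} - {j}) = {..<q} - {a}} = {j0}"
    using j0 a inj f by (auto simp: inj_on_def)
  then show ?thesis using True by simp
next
  case False
  show ?thesis
  proof (cases "{j. j < q \<and> f ` ({..<q} - {j}) = {..<q} - {a}} = {}")
    case True
    then show ?thesis using False by (metis card.empty even_zero)
  next
    case nonempty: False
    then obtain j0 where j0: "j0 < q" "f ` ({..<q} - {j0}) = {..<q} - {a}" by auto
    have inj: "inj_on f ({..<q} - {j})" if "j < q" "f ` ({..<q} - {j}) = {..<q} - {a}" for j
      using that a by (intro eq_card_imp_inj_on) auto
    have "{..<q} = insert j0 ({..<q} - {j0})" using j0 by auto
    then have im: "f ` {..<q} = insert (f j0) ({..<q} - {a})" using j0 by (metis image_insert)
    have "f j0 \<noteq> a" using im False a by auto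
    moreover have "f j0 < q" using f j0 by auto
    ultimately have "f j0 \<in> f ` ({..<q} - {j0})" using j0 by simp
    then obtain j1 where "f j0 = f j1" "j1 \<in> {..<q} - {j0}" by (rule imageE)
    then have j1: "j1 < q" "j1 \<noteq> j0" "f j1 = f j0" by auto
    have "f ` ({..<q} - {j1}) = f ` ({..<q} - {j0})"
    proof (intro equalityI subsetI)
      fix y assume "y \<in> f ` ({..<q} - {j1})"
      then obtain x where "x < q" "x \<noteq> j1" "y = f x" by auto
      then have "y = f (if x = j0 then j1 else x)" using j1 by simp
      then show "y \<in> f ` ({..<q} - {j0})" using j1 \<open>x < q\<close>
        by (intro image_eqI[of _ f "if x = j0 then j1 else x"]) auto
    next
      fix y assume "y \<in> f ` ({..<q} - {j0})"
      then obtain x where "x < q" "x \<noteq> j0" "y = f x" by auto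
      then have "y = f (if x = j1 then j0 else x)" using j1 by simp
      then show "y \<in> f ` ({..<q} - {j1})" using j1 j0 \<open>x < q\<close>
        by (intro image_eqI[of _ f "if x = j1 then j0 else x"]) auto
    qed
    \<comment> \<open>Deleting a third index would leave both \<open>j0\<close> and
      \<open>j1\<close>, on which \<open>f\<close> agrees, against injectivity.\<close>
    moreover have "j = j0 \<or> j = j1" if "j < q" "f ` ({..<q} - {j}) = {..<q} - {a}" for j
      using inj[OF that] j0(1) j1 unfolding inj_on_def by (metis DiffI lessThan_iff singletonD)
    ultimately have "{j. j < q \<and> f ` ({..<q} - {j}) = {..<q} - {a}} = {j0, j1}"
      using j0 j1 by auto
    then show ?thesis using False j1 by simp
  qed
qed

text \<open>The deletions of one entry from \<open>x0 # s\<close>, up to the order of the entries: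
  overwriting \<open>s ! i\<close> by \<open>x0\<close> deletes \<open>s ! i\<close>. The deletion
  of \<open>x0\<close>, which is \<open>s\<close> itself, comes first.\<close>

definition subs :: "'a \<Rightarrow> 'a list \<Rightarrow> 'a list list" where
  "subs x0 s = s # map (\<lambda>i. s[i := x0]) [0..<length s]"

definition viol :: "nat \<Rightarrow> ('a \<Rightarrow> nat) \<Rightarrow> nat \<Rightarrow> 'a list \<Rightarrow> bool" where
  "viol q c a s \<longleftrightarrow> c ` set s = {..<q} - {a}"

text \<open>\<open>odd_card_deletions\<close> for the map from positions of \<open>x0 # s\<close> to
  colours; position 0 belongs to \<open>x0\<close>.\<close>

lemma odd_viol_subs:
  assumes len: "Suc (length s) = q" and c: "\<And>x. x \<in> set (x0 # s) \<Longrightarrow> c x < q" and a: "a < q"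
  shows "odd (length (filter (viol q c a) (subs x0 s))) \<longleftrightarrow> c ` set (x0 # s) = {..<q}"
proof -
  let ?T = "x0 # s"
  define f where "f = (\<lambda>i. c (?T ! i))"
  have sub: "c ` set (subs x0 s ! j) = f ` ({..<q} - {j})" if "j < q" for j
  proof (cases j)
    case 0
    have "c ` set s = f ` {1..<q}"
    proof -
      have i: "{1..<q} = Suc ` {0..<length s}" using len by (simp add: image_Suc_atLeastLessThan)
      have s: "set s = (!) s ` {0..<length s}" using nth_image[of "length s" s] by simp
      show ?thesis unfolding i by (subst s) (simp only: image_image f_def nth_Cons_Suc)
    qed
    moreover have "{1..<q} = {..<q} - {0}" by auto
    ultimately show ?thesis using 0 by (simp add: subs_def)
  next
    case (Suc i)
    then have i: "i < length s" using that len by simp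
    have "set (s[i := x0]) = (\<lambda>k. ?T ! k) ` ({..<q} - {j})"
    proof (intro equalityI subsetI)
      fix y assume "y \<in> set (s[i := x0])"
      then obtain k where k: "k < length s" "y = s[i := x0] ! k" by (auto simp: in_set_conv_nth)
      show "y \<in> (\<lambda>k. ?T ! k) ` ({..<q} - {j})"
      proof (cases "k = i")
        case True
        then show ?thesis using k len Suc by (intro image_eqI[of _ _ 0]) auto
      next
        case False
        then show ?thesis using k len Suc by (intro image_eqI[of _ _ "Suc k"]) auto
      qed
    next
      fix y assume "y \<in> (\<lambda>k. ?T ! k) ` ({..<q} - {j})"
      then obtain k where k: "k < q" "k \<noteq> j" "y = ?T ! k" by auto
      show "y \<in> set (s[i := x0])"
      proof (cases k)
        case 0
        then show ?thesis using i k by (simp add: set_update_memI)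
      next
        case (Suc k')
        then have "s[i := x0] ! k' = y" "k' < length (s[i := x0])"
          using k len \<open>j = Suc i\<close> by auto
        then show ?thesis by (metis nth_mem)
      qed
    qed
    then show ?thesis using Suc i by (simp add: subs_def f_def image_image)
  qed
  have "length (subs x0 s) = q" using len by (simp add: subs_def)
  moreover have "{j. j < q \<and> viol q c a (subs x0 s ! j)} =
      {j. j < q \<and> f ` ({..<q} - {j}) = {..<q} - {a}}"
    by (rule Collect_cong) (simp add: viol_def sub cong: conj_cong)
  moreover have "f ` {..<q} = c ` set ?T"
  proof -
    have "set ?T = (\<lambda>k. ?T ! k) ` {..<q}"
      using len by (auto simp: set_conv_nth image_iff simp del: set_simps nth_Cons_Suc)
    then show ?thesis by (simp add: f_def image_image)
  qed
  moreover have "f ` {..<q} \<subseteq> {..<q}" using calculation(3) c by auto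
  ultimately show ?thesis
    using odd_card_deletions[of f q a] a by (simp add: length_filter_conv_card)
qed

text \<open>All combinations of a deletion in the first half with a deletion in the second. The
  tuple itself comes first; every other member contains \<open>x0\<close> in at least one half, so
  the tail is the other side of the relation for \<open>s\<close>.\<close>

definition boxes :: "nat \<Rightarrow> 'a \<Rightarrow> 'a list \<Rightarrow> 'a list list" where
  "boxes r x0 s = concat (map (\<lambda>s1. map (\<lambda>s2. s1 @ s2) (subs x0 (drop r s))) (subs x0 (take r s)))"

definition pviol :: "nat \<Rightarrow> ('a \<Rightarrow> nat) \<Rightarrow> nat \<Rightarrow> 'a list \<Rightarrow> bool" where
  "pviol q c a s \<longleftrightarrow> viol q c a (take (q - 1) s) \<and> viol q c a (drop (q - 1) s)"

lemma length_subs: "w \<in> set (subs x0 s) \<Longrightarrow> length w = length s"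
  by (auto simp: subs_def)

lemma map_subs: "map (map f) (subs x0 s) = subs (f x0) (map f s)"
  by (simp add: subs_def map_update)

lemma map_boxes: "map (map f) (boxes r x0 s) = boxes r (f x0) (map f s)"
proof -
  have *: "map (map f) (concat (map (\<lambda>s1. map (\<lambda>s2. s1 @ s2) B) A)) =
     concat (map (\<lambda>s1. map (\<lambda>s2. s1 @ s2) (map (map f) B)) (map (map f) A))" for A B
    by (induction A) auto
  show ?thesis unfolding boxes_def * map_subs by (simp add: take_map drop_map)
qed

lemma boxes_eq_Cons: "boxes r x0 s = s # tl (boxes r x0 s)"
  by (simp add: boxes_def subs_def)

lemma length_boxes: "w \<in> set (boxes r x0 s) \<Longrightarrow> length w = length s"
  by (auto simp: boxes_def dest!: length_subs)

lemma set_subs: "w \<in> set (subs x0 s) \<Longrightarrow> set w \<subseteq> insert x0 (set s)"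
  by (auto simp: subs_def dest: set_update_subset_insert[THEN subsetD])

lemma set_boxes:
  assumes "w \<in> set (boxes r x0 s)"
  shows "set w \<subseteq> insert x0 (set s)"
proof -
  obtain s1 s2 where w: "w = s1 @ s2" "s1 \<in> set (subs x0 (take r s))" "s2 \<in> set (subs x0 (drop r s))"
    using assms by (auto simp: boxes_def)
  then show ?thesis
    using set_subs[OF w(2)] set_subs[OF w(3)] set_take_subset[of r s] set_drop_subset[of r s] by auto
qed

lemma tl_boxes_mem:
  assumes "w \<in> set (tl (boxes r x0 s))"
  shows "x0 \<in> set w"
proof -
  have tl_subs: "x0 \<in> set w" if "w \<in> set (tl (subs x0 s))" for w and s :: "'a list"
    using that by (auto simp: subs_def intro: set_update_memI)
  have "tl (boxes r x0 s) = map (\<lambda>s2. take r s @ s2) (tl (subs x0 (drop r s))) @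
      concat (map (\<lambda>s1. map (\<lambda>s2. s1 @ s2) (subs x0 (drop r s))) (tl (subs x0 (take r s))))"
    by (simp add: boxes_def subs_def)
  with assms show ?thesis by (auto dest: tl_subs)
qed

lemma length_filter_product:
  "(\<And>s1. s1 \<in> set A \<Longrightarrow> length s1 = r) \<Longrightarrow>
   length (filter (\<lambda>w. P (take r w) \<and> Q (drop r w)) (concat (map (\<lambda>s1. map (\<lambda>s2. s1 @ s2) B) A))) =
   length (filter P A) * length (filter Q B)"
proof (induction A)
  case (Cons a A)
  have "length (filter (\<lambda>w. P (take r w) \<and> Q (drop r w)) (map (\<lambda>s2. a @ s2) B)) =
      (if P a then length (filter Q B) else 0)"
    using Cons.prems[of a] by (simp add: filter_map comp_def)
  with Cons show ?case by simp
qed simp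

text \<open>The number of violated pairs in a box with missing colour \<open>a\<close> has a parity that does not
  depend on \<open>a\<close>; adding up two colours therefore gives a linear relation over the field
  with two elements, in which every term other than \<open>s\<close> itself contains \<open>x0\<close>.\<close>

lemma odd_pviol_boxes:
  assumes q: "q \<ge> 2" and len: "length s = 2 * (q - 1)"
    and c: "\<And>x. x \<in> set (x0 # s) \<Longrightarrow> c x < q" and ab: "a < q" "b < q" "a \<noteq> b"
  shows "odd (length (filter (\<lambda>w. pviol q c a w \<or> pviol q c b w) (tl (boxes (q - 1) x0 s)))) \<longleftrightarrow>
    pviol q c a s \<or> pviol q c b s"
proof -
  let ?r = "q - 1" and ?S1 = "subs x0 (take (q - 1) s)" and ?S2 = "subs x0 (drop (q - 1) s)"
  have l: "Suc (length (take ?r s)) = q" "Suc (length (drop ?r s)) = q" using q len by auto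
  have c1: "c x < q" if "x \<in> set (x0 # take ?r s)" for x using that c in_set_takeD by fastforce
  have c2: "c x < q" if "x \<in> set (x0 # drop ?r s)" for x using that c in_set_dropD by fastforce
  have count: "length (filter (pviol q c a) (boxes ?r x0 s)) =
      length (filter (viol q c a) ?S1) * length (filter (viol q c a) ?S2)" for a
  proof -
    have "length s1 = ?r" if "s1 \<in> set ?S1" for s1 using length_subs[OF that] len by simp
    from length_filter_product[OF this, of ?S1 "viol q c a" "viol q c a" ?S2]
    show ?thesis by (simp add: boxes_def pviol_def[abs_def])
  qed
  have o1: "odd (length (filter (viol q c a) ?S1)) \<longleftrightarrow> c ` set (x0 # take ?r s) = {..<q}" if "a < q" for a
    using odd_viol_subs[OF l(1), of x0 c a] c1 that by blast
  have o2: "odd (length (filter (viol q c a) ?S2)) \<longleftrightarrow> c ` set (x0 # drop ?r s) = {..<q}" if "a < q" for a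
    using odd_viol_subs[OF l(2), of x0 c a] c2 that by blast
  have "odd (length (filter (pviol q c a) (boxes ?r x0 s))) =
      odd (length (filter (pviol q c b) (boxes ?r x0 s)))"
    unfolding count even_mult_iff using o1[OF ab(1)] o1[OF ab(2)] o2[OF ab(1)] o2[OF ab(2)] by blast
  \<comment> \<open>No list misses exactly \<open>a\<close> and also exactly \<open>b\<close>, so
    the two kinds of violation exclude each other and their counts add up; being of equal parity,
    they have an even sum.\<close>
  moreover have "\<not> (pviol q c a w \<and> pviol q c b w)" for w
    using ab unfolding pviol_def viol_def by blast
  then have "length (filter (\<lambda>w. pviol q c a w \<or> pviol q c b w) W) =
      length (filter (pviol q c a) W) + length (filter (pviol q c b) W)" for W
    by (induction W) auto
  ultimately have "even (length (filter (\<lambda>w. pviol q c a w \<or> pviol q c b w) (boxes ?r x0 s)))"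
    by simp
  then show ?thesis by (subst (asm) boxes_eq_Cons) (auto split: if_splits)
qed

text \<open>\<open>A\<close> and \<open>B\<close> are the colours seen by the two ends of an edge
  outside \<open>X\<close>. If every free colour of one end equals every free colour of the other,
  both ends have a single free colour and it is the same one.\<close>

lemma pair_ext:
  assumes "A \<subseteq> {..<q}" "B \<subseteq> {..<q}" "A \<noteq> {..<q}" "B \<noteq> {..<q}"
    and "\<not> (\<exists>a<q. A = {..<q} - {a} \<and> B = {..<q} - {a})"
  shows "\<exists>\<alpha><q. \<exists>\<beta><q. \<alpha> \<noteq> \<beta> \<and> \<alpha> \<notin> A \<and> \<beta> \<notin> B"
proof (rule ccontr)
  assume no: "\<not> ?thesis"
  obtain \<alpha> \<beta> where \<alpha>: "\<alpha> < q" "\<alpha> \<notin> A" and \<beta>: "\<beta> < q" "\<beta> \<notin> B" using assms(1-4) by blast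
  with no have "\<beta> = \<alpha>" by blast
  then have "A = {..<q} - {\<alpha>}" "B = {..<q} - {\<alpha>}" using no \<alpha> \<beta> assms(1,2) by blast+
  with assms(5) \<alpha> show False by blast
qed

text \<open>One preimage per colour suffices. In this way a neighbourhood that shows a given set of
  colours shrinks to a list of bounded length, hence to one of the constraints.\<close>

lemma image_list:
  assumes "C \<subseteq> c ` N" "finite C"
  shows "\<exists>s. set s \<subseteq> N \<and> c ` set s = C \<and> length s = card C"
proof -
  obtain xs where xs: "set xs = C" "length xs = card C"
    using finite_distinct_list[OF assms(2)] distinct_card by metis
  have inv: "inv_into N c y \<in> N" "c (inv_into N c y) = y" if "y \<in> C" for y
    using that assms(1) by (auto intro: inv_into_into f_inv_into_f)
  have "c ` set (map (inv_into N c) xs) = C" using xs inv(2) by (force simp: image_image)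
  then show ?thesis using xs inv(1) by (intro exI[of _ "map (inv_into N c) xs"]) auto
qed

text \<open>The fresh vertices of a gadget are numbered in pairs after the ranks
  \<open>R y < k\<close> of the vertices of \<open>X\<close>, so that a counter is enough to name
  them.\<close>

definition gedges :: "(nat \<Rightarrow> nat) \<Rightarrow> nat \<Rightarrow> (nat list \<times> nat list) list \<Rightarrow> (nat \<times> nat) list" where
  "gedges R k gs = concat (map (\<lambda>i.
     (k + 2 * i, k + 2 * i + 1) # map (\<lambda>y. (k + 2 * i, R y)) (fst (gs ! i)) @
       map (\<lambda>y. (k + 2 * i + 1, R y)) (snd (gs ! i))) [0..<length gs])"

lemma gedges_Nil [simp]: "gedges R k [] = []"
  by (simp add: gedges_def)

lemma gedges_snoc: "gedges R k (gs @ [g]) = gedges R k gs @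
    (k + 2 * length gs, k + 2 * length gs + 1) # map (\<lambda>y. (k + 2 * length gs, R y)) (fst g) @
       map (\<lambda>y. (k + 2 * length gs + 1, R y)) (snd g)"
proof -
  define F where "F gs i = (k + 2 * i, k + 2 * i + 1) # map (\<lambda>y. (k + 2 * i, R y)) (fst (gs ! i)) @
       map (\<lambda>y. (k + 2 * i + 1, R y)) (snd (gs ! i))" for i and gs :: "(nat list \<times> nat list) list"
  have F: "gedges R k gs = concat (map (F gs) [0..<length gs])" for gs
    unfolding gedges_def F_def[abs_def] ..
  have "map (F (gs @ [g])) [0..<length gs] = map (F gs) [0..<length gs]"
    by (intro map_cong refl) (simp add: F_def nth_append)
  then have "gedges R k (gs @ [g]) = gedges R k gs @ F (gs @ [g]) (length gs)"
    by (simp add: F del: map_eq_conv)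
  then show ?thesis by (simp add: F_def)
qed

lemma mem_gedges:
  "(a, b) \<in> set (gedges R k gs) \<longleftrightarrow> (\<exists>i<length gs.
     a = k + 2 * i \<and> b = k + 2 * i + 1 \<or>
     a = k + 2 * i \<and> b \<in> R ` set (fst (gs ! i)) \<or>
     a = k + 2 * i + 1 \<and> b \<in> R ` set (snd (gs ! i)))"
  by (auto simp: gedges_def)

definition edges_of :: "(nat \<times> nat) list \<Rightarrow> nat set set" where
  "edges_of es = {{u, v} |u v. (u, v) \<in> set es}"

lemma proper_edges_of:
  "proper_coloring q V (edges_of es) c \<longleftrightarrow>
    (\<forall>v\<in>V. c v < q) \<and> (\<forall>(u, v)\<in>set es. c u \<noteq> c v)"
proof
  assume "proper_coloring q V (edges_of es) c"
  then show "(\<forall>v\<in>V. c v < q) \<and> (\<forall>(u, v)\<in>set es. c u \<noteq> c v)"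
    unfolding proper_coloring_def edges_of_def by blast
next
  assume *: "(\<forall>v\<in>V. c v < q) \<and> (\<forall>(u, v)\<in>set es. c u \<noteq> c v)"
  have "c u \<noteq> c v" if "{u, v} \<in> edges_of es" for u v
  proof -
    have "\<exists>a b. {u, v} = {a, b} \<and> (a, b) \<in> set es"
      using that by (simp only: edges_of_def mem_Collect_eq)
    then obtain a b where ab: "{u, v} = {a, b}" "(a, b) \<in> set es" by (elim exE conjE)
    then have "c a \<noteq> c b" using * by blast
    then show ?thesis using ab(1) by (auto simp: doubleton_eq_iff)
  qed
  with * show "proper_coloring q V (edges_of es) c" by (auto simp: proper_coloring_def)
qed

section \<open>The reduced graph\<close>

text \<open>The graph theory does not depend on how the selection is found: \<open>sel2\<close> may
  be any list of candidates such that, for every two colours, respecting it implies respecting all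
  candidates. Two colours occur because the relations hold for pairs of colours.\<close>

locale reduction =
  fixes q n :: nat and E :: "nat set set" and X :: "nat set" and k :: nat and R :: "nat \<Rightarrow> nat"
    and xes :: "(nat \<times> nat) list" and sel1 sel2 cand2 :: "nat list list"
  assumes q: "q \<ge> 3"
    and graph: "simple_graph {..<n} E" and modulator: "deg1_modulator {..<n} E X"
    and R: "bij_betw R X {..<k}"
    and xes: "set xes = {(R u, R v) |u v. u \<in> X \<and> v \<in> X \<and> {u, v} \<in> E}"
    and sel1: "set sel1 = {s. length s = q \<and> set s \<subseteq> X \<and>
      (\<exists>v<n. v \<notin> X \<and> (\<forall>y\<in>set s. {v, y} \<in> E))}"
    and cand2: "set cand2 = {s. length s = 2 * (q - 1) \<and> set s \<subseteq> X \<and>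
      (\<exists>u<n. \<exists>v<n. u \<notin> X \<and> v \<notin> X \<and> {u, v} \<in> E \<and>
        (\<forall>y\<in>set (take (q - 1) s). {u, y} \<in> E) \<and> (\<forall>y\<in>set (drop (q - 1) s). {v, y} \<in> E))}"
    and sel2: "set sel2 \<subseteq> set cand2"
    and implied: "\<And>c a b. (\<And>x. x \<in> X \<Longrightarrow> c x < q) \<Longrightarrow> a < q \<Longrightarrow> b < q \<Longrightarrow> a \<noteq> b \<Longrightarrow>
      (\<forall>s\<in>set sel2. \<not> (pviol q c a s \<or> pviol q c b s)) \<Longrightarrow>
      (\<forall>s\<in>set cand2. \<not> (pviol q c a s \<or> pviol q c b s))"
begin

text \<open>A constraint of the first kind also receives two fresh vertices, the second without
  neighbours in \<open>X\<close>; all gadgets then have the same shape.\<close>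

definition gadgets :: "(nat list \<times> nat list) list" where
  "gadgets = map (\<lambda>s. (s, [])) sel1 @ map (\<lambda>s. (take (q - 1) s, drop (q - 1) s)) sel2"

definition out_edges :: "(nat \<times> nat) list" where
  "out_edges = xes @ gedges R k gadgets"

abbreviation "n_out \<equiv> k + 2 * length gadgets"

lemma X_sub: "X \<subseteq> {..<n}"
  using modulator by (simp add: deg1_modulator_def)

lemma edge_lt: "{u, v} \<in> E \<Longrightarrow> u < n \<and> v < n \<and> u \<noteq> v"
proof -
  assume "{u, v} \<in> E"
  moreover have "\<forall>e\<in>E. e \<subseteq> {..<n} \<and> card e = 2" using graph by (simp add: simple_graph_def)
  ultimately have "{u, v} \<subseteq> {..<n}" "card {u, v} = 2" by auto
  then show ?thesis by (cases "u = v") auto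
qed

lemma gadget_sub: "(A, B) \<in> set gadgets \<Longrightarrow> set A \<subseteq> X \<and> set B \<subseteq> X"
proof -
  assume "(A, B) \<in> set gadgets"
  then consider "A \<in> set sel1" "B = []" |
    s where "s \<in> set cand2" "A = take (q - 1) s" "B = drop (q - 1) s"
    unfolding gadgets_def using sel2 by auto
  then show ?thesis
  proof cases
    case 1
    then show ?thesis unfolding sel1 by simp
  next
    case 2
    then have "set s \<subseteq> X" unfolding cand2 by simp
    then show ?thesis using 2 set_take_subset[of "q - 1" s] set_drop_subset[of "q - 1" s] by auto
  qed
qed

lemma R_lt: "x \<in> X \<Longrightarrow> R x < k"
  using R by (auto simp: bij_betw_def)

lemma partner_unique: "{v, w} \<in> E \<Longrightarrow> {v, w'} \<in> E \<Longrightarrow> v \<notin> X \<Longrightarrow> w \<notin> X \<Longrightarrow> w' \<notin> X \<Longrightarrow> w = w'"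
proof (rule ccontr)
  assume *: "{v, w} \<in> E" "{v, w'} \<in> E" "v \<notin> X" "w \<notin> X" "w' \<notin> X" "w \<noteq> w'"
  have "\<forall>e\<in>E. e \<subseteq> {..<n}" using graph by (simp add: simple_graph_def)
  then have "{e \<in> delete_edges E X. v \<in> e} \<subseteq> Pow {..<n}" unfolding delete_edges_def by blast
  then have fin: "finite {e \<in> delete_edges E X. v \<in> e}" by (rule finite_subset) simp
  have "{{v, w}, {v, w'}} \<subseteq> {e \<in> delete_edges E X. v \<in> e}" using * by (auto simp: delete_edges_def)
  from card_mono[OF fin this] have "2 \<le> degree_in (delete_edges E X) v"
    using * by (simp add: degree_in_def doubleton_eq_iff)
  moreover have "v \<in> {..<n} - X" using edge_lt[OF *(1)] * by auto
  then have "degree_in (delete_edges E X) v \<le> 1" using modulator unfolding deg1_modulator_def by blast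
  ultimately show False by simp
qed

text \<open>Pulling the colouring back along \<open>R\<close> colours \<open>X\<close>. A coloured
  gadget witnesses that its constraint is respected, and \<open>implied\<close> passes from
  \<open>sel2\<close> to all candidates. A bad neighbourhood outside \<open>X\<close> would contain
  a violated tuple, so every edge and every single vertex there still has suitable colours.\<close>

lemma colorable_out_imp:
  assumes "colorable q {..<n_out} (edges_of out_edges)"
  shows "colorable q {..<n} E"
proof -
  obtain c' where "proper_coloring q {..<n_out} (edges_of out_edges) c'"
    using assms unfolding colorable_def by blast
  then have c': "\<And>v. v < n_out \<Longrightarrow> c' v < q" "\<And>u v. (u, v) \<in> set out_edges \<Longrightarrow> c' u \<noteq> c' v"
    unfolding proper_edges_of by auto
  define c where "c = (\<lambda>x. c' (R x))"
  have cX: "c x < q" if "x \<in> X" for x using c'(1)[of "R x"] R_lt[OF that] by (simp add: c_def)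
  have gad: "\<exists>\<alpha><q. \<exists>\<beta><q. \<alpha> \<noteq> \<beta> \<and> \<alpha> \<notin> c ` set A \<and> \<beta> \<notin> c ` set B" if AB: "(A, B) \<in> set gadgets" for A B
  proof -
    obtain i where i: "i < length gadgets" "gadgets ! i = (A, B)" using AB by (metis in_set_conv_nth)
    have e: "(a, b) \<in> set out_edges"
      if "a = k + 2 * i \<and> b = k + 2 * i + 1 \<or> a = k + 2 * i \<and> b \<in> R ` set A \<or>
        a = k + 2 * i + 1 \<and> b \<in> R ` set B" for a b
      using that i unfolding out_edges_def set_append Un_iff mem_gedges by (metis fst_conv snd_conv)
    have "c' (k + 2 * i) < q" "c' (k + 2 * i + 1) < q" using i by (auto intro!: c'(1))
    moreover have "c' (k + 2 * i) \<noteq> c' (k + 2 * i + 1)" by (intro c'(2) e) auto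
    moreover have "c' (k + 2 * i) \<notin> c ` set A"
      using c'(2)[OF e, of "k + 2 * i"] by (auto simp: c_def)
    moreover have "c' (k + 2 * i + 1) \<notin> c ` set B"
      using c'(2)[OF e, of "k + 2 * i + 1"] by (auto simp: c_def)
    ultimately show ?thesis by blast
  qed
  have s1: "c ` set s \<noteq> {..<q}" if "s \<in> set sel1" for s
    using gad[of s "[]"] that by (auto simp: gadgets_def)
  have s2: "\<not> (\<exists>a<q. pviol q c a s)" if "s \<in> set sel2" for s
    using gad[of "take (q - 1) s" "drop (q - 1) s"] that
    by (auto simp: gadgets_def pviol_def viol_def)
  have c2: "\<not> pviol q c a s" if "s \<in> set cand2" "a < q" for s a
  proof -
    \<comment> \<open>\<open>implied\<close> speaks about two colours; any colour other than
      \<open>a\<close> can be the second one.\<close>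
    define b where "b = (if a = 0 then 1 else 0 :: nat)"
    have "b < q" "a \<noteq> b" using q by (auto simp: b_def)
    then show ?thesis using implied[of c a b, OF cX that(2)] s2 that by blast
  qed
  define N where "N v = {y \<in> X. {v, y} \<in> E}" for v
  have N_sub: "c ` N v \<subseteq> {..<q}" for v using cX by (auto simp: N_def)
  have N1: "c ` N v \<noteq> {..<q}" if v: "v < n" "v \<notin> X" for v
  proof
    assume "c ` N v = {..<q}"
    then obtain s where s: "set s \<subseteq> N v" "c ` set s = {..<q}" "length s = q"
      using image_list[of "{..<q}" c "N v"] by auto
    then have "s \<in> set sel1" using v unfolding sel1 by (auto simp: N_def)
    with s1 s show False by blast
  qed
  have N2: "\<not> (\<exists>a<q. c ` N u = {..<q} - {a} \<and> c ` N v = {..<q} - {a})"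
    if uv: "u < n" "u \<notin> X" "v < n" "v \<notin> X" "{u, v} \<in> E" for u v
  proof
    assume "\<exists>a<q. c ` N u = {..<q} - {a} \<and> c ` N v = {..<q} - {a}"
    then obtain a where a: "a < q" "c ` N u = {..<q} - {a}" "c ` N v = {..<q} - {a}" by blast
    obtain s where s: "set s \<subseteq> N u" "c ` set s = {..<q} - {a}" "length s = q - 1"
      using image_list[of "{..<q} - {a}" c "N u"] a by auto
    obtain s' where s': "set s' \<subseteq> N v" "c ` set s' = {..<q} - {a}" "length s' = q - 1"
      using image_list[of "{..<q} - {a}" c "N v"] a by auto
    have "s @ s' \<in> set cand2"
    proof -
      have "set s \<subseteq> X" "set s' \<subseteq> X" "\<forall>y\<in>set s. {u, y} \<in> E" "\<forall>y\<in>set s'. {v, y} \<in> E"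
        using s(1) s'(1) by (auto simp: N_def)
      then show ?thesis unfolding cand2 mem_Collect_eq using uv s(3) s'(3)
        by (intro conjI exI[of _ u] exI[of _ v]) auto
    qed
    moreover have "pviol q c a (s @ s')" using s s' by (simp add: pviol_def viol_def)
    ultimately show False using c2 a by blast
  qed
  have "\<exists>z. fst z < q \<and> snd z < q \<and> fst z \<noteq> snd z \<and> fst z \<notin> c ` N u \<and> snd z \<notin> c ` N v"
    if "u < n" "u \<notin> X" "v < n" "v \<notin> X" "{u, v} \<in> E" for u v
    using pair_ext[OF N_sub N_sub N1[OF that(1,2)] N1[OF that(3,4)] N2[OF that]] by auto
  then obtain Z where Z: "\<And>u v. u < n \<Longrightarrow> u \<notin> X \<Longrightarrow> v < n \<Longrightarrow> v \<notin> X \<Longrightarrow> {u, v} \<in> E \<Longrightarrow>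
      fst (Z u v) < q \<and> snd (Z u v) < q \<and> fst (Z u v) \<noteq> snd (Z u v) \<and>
      fst (Z u v) \<notin> c ` N u \<and> snd (Z u v) \<notin> c ` N v"
    by metis
  have "\<exists>\<alpha>. \<alpha> < q \<and> \<alpha> \<notin> c ` N v" if "v < n" "v \<notin> X" for v
    using N1[OF that] N_sub[of v] by auto
  then obtain Y where Y: "\<And>v. v < n \<Longrightarrow> v \<notin> X \<Longrightarrow> Y v < q \<and> Y v \<notin> c ` N v" by metis
  define p where "p v = (THE w. w \<notin> X \<and> {v, w} \<in> E)" for v
  have p: "p v = w" if "{v, w} \<in> E" "v \<notin> X" "w \<notin> X" for v w
    unfolding p_def using that partner_unique by blast
  \<comment> \<open>Both ends of an edge must take their colours from the same pair, so the pair is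
    always the one chosen for the smaller end followed by the larger one.\<close>
  define d where "d v = (if v \<in> X then c v
     else if \<exists>w. w \<notin> X \<and> {v, w} \<in> E
     then if v < p v then fst (Z v (p v)) else snd (Z (p v) v) else Y v)" for v
  have d_off: "d v < q \<and> d v \<notin> c ` N v" if v: "v < n" "v \<notin> X" for v
  proof (cases "\<exists>w. w \<notin> X \<and> {v, w} \<in> E")
    case True
    then obtain w where w: "w \<notin> X" "{v, w} \<in> E" by blast
    have "{w, v} \<in> E" using w by (simp add: insert_commute)
    then show ?thesis
      using w v p[OF w(2) v(2) w(1)] edge_lt[OF w(2)] Z[of v w] Z[of w v] by (auto simp: d_def)
  next
    case False
    then show ?thesis using Y[OF v] v by (auto simp: d_def)
  qed
  have XX: "c u \<noteq> c v" if "u \<in> X" "v \<in> X" "{u, v} \<in> E" for u v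
    using that c'(2)[of "R u" "R v"] by (auto simp: out_edges_def xes c_def)
  have "d u \<noteq> d v" if uv: "{u, v} \<in> E" for u v
  proof -
    have vu: "{v, u} \<in> E" using uv by (simp add: insert_commute)
    note lt = edge_lt[OF uv]
    consider "u \<in> X" "v \<in> X" | "u \<in> X" "v \<notin> X" | "u \<notin> X" "v \<in> X" | "u \<notin> X" "v \<notin> X" by blast
    then show ?thesis
    proof cases
      case 1
      then show ?thesis using XX uv by (simp add: d_def)
    next
      case 2
      then have "c u \<in> c ` N v" using vu by (auto simp: N_def)
      moreover have "d u = c u" using 2 by (simp add: d_def)
      ultimately show ?thesis using d_off[of v] lt 2 by metis
    next
      case 3
      then have "c v \<in> c ` N u" using uv by (auto simp: N_def)
      moreover have "d v = c v" using 3 by (simp add: d_def)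
      ultimately show ?thesis using d_off[of u] lt 3 by metis
    next
      case 4
      have "p u = v" "p v = u" using p uv vu 4 by auto
      then show ?thesis using Z[of u v] Z[of v u] lt 4 uv vu by (auto simp: d_def)
    qed
  qed
  moreover have "d v < q" if "v < n" for v
    using d_off[of v] that cX by (cases "v \<in> X") (auto simp: d_def)
  ultimately have "proper_coloring q {..<n} E d" by (auto simp: proper_coloring_def)
  then show ?thesis unfolding colorable_def by blast
qed

text \<open>Each constraint was read off a vertex or an edge outside \<open>X\<close>. Its gadget
  can copy the colours found there, because the neighbours of the gadget in \<open>X\<close> are
  also neighbours of that vertex or edge.\<close>

lemma colorable_imp_out:
  assumes "colorable q {..<n} E"
  shows "colorable q {..<n_out} (edges_of out_edges)"
proof -
  obtain c where c: "\<And>v. v < n \<Longrightarrow> c v < q" "\<And>u v. {u, v} \<in> E \<Longrightarrow> c u \<noteq> c v"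
    using assms by (auto simp: colorable_def proper_coloring_def)
  have ne: "c v \<notin> c ` A" if "\<forall>y\<in>A. {v, y} \<in> E" for v A using that c(2) by auto
  have "\<exists>z. fst z < q \<and> snd z < q \<and> fst z \<noteq> snd z \<and>
      fst z \<notin> c ` set (fst (gadgets ! i)) \<and> snd z \<notin> c ` set (snd (gadgets ! i))"
    if i: "i < length gadgets" for i
  proof -
    have "gadgets ! i \<in> set gadgets" using i by simp
    then consider s where "s \<in> set sel1" "gadgets ! i = (s, [])" |
      s where "s \<in> set cand2" "gadgets ! i = (take (q - 1) s, drop (q - 1) s)"
      unfolding gadgets_def using sel2 by fastforce
    then show ?thesis
    proof cases
      case 1
      then obtain v where v: "v < n" "\<forall>y\<in>set s. {v, y} \<in> E" unfolding sel1 by blast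
      define b where "b = (if c v = 0 then 1 else 0 :: nat)"
      have "b < q" "c v \<noteq> b" using q by (auto simp: b_def)
      then show ?thesis using 1 c(1)[OF v(1)] ne[OF v(2)] by (intro exI[of _ "(c v, b)"]) auto
    next
      case 2
      then obtain u v where "u < n" "v < n" "{u, v} \<in> E"
        "\<forall>y\<in>set (take (q - 1) s). {u, y} \<in> E" "\<forall>y\<in>set (drop (q - 1) s). {v, y} \<in> E"
        unfolding cand2 by blast
      then show ?thesis using 2 c ne by (intro exI[of _ "(c u, c v)"]) auto
    qed
  qed
  then obtain Z where Z: "\<And>i. i < length gadgets \<Longrightarrow> fst (Z i) < q \<and> snd (Z i) < q \<and> fst (Z i) \<noteq> snd (Z i) \<and>
      fst (Z i) \<notin> c ` set (fst (gadgets ! i)) \<and> snd (Z i) \<notin> c ` set (snd (gadgets ! i))"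
    by metis
  define d where "d j = (if j < k then c (inv_into X R j)
     else if even (j - k) then fst (Z ((j - k) div 2)) else snd (Z ((j - k) div 2)))" for j
  have dR: "d (R x) = c x" if "x \<in> X" for x
    using that R R_lt by (auto simp: d_def bij_betw_def)
  have dZ: "d (k + 2 * i) = fst (Z i)" "d (k + 2 * i + 1) = snd (Z i)" for i
    by (auto simp: d_def)
  have "d j < q" if "j < n_out" for j
  proof (cases "j < k")
    case True
    then have "j \<in> R ` X" using R by (auto simp: bij_betw_def)
    then show ?thesis using dR c(1) X_sub by auto
  next
    case False
    then have "(j - k) div 2 < length gadgets" using that by auto
    then show ?thesis using Z False by (auto simp: d_def)
  qed
  moreover have "d a \<noteq> d b" if ab: "(a, b) \<in> set out_edges" for a b
  proof -
    have "(a, b) \<in> set xes \<or> (a, b) \<in> set (gedges R k gadgets)" using ab by (auto simp: out_edges_def)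
    then show ?thesis
    proof
      assume "(a, b) \<in> set xes"
      then show ?thesis unfolding xes using dR c(2) by auto
    next
      assume "(a, b) \<in> set (gedges R k gadgets)"
      then obtain i where i: "i < length gadgets" and
        "a = k + 2 * i \<and> b = k + 2 * i + 1 \<or>
         a = k + 2 * i \<and> b \<in> R ` set (fst (gadgets ! i)) \<or>
         a = k + 2 * i + 1 \<and> b \<in> R ` set (snd (gadgets ! i))" unfolding mem_gedges by blast
      then consider "a = k + 2 * i" "b = k + 2 * i + 1" |
        y where "a = k + 2 * i" "b = R y" "y \<in> set (fst (gadgets ! i))" |
        y where "a = k + 2 * i + 1" "b = R y" "y \<in> set (snd (gadgets ! i))" by blast
      moreover have sub: "set (fst (gadgets ! i)) \<subseteq> X" "set (snd (gadgets ! i)) \<subseteq> X"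
        using gadget_sub[of "fst (gadgets ! i)" "snd (gadgets ! i)"] i by auto
      ultimately show ?thesis
      proof cases
        case 1
        then show ?thesis using Z[OF i] dZ[of i] by simp
      next
        case (2 y)
        have "d b = c y" using 2 dR sub(1) by auto
        then have "d b \<in> c ` set (fst (gadgets ! i))" using 2 by simp
        then show ?thesis using Z[OF i] dZ(1)[of i] 2(1) by auto
      next
        case (3 y)
        have "d b = c y" using 3 dR sub(2) by auto
        then have "d b \<in> c ` set (snd (gadgets ! i))" using 3 by simp
        then show ?thesis using Z[OF i] dZ(2)[of i] 3(1) by auto
      qed
    qed
  qed
  ultimately have "proper_coloring q {..<n_out} (edges_of out_edges) d"
    unfolding proper_edges_of by auto
  then show ?thesis unfolding colorable_def by blast
qed

lemma out_edges_lt: "(a, b) \<in> set out_edges \<Longrightarrow> a < n_out \<and> b < n_out \<and> a \<noteq> b"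
proof -
  assume "(a, b) \<in> set out_edges"
  then consider "(a, b) \<in> set xes" | "(a, b) \<in> set (gedges R k gadgets)" by (auto simp: out_edges_def)
  then show ?thesis
  proof cases
    case 1
    then obtain u v where "u \<in> X" "v \<in> X" "{u, v} \<in> E" "a = R u" "b = R v" unfolding xes by blast
    then show ?thesis using edge_lt[of u v] R R_lt[of u] R_lt[of v] by (auto simp: bij_betw_def inj_on_def)
  next
    case 2
    then obtain i where i: "i < length gadgets" and
        "a = k + 2 * i \<and> b = k + 2 * i + 1 \<or>
         a = k + 2 * i \<and> b \<in> R ` set (fst (gadgets ! i)) \<or>
         a = k + 2 * i + 1 \<and> b \<in> R ` set (snd (gadgets ! i))" unfolding mem_gedges by blast
    moreover have "set (fst (gadgets ! i)) \<subseteq> X" "set (snd (gadgets ! i)) \<subseteq> X"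
      using gadget_sub[of "fst (gadgets ! i)" "snd (gadgets ! i)"] i by auto
    ultimately have "b = a + 1 \<and> a = k + 2 * i \<or> b < k \<and> k \<le> a \<and> a \<le> k + 2 * i + 1" using R_lt by auto
    then show ?thesis using i by auto
  qed
qed

lemma out_graph: "simple_graph {..<n_out} (edges_of out_edges)"
  unfolding simple_graph_def edges_of_def
proof (intro conjI ballI)
  fix e assume "e \<in> {{u, v} |u v. (u, v) \<in> set out_edges}"
  then obtain a b where "e = {a, b}" "(a, b) \<in> set out_edges" by blast
  then show "e \<subseteq> {..<n_out}" "card e = 2" using out_edges_lt[of a b] by auto
qed simp

lemma out_modulator: "deg1_modulator {..<n_out} (edges_of out_edges) {..<k}"
proof -
  have "degree_in (delete_edges (edges_of out_edges) {..<k}) v \<le> 1" for v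
  proof -
    \<comment> \<open>An output edge with both ends outside \<open>X\<close> is the inner edge of a
      gadget, and the number of \<open>v\<close> determines the gadget.\<close>
    have "{e \<in> delete_edges (edges_of out_edges) {..<k}. v \<in> e} \<subseteq>
        {{k + 2 * ((v - k) div 2), k + 2 * ((v - k) div 2) + 1}}"
    proof
      fix e assume "e \<in> {e \<in> delete_edges (edges_of out_edges) {..<k}. v \<in> e}"
      then obtain a b where e: "e = {a, b}" "(a, b) \<in> set out_edges" "k \<le> a" "k \<le> b" "v = a \<or> v = b"
        unfolding delete_edges_def edges_of_def by auto
      have "(a, b) \<notin> set xes" using e(3) R_lt unfolding xes by force
      then have "(a, b) \<in> set (gedges R k gadgets)" using e(2) by (simp add: out_edges_def)
      then obtain i where i: "i < length gadgets" and
        *: "a = k + 2 * i \<and> b = k + 2 * i + 1 \<or>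
         a = k + 2 * i \<and> b \<in> R ` set (fst (gadgets ! i)) \<or>
         a = k + 2 * i + 1 \<and> b \<in> R ` set (snd (gadgets ! i))" unfolding mem_gedges by blast
      moreover have "set (fst (gadgets ! i)) \<subseteq> X" "set (snd (gadgets ! i)) \<subseteq> X"
        using gadget_sub[of "fst (gadgets ! i)" "snd (gadgets ! i)"] i by auto
      ultimately have "a = k + 2 * i \<and> b = k + 2 * i + 1 \<or> b < k" using R_lt by auto
      then have "a = k + 2 * i \<and> b = k + 2 * i + 1" using e(4) by simp
      then show "e \<in> {{k + 2 * ((v - k) div 2), k + 2 * ((v - k) div 2) + 1}}" using e by auto
    qed
    from card_mono[OF _ this] show ?thesis by (simp add: degree_in_def)
  qed
  then show ?thesis by (auto simp: deg1_modulator_def)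
qed

end

section \<open>Codes of instances and of tuples\<close>

fun bin_val :: "bool list \<Rightarrow> nat" where
  "bin_val [] = 0"
| "bin_val (b # bs) = of_bool b + 2 * bin_val bs"

lemma bin_val_snoc: "bin_val (bs @ [b]) = bin_val bs + of_bool b * 2 ^ length bs"
  by (induction bs) auto

lemma bin_val_bits: "bin_val (bits m) = m"
proof (induction m rule: bits.induct)
  case (1 m)
  then show ?case by (cases "m = 0") (subst bits.simps; auto simp: bits.simps[of 0])+
qed

lemma bits_canonical: "bits m = [] \<or> last (bits m)"
proof (induction m rule: bits.induct)
  case (1 m)
  show ?case
  proof (cases "m = 0")
    case False
    have b: "bits m = odd m # bits (m div 2)" using False by (subst bits.simps) simp
    show ?thesis
    proof (cases "m div 2 = 0")
      case True
      then have "m = 1" using False by linarith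
      then show ?thesis using b by (simp add: bits.simps[of 0])
    next
      case 2: False
      then have "bits (m div 2) \<noteq> []" by (subst bits.simps) simp
      then show ?thesis using 1 False b by auto
    qed
  qed (simp add: bits.simps)
qed

lemma bits_bin_val: "ds = [] \<or> last ds \<Longrightarrow> bits (bin_val ds) = ds"
proof (induction ds)
  case (Cons b ds)
  have pos: "bin_val ds > 0" if "ds \<noteq> []" "last ds" for ds
    using that by (induction ds) (auto split: if_splits)
  have "bin_val (b # ds) \<noteq> 0" using pos[of "b # ds"] Cons.prems by simp
  then show ?case using Cons by (subst bits.simps) (auto split: if_splits)
qed (simp add: bits.simps)

lemma length_bits: "m < 2 ^ j \<Longrightarrow> length (bits m) \<le> j"
proof (induction j arbitrary: m)
  case (Suc j)
  then show ?case using Suc.IH[of "m div 2"] by (subst bits.simps) auto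
qed (simp add: bits.simps)

definition dcode :: "bool list \<Rightarrow> bool list" where
  "dcode ds = concat (map (\<lambda>b. [True, b]) ds) @ [False]"

lemma nat_code_dcode: "nat_code m = dcode (bits m)"
  by (simp add: nat_code_def dcode_def)

text \<open>The marker before each digit tells whether the number continues, hence no code is a
  proper prefix of another.\<close>

lemma dcode_inj: "dcode ds @ r = dcode ds' @ r' \<Longrightarrow> ds = ds' \<and> r = r'"
proof (induction ds arbitrary: ds')
  case Nil
  then show ?case by (cases ds') (auto simp: dcode_def)
next
  case (Cons b ds)
  then show ?case by (cases ds') (auto simp: dcode_def)
qed

text \<open>The part of the input read so far may end inside the code of a number: \<open>ds\<close> are its digits
  up to now, and \<open>g\<close> says that the marker of the next digit has been read.\<close>

definition tail_code :: "bool list \<Rightarrow> bool \<Rightarrow> bool list" where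
  "tail_code ds g = concat (map (\<lambda>b. [True, b]) ds) @ (if g then [True] else [])"

lemma tail_code_neq_dcode: "tail_code ds g \<noteq> dcode ds' @ r"
proof (induction ds arbitrary: ds')
  case Nil
  then show ?case by (cases ds') (auto simp: dcode_def tail_code_def)
next
  case (Cons b ds)
  then show ?case by (cases ds') (auto simp: dcode_def tail_code_def)
qed

lemma tail_code_eq_Nil [simp]: "tail_code ds g = [] \<longleftrightarrow> ds = [] \<and> \<not> g"
  by (cases ds) (auto simp: tail_code_def)

lemma dcodes_inj:
  "concat (map dcode dss) @ tail_code ds g = concat (map dcode dss') \<Longrightarrow> dss = dss' \<and> ds = [] \<and> \<not> g"
proof (induction dss arbitrary: dss')
  case Nil
  then show ?case
    by (cases dss') (auto simp: tail_code_neq_dcode)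
next
  case (Cons d dss)
  show ?case
  proof (cases dss')
    case Nil
    then show ?thesis using Cons.prems by (simp add: dcode_def)
  next
    case (Cons d' dss'')
    then show ?thesis
      using Cons.prems dcode_inj[of d _ d'] Cons.IH[of dss''] by auto
  qed
qed

text \<open>Numbers appear as digit lists, since a parser can meet digit lists that belong to no
  number. To be the code of an instance, such a string needs in addition canonical digits and an
  even number of numbers.\<close>

definition pform :: "bool list \<Rightarrow> bool list list \<Rightarrow> bool list" where
  "pform fl dss = replicate (length fl) True @ False # fl @ concat (map dcode dss)"

definition flat :: "('a \<times> 'a) list \<Rightarrow> 'a list" where
  "flat es = concat (map (\<lambda>(u, v). [u, v]) es)"

lemma flat_simps [simp]: "flat [] = []" "flat (e # es) = fst e # snd e # flat es"
  "flat (es @ es') = flat es @ flat es'"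
  by (auto simp: flat_def split: prod.splits)

lemma length_flat [simp]: "length (flat es) = 2 * length es"
  by (induction es) auto

lemma instance_code_flat:
  "instance_code n X es = replicate n True @ [False] @ map (\<lambda>v. v \<in> X) [0..<n] @ concat (map nat_code (flat es))"
proof -
  have "concat (map (\<lambda>(u, v). nat_code u @ nat_code v) es) = concat (map nat_code (flat es))"
    by (induction es) auto
  then show ?thesis by (simp add: instance_code_def)
qed

lemma instance_code_pform:
  "instance_code n X es = pform (map (\<lambda>v. v \<in> X) [0..<n]) (map bits (flat es))"
proof -
  have "nat_code = (\<lambda>m. dcode (bits m))" by (simp add: fun_eq_iff nat_code_dcode)
  then show ?thesis by (simp add: instance_code_flat pform_def comp_def)
qed

lemma replicate_header_inj:
  "replicate n True @ False # r = replicate n' True @ False # r' \<Longrightarrow> n = n' \<and> r = r'"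
proof (induction n arbitrary: n')
  case 0
  then show ?case by (cases n') auto
next
  case (Suc n)
  then show ?case by (cases n') auto
qed

lemma replicate_neq_header: "replicate n True \<noteq> replicate n' True @ False # r'"
proof
  assume "replicate n True = replicate n' True @ False # r'"
  then have "False \<in> set (replicate n True)" by simp
  then show False by simp
qed

text \<open>The header fixes the length of the flag block and the codes of numbers are prefix-free,
  so a string of the proper form leaves only one possible reading: everything complete and nothing
  pending.\<close>

lemma partial_pform:
  assumes "replicate n True @ False # fl @ concat (map dcode dss) @ tail_code ds g = pform fl' dss'"
    and "length fl \<le> n" "length fl < n \<Longrightarrow> dss = [] \<and> ds = [] \<and> \<not> g"
  shows "length fl = n \<and> fl = fl' \<and> dss = dss' \<and> ds = [] \<and> \<not> g"
proof -
  have n: "n = length fl'" and eq: "fl @ concat (map dcode dss) @ tail_code ds g = fl' @ concat (map dcode dss')"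
    using replicate_header_inj[OF assms(1)[unfolded pform_def]] by auto
  have "length fl = n"
  proof (rule ccontr)
    assume "length fl \<noteq> n"
    then have "length fl < n" using assms(2) by simp
    moreover from this have "fl = fl' @ concat (map dcode dss')" using assms(3) eq by (simp add: tail_code_def)
    ultimately show False using n by simp
  qed
  then show ?thesis using eq n dcodes_inj[of dss ds g dss'] by auto
qed

lemma pform_inj: "pform fl dss = pform fl' dss' \<Longrightarrow> fl = fl' \<and> dss = dss'"
  using partial_pform[of "length fl" fl dss "[]" False fl' dss'] by (simp add: pform_def tail_code_def)

definition pairs :: "(nat \<Rightarrow> 'a) \<Rightarrow> nat \<Rightarrow> ('a \<times> 'a) list" where
  "pairs f m = map (\<lambda>j. (f (2 * j), f (2 * j + 1))) [0..<m]"

lemma flat_pairs: "flat (pairs f m) = map f [0..<2 * m]"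
  by (induction m) (auto simp: pairs_def)

lemma pform_is_code:
  assumes "even (length dss)" "\<And>ds. ds \<in> set dss \<Longrightarrow> ds = [] \<or> last ds"
  shows "pform fl dss = instance_code (length fl) {v. v < length fl \<and> fl ! v}
    (pairs (\<lambda>i. bin_val (dss ! i)) (length dss div 2))"
proof -
  have "map bits (flat (pairs (\<lambda>i. bin_val (dss ! i)) (length dss div 2))) = dss"
    unfolding flat_pairs
  proof (rule nth_equalityI)
    show "length (map bits (map (\<lambda>i. bin_val (dss ! i)) [0..<2 * (length dss div 2)])) = length dss"
      using assms(1) by simp
    fix i assume "i < length (map bits (map (\<lambda>i. bin_val (dss ! i)) [0..<2 * (length dss div 2)]))"
    then have "i < length dss" "i < 2 * (length dss div 2)" by auto
    moreover from this have "bits (bin_val (dss ! i)) = dss ! i" using assms(2) bits_bin_val nth_mem by blast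
    ultimately show "map bits (map (\<lambda>i. bin_val (dss ! i)) [0..<2 * (length dss div 2)]) ! i = dss ! i"
      by simp
  qed
  moreover have "map (\<lambda>v. v \<in> {v. v < length fl \<and> fl ! v}) [0..<length fl] = fl"
    by (rule nth_equalityI) auto
  ultimately show ?thesis unfolding instance_code_pform by simp
qed

lemma flat_inj: "flat es = flat es' \<Longrightarrow> es = es'"
proof (induction es arbitrary: es')
  case Nil
  then show ?case by (cases es') auto
next
  case (Cons e es)
  then show ?case by (cases es') (auto simp: prod_eq_iff)
qed

lemma instance_code_inj:
  assumes "instance_code n X es = instance_code n' X' es'"
  shows "n = n'" "X \<inter> {..<n} = X' \<inter> {..<n}" "es = es'"
proof -
  have *: "map (\<lambda>v. v \<in> X) [0..<n] = map (\<lambda>v. v \<in> X') [0..<n']" "map bits (flat es) = map bits (flat es')"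
    using assms pform_inj unfolding instance_code_pform by blast+
  from *(1) show n: "n = n'" using map_eq_imp_length_eq by fastforce
  from *(1) n show "X \<inter> {..<n} = X' \<inter> {..<n}" by auto
  have "inj bits" by (metis bin_val_bits injI)
  with *(2) have "flat es = flat es'" by (simp add: inj_map_eq_map)
  then show "es = es'" by (rule flat_inj)
qed

lemma length_instance_code:
  assumes "\<And>u v. (u, v) \<in> set es \<Longrightarrow> u < 2 ^ j \<and> v < 2 ^ j"
  shows "length (instance_code n X es) \<le> 2 * n + 1 + length es * (4 * j + 2)"
proof -
  have nc: "length (nat_code m) \<le> 2 * j + 1" if "m < 2 ^ j" for m
  proof -
    have "length (concat (map (\<lambda>b. [True, b]) ds)) = 2 * length ds" for ds :: "bool list"
      by (induction ds) auto
    then show ?thesis using length_bits[OF that] by (simp add: nat_code_def)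
  qed
  have "length (concat (map (\<lambda>(u, v). nat_code u @ nat_code v) es)) \<le> length es * (4 * j + 2)"
    using assms
  proof (induction es)
    case (Cons e es)
    obtain u v where e: "e = (u, v)" by fastforce
    have "u < 2 ^ j" "v < 2 ^ j" using Cons.prems e by auto
    note uv = nc[OF this(1)] nc[OF this(2)]
    have "length (concat (map (\<lambda>(u, v). nat_code u @ nat_code v) es)) \<le> length es * (4 * j + 2)"
      using Cons.prems by (intro Cons.IH) auto
    with uv show ?case by (simp add: e)
  qed simp
  then show ?thesis by (simp add: instance_code_def)
qed

section \<open>Tuples as numbers in base \<open>b\<close>, and how many there are\<close>

definition digs :: "nat \<Rightarrow> nat \<Rightarrow> nat \<Rightarrow> nat list" where
  "digs b m t = map (\<lambda>i. t div b ^ i mod b) [0..<m]"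

lemma length_digs [simp]: "length (digs b m t) = m"
  by (simp add: digs_def)

lemma digs_0 [simp]: "digs b 0 t = []"
  by (simp add: digs_def)

lemma digs_Suc: "digs b (Suc m) t = t mod b # digs b m (t div b)"
  unfolding digs_def map_upt_Suc by (simp add: div_mult2_eq)

lemma digs_inj: "b > 0 \<Longrightarrow> t < b ^ m \<Longrightarrow> t' < b ^ m \<Longrightarrow> digs b m t = digs b m t' \<Longrightarrow> t = t'"
proof (induction m arbitrary: t t')
  case (Suc m)
  have "t div b < b ^ m" "t' div b < b ^ m"
    using Suc.prems by (auto simp: less_mult_imp_div_less mult.commute)
  then have "t div b = t' div b" using Suc by (simp add: digs_Suc)
  moreover have "t mod b = t' mod b" using Suc.prems by (simp add: digs_Suc)
  ultimately show ?case by (metis div_mult_mod_eq)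
qed simp

lemma digs_surj: "b > 0 \<Longrightarrow> set s \<subseteq> {..<b} \<Longrightarrow> \<exists>t<b ^ length s. digs b (length s) t = s"
proof (induction s)
  case (Cons x s)
  then obtain t where t: "t < b ^ length s" "digs b (length s) t = s" by auto
  have "Suc t * b \<le> b ^ length s * b" using t by (intro mult_le_mono) auto
  then have "x + b * t < b ^ length (x # s)" using Cons.prems by (simp add: mult.commute)
  moreover have "digs b (length (x # s)) (x + b * t) = x # s"
    using Cons.prems t by (simp add: digs_Suc)
  ultimately show ?case by blast
qed simp

text \<open>Choose the position of one occurrence of \<open>x0\<close> and then the other
  \<open>m - 1\<close> entries. With \<open>m = 2q - 2\<close> this is the origin of the exponent
  \<open>2q - 3\<close>.\<close>

lemma card_lists_with:
  fixes X :: "'a set"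
  assumes "finite X"
  shows "card {s. length s = m \<and> set s \<subseteq> X \<and> x0 \<in> set s} \<le> m * card X ^ (m - 1)"
proof -
  let ?W = "{w. set w \<subseteq> X \<and> length w = m - 1}"
  have "{s. length s = m \<and> set s \<subseteq> X \<and> x0 \<in> set s} \<subseteq>
      (\<Union>i<m. (\<lambda>w. take i w @ x0 # drop i w) ` ?W)"
  proof
    fix s assume "s \<in> {s. length s = m \<and> set s \<subseteq> X \<and> x0 \<in> set s}"
    then have s: "length s = m" "set s \<subseteq> X" "x0 \<in> set s" by auto
    then obtain p r where pr: "s = p @ x0 # r" by (auto simp: in_set_conv_decomp)
    then have "s = take (length p) (p @ r) @ x0 # drop (length p) (p @ r)" by simp
    moreover have "p @ r \<in> ?W" "length p < m" using s pr by auto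
    ultimately show "s \<in> (\<Union>i<m. (\<lambda>w. take i w @ x0 # drop i w) ` ?W)" by blast
  qed
  moreover have fin: "finite ?W" using assms by (simp add: finite_lists_length_eq)
  ultimately have "card {s. length s = m \<and> set s \<subseteq> X \<and> x0 \<in> set s} \<le>
      card (\<Union>i<m. (\<lambda>w. take i w @ x0 # drop i w) ` ?W)"
    by (intro card_mono) auto
  also have "\<dots> \<le> (\<Sum>i<m. card ((\<lambda>w. take i w @ x0 # drop i w) ` ?W))"
    by (rule card_UN_le) simp
  also have "\<dots> \<le> (\<Sum>i<m. card X ^ (m - 1))"
  proof (intro sum_mono)
    fix i
    show "card ((\<lambda>w. take i w @ x0 # drop i w) ` ?W) \<le> card X ^ (m - 1)"
      using card_image_le[OF fin] card_lists_length_eq[OF assms, of "m - 1"] by simp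
  qed
  finally show ?thesis by simp
qed

lemma card_codes_with:
  assumes "finite X" "b > 0"
  shows "card {t. t < b ^ m \<and> set (digs b m t) \<subseteq> X \<and> x0 \<in> set (digs b m t)} \<le> m * card X ^ (m - 1)"
proof -
  let ?A = "{t. t < b ^ m \<and> set (digs b m t) \<subseteq> X \<and> x0 \<in> set (digs b m t)}"
  let ?L = "{s. length s = m \<and> set s \<subseteq> X \<and> x0 \<in> set s}"
  have "inj_on (digs b m) ?A" using digs_inj[OF assms(2)] by (auto simp: inj_on_def)
  then have "card ?A = card (digs b m ` ?A)" by (simp add: card_image)
  also have "\<dots> \<le> card ?L"
  proof (intro card_mono)
    show "finite ?L"
      by (rule finite_subset[OF _ finite_lists_length_eq[OF assms(1), of m]]) auto
  qed auto
  also have "\<dots> \<le> m * card X ^ (m - 1)" by (rule card_lists_with) (rule assms)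
  finally show ?thesis .
qed

lemma card_codes:
  assumes "finite X" "b > 0"
  shows "card {t. t < b ^ m \<and> set (digs b m t) \<subseteq> X} \<le> card X ^ m"
proof -
  let ?A = "{t. t < b ^ m \<and> set (digs b m t) \<subseteq> X}"
  have "inj_on (digs b m) ?A" using digs_inj[OF assms(2)] by (auto simp: inj_on_def)
  then have "card ?A = card (digs b m ` ?A)" by (simp add: card_image)
  also have "\<dots> \<le> card {s. set s \<subseteq> X \<and> length s = m}"
    using assms by (intro card_mono) (auto simp: finite_lists_length_eq)
  finally show ?thesis using assms by (simp add: card_lists_length_eq)
qed

text \<open>A vector over the field with two elements is a function into \<open>{0, 1}\<close>, of which only the
  values below \<open>N\<close> matter; \<open>l\<close> is the value of a linear functional at the unit vectors.\<close>

definition ev :: "nat \<Rightarrow> (nat \<Rightarrow> nat) \<Rightarrow> (nat \<Rightarrow> nat) \<Rightarrow> bool" where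
  "ev N l v \<longleftrightarrow> even (\<Sum>c<N. v c * l c)"

lemma even_sum_cong: "(\<And>x. x \<in> A \<Longrightarrow> even (f x) \<longleftrightarrow> even (g x)) \<Longrightarrow> even (sum f A) \<longleftrightarrow> even (sum g A)"
  for f g :: "'a \<Rightarrow> nat"
  by (induction A rule: infinite_finite_induct) auto

lemma ev_cong: "(\<And>c. c < N \<Longrightarrow> v c = w c) \<Longrightarrow> ev N l v = ev N l w"
proof -
  assume "\<And>c. c < N \<Longrightarrow> v c = w c"
  then have "(\<Sum>c<N. v c * l c) = (\<Sum>c<N. w c * l c)" by (intro sum.cong) auto
  then show ?thesis by (simp add: ev_def)
qed

lemma ev_xor:
  assumes "\<And>c. c < N \<Longrightarrow> v c \<le> 1" "\<And>c. c < N \<Longrightarrow> w c \<le> 1"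
  shows "ev N l (\<lambda>c. (v c - w c) + (w c - v c)) \<longleftrightarrow> (ev N l v \<longleftrightarrow> ev N l w)"
proof -
  have "even (((v c - w c) + (w c - v c)) * l c) \<longleftrightarrow> even (v c * l c + w c * l c)" if "c < N" for c
    using assms(1)[OF that] assms(2)[OF that] by (auto simp: le_Suc_eq)
  then have "ev N l (\<lambda>c. (v c - w c) + (w c - v c)) \<longleftrightarrow> even (\<Sum>c<N. v c * l c + w c * l c)"
    unfolding ev_def by (intro even_sum_cong) auto
  then show ?thesis by (simp add: ev_def sum.distrib)
qed

text \<open>The list \<open>W\<close> of tuples as a vector with one coordinate per code.
  Multiplicities count modulo 2, so tuples that occur twice in a box cancel.\<close>

definition phi :: "nat \<Rightarrow> nat \<Rightarrow> nat list list \<Rightarrow> nat \<Rightarrow> nat" where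
  "phi b m W c = of_bool (c < b ^ m \<and> odd (count_list W (digs b m c)))"

text \<open>The functional with the indicator of \<open>P\<close> as values at the unit vectors
  counts, modulo 2, the members of \<open>W\<close> that satisfy \<open>P\<close>. Codes are unique,
  so each member contributes at exactly one coordinate, and the coordinates from
  \<open>b ^ m\<close> on are 0.\<close>

lemma ev_phi:
  assumes "b > 0" "b ^ m \<le> N" "\<And>w. w \<in> set W \<Longrightarrow> length w = m \<and> set w \<subseteq> {..<b}"
  shows "ev N (\<lambda>c. of_bool (P (digs b m c))) (phi b m W) \<longleftrightarrow> even (length (filter P W))"
proof -
  have count: "(\<Sum>c<b ^ m. count_list W (digs b m c) * of_bool (P (digs b m c))) = length (filter P W)"
    using assms(3)
  proof (induction W)
    case (Cons w W)
    obtain t where t: "t < b ^ m" "digs b m t = w"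
      using digs_surj[OF assms(1), of w] Cons.prems[of w] by auto
    have "(\<Sum>c<b ^ m. of_bool (digs b m c = w) * of_bool (P (digs b m c))) =
        (\<Sum>c<b ^ m. if c = t then of_bool (P w) else (0::nat))"
      using t digs_inj[OF assms(1)] by (intro sum.cong) auto
    also have "\<dots> = of_bool (P w)" using t by simp
    finally have 1: "(\<Sum>c<b ^ m. of_bool (digs b m c = w) * of_bool (P (digs b m c))) = (of_bool (P w) :: nat)" .
    have "(\<Sum>c<b ^ m. count_list (w # W) (digs b m c) * of_bool (P (digs b m c))) =
      (\<Sum>c<b ^ m. of_bool (digs b m c = w) * of_bool (P (digs b m c)) +
         count_list W (digs b m c) * of_bool (P (digs b m c)))"
      by (intro sum.cong) (auto simp: algebra_simps)
    then show ?case using Cons 1 by (simp add: sum.distrib)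
  qed simp
  have "(\<Sum>c<N. phi b m W c * of_bool (P (digs b m c))) = (\<Sum>c<b ^ m. phi b m W c * of_bool (P (digs b m c)))"
    using assms(2) by (intro sum.mono_neutral_right) (auto simp: phi_def)
  moreover have "even (\<Sum>c<b ^ m. phi b m W c * of_bool (P (digs b m c))) \<longleftrightarrow>
      even (\<Sum>c<b ^ m. count_list W (digs b m c) * of_bool (P (digs b m c)))"
    by (intro even_sum_cong) (auto simp: phi_def)
  ultimately show ?thesis unfolding ev_def count by simp
qed

section \<open>Reading and checking the input\<close>

text \<open>Array 0 holds the length of the string in array 1, and the parameter. The loop bound \<open>N\<close> and
  the base \<open>b\<close> of the codes of tuples are in \<open>aN\<close> and \<open>aBase\<close>. The entry \<open>(u, v)\<close> of a matrix has the
  index \<open>u * N + v\<close>.\<close>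

abbreviation (input) "aN \<equiv> 2 :: nat"
abbreviation (input) "aBase \<equiv> 3 :: nat"
abbreviation (input) "aMode \<equiv> 10 :: nat"
abbreviation (input) "aVtx \<equiv> 11 :: nat"
abbreviation (input) "aXI \<equiv> 12 :: nat"
abbreviation (input) "aXF \<equiv> 13 :: nat"
abbreviation (input) "aVal \<equiv> 14 :: nat"
abbreviation (input) "aPow \<equiv> 15 :: nat"
abbreviation (input) "aCanon \<equiv> 16 :: nat"
abbreviation (input) "aDig \<equiv> 17 :: nat"
abbreviation (input) "aW \<equiv> 18 :: nat"
abbreviation (input) "aCnt \<equiv> 19 :: nat"
abbreviation (input) "aBad \<equiv> 20 :: nat"
abbreviation (input) "aPos \<equiv> 21 :: nat"
abbreviation (input) "aOdd \<equiv> 22 :: nat"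
abbreviation (input) "aHalf \<equiv> 23 :: nat"
abbreviation (input) "aI \<equiv> 24 :: nat"
abbreviation (input) "aMul \<equiv> 25 :: nat"
abbreviation (input) "aMod \<equiv> 26 :: nat"
abbreviation (input) "aDiv \<equiv> 27 :: nat"

abbreviation (input) "Inc e \<equiv> Add e (Const 1)"

text \<open>Expressions know only addition and truncated subtraction, so products and quotients are
  tabulated.\<close>

definition tables_prog :: prog where
  "tables_prog = PFor aI (seqs [
     PAsg aOdd (Inc (Var aI)) (NotE (Cell aOdd (Var aI))),
     PAsg aHalf (Inc (Var aI)) (Add (Cell aHalf (Var aI)) (Cell aOdd (Var aI))),
     PAsg aMul (Inc (Var aI)) (Add (Cell aMul (Var aI)) (Var aN)),
     PIf (EqE (Inc (Cell aMod (Var aI))) (Var aBase))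
       (PSeq (PAsg aMod (Inc (Var aI)) (Const 0))
             (PAsg aDiv (Inc (Var aI)) (Inc (Cell aDiv (Var aI)))))
       (PSeq (PAsg aMod (Inc (Var aI)) (Inc (Cell aMod (Var aI))))
             (PAsg aDiv (Inc (Var aI)) (Cell aDiv (Var aI))))])"

definition tables :: "nat \<Rightarrow> nat \<Rightarrow> memory \<Rightarrow> bool" where
  "tables N b s \<longleftrightarrow> (\<forall>i\<le>N. s aOdd i = i mod 2 \<and> s aHalf i = i div 2 \<and> s aMul i = i * N \<and>
     s aMod i = i mod b \<and> s aDiv i = i div b)"

text \<open>Iteration \<open>i\<close> fills the entries at \<open>i + 1\<close> from those at
  \<open>i\<close>, so the tables reach up to \<open>N\<close>; the entries at 0 are right because
  fresh memory is 0.\<close>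

lemma run_tables:
  assumes "\<And>a. a \<in> {aOdd, aHalf, aMul, aMod, aDiv} \<Longrightarrow> s a 0 = 0" "s aN 0 = N" "s aBase 0 = b" "b > 0"
  shows "tables N b (run N tables_prog s)"
proof -
  let ?I = "\<lambda>i s'. \<forall>j\<le>i. s' aOdd j = j mod 2 \<and> s' aHalf j = j div 2 \<and> s' aMul j = j * N \<and>
     s' aMod j = j mod b \<and> s' aDiv j = j div b"
  show ?thesis
    unfolding tables_prog_def tables_def
  proof (rule for_rule[where I = ?I], goal_cases)
    case 1
    then show ?case by simp
  next
    case 2
    then show ?case using assms by simp
  next
    case (3 i s')
    have v: "s' aOdd i = i mod 2" "s' aHalf i = i div 2" "s' aMul i = i * N" "s' aMod i = i mod b" "s' aDiv i = i div b"
      using 3(2) by auto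
    have "s' aN 0 = N" "s' aBase 0 = b" using 3(4)[of aN] 3(4)[of aBase] assms by auto
    with 3(2,3) v show ?case
      by (auto simp: le_Suc_eq mod_Suc div_Suc of_bool_def)
  qed
qed

definition pstep :: prog where
  "pstep = PIf (EqE (Var aMode) (Const 0))
     (PIf (Cell 1 (Var aPos)) (PAsg aVtx (Const 0) (Inc (Var aVtx))) (PAsg aMode (Const 0) (Const 1)))
     (PIf (LessE (Var aXI) (Var aVtx))
       (PSeq (PAsg aXF (Var aXI) (Cell 1 (Var aPos))) (PAsg aXI (Const 0) (Inc (Var aXI))))
       (PIf (Var aDig)
         (seqs [PIf (Cell 1 (Var aPos)) (PAsg aVal (Const 0) (Add (Var aVal) (Var aPow))) PSkip,
           PAsg aPow (Const 0) (Add (Var aPow) (Var aPow)),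
           PAsg aCanon (Const 0) (Cell 1 (Var aPos)),
           PAsg aDig (Const 0) (Const 0)])
         (PIf (Cell 1 (Var aPos)) (PAsg aDig (Const 0) (Const 1))
           (seqs [PIf (Var aCanon) PSkip (PAsg aBad (Const 0) (Const 1)),
             PAsg aW (Var aCnt) (Var aVal),
             PAsg aCnt (Const 0) (Inc (Var aCnt)),
             PAsg aVal (Const 0) (Const 0),
             PAsg aPow (Const 0) (Const 1),
             PAsg aCanon (Const 0) (Const 1)]))))"

definition parse_prog :: prog where
  "parse_prog = seqs [PAsg aPow (Const 0) (Const 1), PAsg aCanon (Const 0) (Const 1),
     PFor aPos (PIf (LessE (Var aPos) (Var 0)) pstep PSkip)]"

definition pst :: "bool list \<Rightarrow> bool list list \<Rightarrow> bool list \<Rightarrow> bool \<Rightarrow> memory \<Rightarrow> bool" where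
  "pst fl dss ds g s \<longleftrightarrow>
     s aXI 0 = length fl \<and> (\<forall>i<length fl. s aXF i = of_bool (fl ! i)) \<and>
     s aCnt 0 = length dss \<and> (\<forall>i<length dss. s aW i = bin_val (dss ! i)) \<and>
     s aBad 0 = of_bool (\<exists>ds\<in>set dss. \<not> (ds = [] \<or> last ds)) \<and>
     s aDig 0 = of_bool g \<and> s aVal 0 = bin_val ds \<and> s aPow 0 = 2 ^ length ds \<and>
     s aCanon 0 = of_bool (ds = [] \<or> last ds)"

definition pinv :: "bool list \<Rightarrow> memory \<Rightarrow> bool" where
  "pinv y s \<longleftrightarrow>
     (s aMode 0 = 0 \<and> y = replicate (s aVtx 0) True \<and> pst [] [] [] False s) \<or>
     (s aMode 0 = 1 \<and> (\<exists>fl dss ds g. pst fl dss ds g s \<and> length fl \<le> s aVtx 0 \<and>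
        (length fl < s aVtx 0 \<longrightarrow> dss = [] \<and> ds = [] \<and> \<not> g) \<and>
        y = replicate (s aVtx 0) True @ False # fl @ concat (map dcode dss) @ tail_code ds g))"

lemma run_pstep:
  assumes inv: "pinv y s" and b: "s 1 (s aPos 0) = of_bool b"
  shows "pinv (y @ [b]) (run N pstep s)"
proof (cases "s aMode 0 = 0")
  case True
  then have y: "y = replicate (s aVtx 0) True" "pst [] [] [] False s" using inv by (auto simp: pinv_def)
  show ?thesis
  proof (cases b)
    case bt: True
    then have "run N pstep s = setc aVtx 0 (Suc (s aVtx 0)) s" using True b by (simp add: pstep_def)
    then show ?thesis
      using y True bt by (simp add: pinv_def pst_def replicate_append_same)
  next
    case False
    then have "run N pstep s = setc aMode 0 1 s" using True b by (simp add: pstep_def)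
    then show ?thesis
      using y False by (auto simp: pinv_def pst_def tail_code_def)
  qed
next
  case False
  then have "s aMode 0 = 1 \<and> (\<exists>fl dss ds g. pst fl dss ds g s \<and> length fl \<le> s aVtx 0 \<and>
        (length fl < s aVtx 0 \<longrightarrow> dss = [] \<and> ds = [] \<and> \<not> g) \<and>
        y = replicate (s aVtx 0) True @ False # fl @ concat (map dcode dss) @ tail_code ds g)"
    using inv unfolding pinv_def by (elim disjE) simp_all
  then obtain fl dss ds g where m: "s aMode 0 = 1" and p: "pst fl dss ds g s"
    and l: "length fl \<le> s aVtx 0" "length fl < s aVtx 0 \<longrightarrow> dss = [] \<and> ds = [] \<and> \<not> g"
    and y: "y = replicate (s aVtx 0) True @ False # fl @ concat (map dcode dss) @ tail_code ds g"
    by blast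
  have xi: "s aXI 0 = length fl" using p by (simp add: pst_def)
  have intro: "pinv y' s'" if "s' aMode 0 = 1" "pst fl' dss' ds' g' s'" "length fl' \<le> s' aVtx 0"
      "length fl' < s' aVtx 0 \<longrightarrow> dss' = [] \<and> ds' = [] \<and> \<not> g'"
      "y' = replicate (s' aVtx 0) True @ False # fl' @ concat (map dcode dss') @ tail_code ds' g'"
    for y' s' fl' dss' ds' g'
    using that unfolding pinv_def by blast
  \<comment> \<open>The four cases are a flag, the value of a digit, the marker of a further digit,
    and the end of a number.\<close>
  consider "length fl < s aVtx 0" | "length fl = s aVtx 0" g | "length fl = s aVtx 0" "\<not> g" b
    | "length fl = s aVtx 0" "\<not> g" "\<not> b" using l by linarith
  then show ?thesis
  proof cases
    case 1
    then have r: "run N pstep s = setc aXI 0 (Suc (length fl)) (setc aXF (length fl) (of_bool b) s)"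
      using m xi b by (simp add: pstep_def)
    have d: "dss = []" "ds = []" "\<not> g" using 1 l by auto
    show ?thesis
      unfolding r by (rule intro[of _ "fl @ [b]" dss ds g])
        (use m p 1 d y in \<open>auto simp: pst_def nth_append tail_code_def less_Suc_eq\<close>)
  next
    case 2
    have g1: "s aDig 0 = 1" "s aVal 0 = bin_val ds" "s aPow 0 = 2 ^ length ds" using p 2 by (auto simp: pst_def)
    show ?thesis
      by (rule intro[of _ fl dss "ds @ [b]" False])
        (use m xi p 2 y b g1 in \<open>auto simp: pstep_def pst_def bin_val_snoc tail_code_def\<close>)
  next
    case 3
    have r: "run N pstep s = setc aDig 0 1 s" using 3 m xi b p by (simp add: pstep_def pst_def)
    show ?thesis
      unfolding r by (rule intro[of _ fl dss ds True]) (use m p 3 y in \<open>auto simp: pst_def tail_code_def\<close>)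
  next
    case 4
    have g0: "s aDig 0 = 0" "s aCanon 0 = of_bool (ds = [] \<or> last ds)" "s aCnt 0 = length dss" "s aVal 0 = bin_val ds"
      using p 4 by (auto simp: pst_def)
    show ?thesis
      by (rule intro[of _ fl "dss @ [ds]" "[]" False])
        (use m xi p 4 y b g0 in \<open>auto simp: pstep_def pst_def tail_code_def dcode_def nth_append less_Suc_eq\<close>)
  qed
qed

lemma run_parse:
  assumes "length x \<le> N" "s 0 0 = length x" "\<And>i. i < length x \<Longrightarrow> s 1 i = of_bool (x ! i)"
    and "\<And>a. a \<in> {aMode, aVtx, aXI, aVal, aDig, aCnt, aBad} \<Longrightarrow> s a 0 = 0"
  shows "pinv x (run N parse_prog s)"
proof -
  let ?I = "\<lambda>i s'. pinv (take i x) s'"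
  define s1 where "s1 = setc aCanon 0 1 (setc aPow 0 1 s)"
  have upd: "pinv y (setc aPos 0 i s') = pinv y s'" for y i s'
    by (simp add: pinv_def pst_def)
  have "?I N (run N (PFor aPos (PIf (LessE (Var aPos) (Var 0)) pstep PSkip)) s1)"
  proof (rule for_rule[where I = ?I], goal_cases)
    case 1
    then show ?case by (simp add: pstep_def)
  next
    case 2
    then show ?case unfolding upd using assms by (simp add: s1_def pinv_def pst_def)
  next
    case (3 i s')
    have fr: "s' 0 = s 0" "s' 1 = s 1" using 3(4)[of 0] 3(4)[of 1] by (simp_all add: pstep_def s1_def)
    show ?case
    proof (cases "i < length x")
      case True
      then have "pinv (take i x @ [x ! i]) (run N pstep s')"
        using 3 fr assms by (intro run_pstep) auto
      then show ?thesis unfolding upd using True 3 fr assms by (simp add: take_Suc_conv_app_nth)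
    next
      case False
      then show ?thesis unfolding upd using 3 fr assms by simp
    qed
  qed
  then show ?thesis using assms(1) by (simp add: parse_prog_def s1_def)
qed

section \<open>Bounded search and the acceptance test of the parser\<close>

definition scan :: "nat list \<Rightarrow> exp \<Rightarrow> nat \<Rightarrow> nat \<Rightarrow> prog" where
  "scan vs e r c = foldr PFor vs (PIf e (PAsg r (Const 0) (Const c)) PSkip)"

lemma writes_scan [simp]: "writes (scan vs e r c) = insert r (set vs)"
  by (induction vs) (auto simp: scan_def)

lemma wf_scan [simp]:
  "wf_prog B (scan vs e r c) \<longleftrightarrow> distinct vs \<and> r \<notin> set vs \<and> B \<notin> insert r (set vs)"
proof (induction vs)
  case (Cons v vs)
  have "writes (foldr PFor vs (PIf e (PAsg r (Const 0) (Const c)) PSkip)) = insert r (set vs)"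
    using writes_scan[of vs] by (simp add: scan_def)
  then show ?case using Cons by (auto simp: scan_def)
qed (auto simp: scan_def)

text \<open>Every hit stores the same constant and nothing resets the flag, so at the end it tells
  whether some tuple of counter values satisfied the test. The assumption on \<open>e\<close> makes
  the outcome of the test a matter of the counters only.\<close>

lemma run_scan:
  assumes "distinct vs" "r \<notin> set vs"
    and "\<And>s'. (\<And>a. a \<notin> insert r (set vs) \<Longrightarrow> s' a = s a) \<Longrightarrow> eval_exp e s' \<noteq> 0 \<longleftrightarrow> P (map (\<lambda>v. s' v 0) vs)"
  shows "run N (scan vs e r c) s r 0 =
    (if \<exists>xs. length xs = length vs \<and> set xs \<subseteq> {..<N} \<and> P xs then c else s r 0)"
  using assms
proof (induction vs arbitrary: s P)
  case Nil
  then show ?case by (auto simp: scan_def)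
next
  case (Cons v vs)
  let ?Q = "\<lambda>i. \<exists>xs. length xs = length vs \<and> set xs \<subseteq> {..<N} \<and> P (i # xs)"
  let ?I = "\<lambda>i s'. s' r 0 = (if \<exists>j<i. ?Q j then c else s r 0)"
  have vr: "v \<noteq> r" "r \<notin> set vs" "v \<notin> set vs" "distinct vs" using Cons.prems by auto
  have "?I N (run N (PFor v (scan vs e r c)) s)"
  proof (rule for_rule[where I = ?I], goal_cases)
    case (3 i s')
    have "run N (scan vs e r c) s' r 0 = (if ?Q i then c else s' r 0)"
    proof (rule Cons.IH[where P = "\<lambda>xs. P (i # xs)"])
      fix s'' assume s'': "\<And>a. a \<notin> insert r (set vs) \<Longrightarrow> s'' a = s' a"
      have "s'' v 0 = i" using s''[of v] 3(3) vr by simp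
      moreover have "eval_exp e s'' \<noteq> 0 \<longleftrightarrow> P (map (\<lambda>v. s'' v 0) (v # vs))"
        by (rule Cons.prems(3)) (use s'' 3(4) in auto)
      ultimately show "eval_exp e s'' \<noteq> 0 \<longleftrightarrow> P (i # map (\<lambda>v. s'' v 0) vs)" by simp
    qed (use vr in auto)
    then show ?case using 3(2) vr by (auto simp: less_Suc_eq)
  qed (use vr in auto)
  moreover have "(\<exists>j<N. ?Q j) \<longleftrightarrow> (\<exists>xs. length xs = length (v # vs) \<and> set xs \<subseteq> {..<N} \<and> P xs)"
  proof
    assume "\<exists>j<N. ?Q j"
    then obtain j xs where "j < N" "length xs = length vs" "set xs \<subseteq> {..<N}" "P (j # xs)" by blast
    then show "\<exists>xs. length xs = length (v # vs) \<and> set xs \<subseteq> {..<N} \<and> P xs"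
      by (intro exI[of _ "j # xs"]) auto
  next
    assume "\<exists>xs. length xs = length (v # vs) \<and> set xs \<subseteq> {..<N} \<and> P xs"
    then obtain xs where "length xs = Suc (length vs)" "set xs \<subseteq> {..<N}" "P xs" by auto
    then show "\<exists>j<N. ?Q j" by (cases xs) auto
  qed
  ultimately show ?case by (simp add: scan_def)
qed

abbreviation (input) "aOk \<equiv> 30 :: nat"
abbreviation (input) "aAdj \<equiv> 31 :: nat"
abbreviation (input) "aA \<equiv> 32 :: nat"
abbreviation (input) "aB \<equiv> 33 :: nat"
abbreviation (input) "aC \<equiv> 34 :: nat"
abbreviation (input) "aK \<equiv> 35 :: nat"
abbreviation (input) "aR \<equiv> 36 :: nat"
abbreviation (input) "aX0 \<equiv> 37 :: nat"

text \<open>The conditions are, in this order: the header has ended, all flags have been read, no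
  marker and no digit is pending, all numbers were canonical, and the numbers pair up to
  edges.\<close>

definition parse_ok :: exp where
  "parse_ok = AllE [EqE (Var aMode) (Const 1), EqE (Var aXI) (Var aVtx), NotE (Var aDig),
     EqE (Var aPow) (Const 1), NotE (Var aBad), NotE (Cell aOdd (Var aCnt))]"

lemma length_dcodes: "length dss \<le> length (concat (map dcode dss))"
  by (induction dss) (auto simp: dcode_def)

text \<open>Each number and each vertex occupies at least one character. Hence loops of length
  \<open>N\<close> reach all of them, and lookups at these counts stay inside the tables.\<close>

lemma pinv_bounds: "pinv x s \<Longrightarrow> s aCnt 0 \<le> length x \<and> s aVtx 0 \<le> length x"
  unfolding pinv_def
proof (elim disjE conjE exE)
  fix fl dss ds g
  assume "pst fl dss ds g s" "x = replicate (s aVtx 0) True @ False # fl @ concat (map dcode dss) @ tail_code ds g"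
  then show ?thesis using length_dcodes[of dss] by (simp add: pst_def)
next
  assume "x = replicate (s aVtx 0) True" "pst [] [] [] False s"
  then show ?thesis by (simp add: pst_def)
qed

lemma parse_okD:
  assumes "pinv x s" "tables N b s" "length x \<le> N" and ok: "eval_exp parse_ok s \<noteq> 0"
  shows "x = instance_code (s aVtx 0) {v. v < s aVtx 0 \<and> s aXF v \<noteq> 0} (pairs (s aW) (s aCnt 0 div 2))"
proof -
  have m: "s aMode 0 = 1" "s aXI 0 = s aVtx 0" "s aDig 0 = 0" "s aPow 0 = 1" "s aBad 0 = 0" "s aOdd (s aCnt 0) = 0"
    using ok by (auto simp: parse_ok_def)
  from assms(1) m(1) have "\<exists>fl dss ds g. pst fl dss ds g s \<and>
        x = replicate (s aVtx 0) True @ False # fl @ concat (map dcode dss) @ tail_code ds g"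
    unfolding pinv_def by (elim disjE) (simp, blast)
  then obtain fl dss ds g where p: "pst fl dss ds g s" and
    x: "x = replicate (s aVtx 0) True @ False # fl @ concat (map dcode dss) @ tail_code ds g" by blast
  have "(2::nat) ^ length ds = 1" using p m(4) unfolding pst_def by metis
  then have ds: "ds = []" by (cases ds) auto
  have q: "s aVtx 0 = length fl" "\<And>i. i < length fl \<Longrightarrow> s aXF i = of_bool (fl ! i)"
    "s aCnt 0 = length dss" "\<And>i. i < length dss \<Longrightarrow> s aW i = bin_val (dss ! i)"
    "\<forall>ds\<in>set dss. ds = [] \<or> last ds" "\<not> g" "ds = []"
    using p m ds by (simp_all add: pst_def)
  have xp: "x = pform fl dss" using x q(1,6,7) by (simp add: pform_def tail_code_def)
  have "s aCnt 0 \<le> N" using pinv_bounds[OF assms(1)] assms(3) by simp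
  then have "even (length dss)" using assms(2) m(6) q(3) by (auto simp: tables_def)
  then have "x = instance_code (length fl) {v. v < length fl \<and> fl ! v}
      (pairs (\<lambda>i. bin_val (dss ! i)) (length dss div 2))"
    unfolding xp using q(5) by (intro pform_is_code) auto
  moreover have "{v. v < length fl \<and> fl ! v} = {v. v < length fl \<and> s aXF v \<noteq> 0}"
    using q(2) by auto
  moreover have "pairs (\<lambda>i. bin_val (dss ! i)) (length dss div 2) = pairs (s aW) (length dss div 2)"
    unfolding pairs_def by (intro map_cong refl) (use q(4) in auto)
  ultimately show ?thesis using q(1,3) by simp
qed

text \<open>The separator after the header forces the parser out of its first mode, and
  \<open>partial_pform\<close> excludes every incomplete reading.\<close>

lemma parse_ok_complete:
  assumes "pinv x s" "tables N b s" "length x \<le> N" "x = instance_code n X es"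
  shows "eval_exp parse_ok s \<noteq> 0"
proof -
  let ?fl = "map (\<lambda>v. v \<in> X) [0..<n]" and ?dss = "map bits (flat es)"
  have x: "x = pform ?fl ?dss" using assms(4) by (simp add: instance_code_pform)
  have "\<not> (x = replicate (s aVtx 0) True)"
    unfolding x pform_def using replicate_neq_header by metis
  then have "s aMode 0 = 1 \<and> (\<exists>fl dss ds g. pst fl dss ds g s \<and> length fl \<le> s aVtx 0 \<and>
        (length fl < s aVtx 0 \<longrightarrow> dss = [] \<and> ds = [] \<and> \<not> g) \<and>
        x = replicate (s aVtx 0) True @ False # fl @ concat (map dcode dss) @ tail_code ds g)"
    using assms(1) unfolding pinv_def by (elim disjE) simp_all
  then obtain fl dss ds g where m: "s aMode 0 = 1" and p: "pst fl dss ds g s"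
    and l: "length fl \<le> s aVtx 0" "length fl < s aVtx 0 \<Longrightarrow> dss = [] \<and> ds = [] \<and> \<not> g"
    and y: "x = replicate (s aVtx 0) True @ False # fl @ concat (map dcode dss) @ tail_code ds g"
    by blast
  have eq: "length fl = s aVtx 0 \<and> fl = ?fl \<and> dss = ?dss \<and> ds = [] \<and> \<not> g"
    by (rule partial_pform[OF _ l]) (use x y in simp_all)
  have "s aCnt 0 \<le> N" using pinv_bounds[OF assms(1)] assms(3) by simp
  moreover have "s aCnt 0 = 2 * length es" using p eq by (simp add: pst_def)
  ultimately have "s aOdd (s aCnt 0) = 0" using assms(2) by (simp add: tables_def)
  moreover have "\<forall>ds\<in>set dss. ds = [] \<or> last ds" using eq bits_canonical by auto
  moreover have "s aVtx 0 = n" using eq by (metis length_map length_upt diff_zero)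
  ultimately show ?thesis using p m eq by (simp add: parse_ok_def pst_def)
qed

section \<open>Adjacency matrix, ranks in \<open>X\<close> and the degree condition\<close>

definition adjE :: "exp \<Rightarrow> exp \<Rightarrow> exp" where
  "adjE u v = Cell aAdj (Add (Cell aMul u) v)"

lemma eval_adjE [simp]: "eval_exp (adjE u v) s = s aAdj (s aMul (eval_exp u s) + eval_exp v s)"
  by (simp add: adjE_def)

definition edge_prog :: prog where
  "edge_prog = PFor aA (PIf (LessE (Var aA) (Cell aHalf (Var aCnt)))
     (let u = Cell aW (Add (Var aA) (Var aA)); v = Cell aW (Inc (Add (Var aA) (Var aA))) in
      PIf (AllE [LessE u (Var aVtx), LessE v (Var aVtx), NotE (EqE u v)])
        (PSeq (PAsg aAdj (Add (Cell aMul u) v) (Const 1)) (PAsg aAdj (Add (Cell aMul v) u) (Const 1)))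
        (PAsg aOk (Const 0) (Const 0))) PSkip)"

definition good_pair :: "nat \<Rightarrow> nat \<times> nat \<Rightarrow> bool" where
  "good_pair n p \<longleftrightarrow> fst p < n \<and> snd p < n \<and> fst p \<noteq> snd p"

lemma index_inj: "(u * N + v = u' * N + v') \<longleftrightarrow> u = u' \<and> v = v'" if "v < N" "v' < N" for u v u' v' N :: nat
proof
  assume *: "u * N + v = u' * N + v'"
  have "(u * N + v) div N = u" "(u' * N + v') div N = u'" using that by auto
  with * show "u = u' \<and> v = v'" by auto
qed simp

text \<open>An ill-formed pair clears the flag and leaves the matrix alone. All indices
  \<open>u * N + v\<close> that are written thus have \<open>u, v < N\<close>, where different
  entries have different indices.\<close>

lemma run_edges:
  assumes t: "tables N b s" and n: "s aVtx 0 \<le> N" and c: "s aCnt 0 \<le> N" and z: "\<And>i. s aAdj i = 0"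
  defines "n \<equiv> s aVtx 0" and "es \<equiv> pairs (s aW) (s aCnt 0 div 2)"
  defines "s' \<equiv> run N edge_prog s"
  shows "s' aOk 0 \<noteq> 0 \<longleftrightarrow> s aOk 0 \<noteq> 0 \<and> (\<forall>p\<in>set es. good_pair n p)"
    and "\<And>u v. u < N \<Longrightarrow> v < N \<Longrightarrow> s' aAdj (u * N + v) \<noteq> 0 \<longleftrightarrow>
      (\<exists>p\<in>set es. good_pair n p \<and> {u, v} = {fst p, snd p})"
proof -
  define m where "m = s aCnt 0 div 2"
  have mN: "m \<le> N" using c by (simp add: m_def)
  define p where "p j = (s aW (2 * j), s aW (2 * j + 1))" for j
  have set_es: "set es = p ` {..<m}" by (auto simp: es_def pairs_def p_def m_def)
  let ?I = "\<lambda>i s'. (s' aOk 0 \<noteq> 0 \<longleftrightarrow> s aOk 0 \<noteq> 0 \<and> (\<forall>j<i. j < m \<longrightarrow> good_pair n (p j))) \<and>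
     (\<forall>u<N. \<forall>v<N. s' aAdj (u * N + v) \<noteq> 0 \<longleftrightarrow>
        (\<exists>j<i. j < m \<and> good_pair n (p j) \<and> {u, v} = {fst (p j), snd (p j)}))"
  have "?I N s'"
    unfolding s'_def edge_prog_def Let_def
  proof (rule for_rule[where I = ?I], goal_cases)
    case 1
    then show ?case by simp
  next
    case 2
    then show ?case using z by simp
  next
    case (3 i s')
    have fr: "s' aHalf = s aHalf" "s' aCnt = s aCnt" "s' aW = s aW" "s' aVtx = s aVtx" "s' aMul = s aMul"
      using 3(4)[of aHalf] 3(4)[of aCnt] 3(4)[of aW] 3(4)[of aVtx] 3(4)[of aMul] by auto
    have half: "s aHalf (s aCnt 0) = m" using t c by (simp add: tables_def m_def)
    obtain u v where uv: "p i = (u, v)" by fastforce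
    have W: "s aW (i + i) = u" "s aW (Suc (i + i)) = v"
      using uv by (auto simp: p_def simp flip: mult_2)
    show ?case
    proof (cases "i < m")
      case False
      then have "j < Suc i \<and> j < m \<longleftrightarrow> j < i \<and> j < m" for j by auto
      then have "(\<exists>j<Suc i. j < m \<and> Q j) = (\<exists>j<i. j < m \<and> Q j)"
        "(\<forall>j<Suc i. j < m \<longrightarrow> Q j) = (\<forall>j<i. j < m \<longrightarrow> Q j)" for Q by metis+
      then show ?thesis using 3(2,3) fr half False by simp
    next
      case True
      show ?thesis
      proof (cases "good_pair n (u, v)")
        case False
        then show ?thesis using 3(2,3) fr half True W uv
          by (simp add: less_Suc_eq n_def good_pair_def) auto
      next
        case good: True
        then have lt: "u < N" "v < N" "u \<noteq> v" "u < s aVtx 0" "v < s aVtx 0"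
          using n by (auto simp: good_pair_def n_def)
        have mul: "s aMul u = u * N" "s aMul v = v * N" using t lt by (auto simp: tables_def)
        define f where "f = (s' aAdj)(u * N + v := 1, v * N + u := 1)"
        have idx: "(u' * N + v' = u * N + v \<or> u' * N + v' = v * N + u) \<longleftrightarrow> {u', v'} = {u, v}"
          if "u' < N" "v' < N" for u' v'
          using that lt by (auto simp: index_inj doubleton_eq_iff)
        have f: "f (u' * N + v') \<noteq> 0 \<longleftrightarrow>
            (\<exists>j<Suc i. j < m \<and> good_pair n (p j) \<and> {u', v'} = {fst (p j), snd (p j)})"
          if "u' < N" "v' < N" for u' v'
        proof -
          have "f (u' * N + v') \<noteq> 0 \<longleftrightarrow> {u', v'} = {u, v} \<or> s' aAdj (u' * N + v') \<noteq> 0"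
            using idx[OF that] by (simp add: f_def) blast
          also have "\<dots> \<longleftrightarrow> {u', v'} = {u, v} \<or>
              (\<exists>j<i. j < m \<and> good_pair n (p j) \<and> {u', v'} = {fst (p j), snd (p j)})"
            using 3(2) that by simp
          also have "\<dots> \<longleftrightarrow> (\<exists>j<Suc i. j < m \<and> good_pair n (p j) \<and> {u', v'} = {fst (p j), snd (p j)})"
            using True good uv by (metis fst_conv less_Suc_eq snd_conv)
          finally show ?thesis .
        qed
        show ?thesis
        proof (intro conjI allI impI, goal_cases)
          case 1
          then show ?case using 3(2,3) fr half True W uv lt good by (simp add: less_Suc_eq)
        next
          case (2 u' v')
          then show ?case using f[OF 2] 3(3) fr half True W lt mul by (simp add: f_def)
        qed
      qed
    qed
  qed
  moreover have ex: "(\<exists>x\<in>p ` {..<m}. Q x) \<longleftrightarrow> (\<exists>j<N. j < m \<and> Q (p j))" for Q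
    using mN by (auto intro: order_less_le_trans)
  moreover have all: "(\<forall>x\<in>p ` {..<m}. Q x) \<longleftrightarrow> (\<forall>j<N. j < m \<longrightarrow> Q (p j))" for Q
    using mN by auto
  ultimately show "s' aOk 0 \<noteq> 0 \<longleftrightarrow> s aOk 0 \<noteq> 0 \<and> (\<forall>p\<in>set es. good_pair n p)"
    "\<And>u v. u < N \<Longrightarrow> v < N \<Longrightarrow> s' aAdj (u * N + v) \<noteq> 0 \<longleftrightarrow>
      (\<exists>p\<in>set es. good_pair n p \<and> {u, v} = {fst p, snd p})"
    unfolding set_es ex all by simp_all
qed

definition rank_prog :: prog where
  "rank_prog = PFor aA (PIf (AllE [LessE (Var aA) (Var aVtx), Cell aXF (Var aA)])
     (seqs [PAsg aR (Var aA) (Var aK), PAsg aK (Const 0) (Inc (Var aK)), PAsg aX0 (Const 0) (Var aA)]) PSkip)"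

lemma run_rank:
  assumes n: "s aVtx 0 \<le> N" and z: "s aK 0 = 0"
  defines "X \<equiv> {v. v < s aVtx 0 \<and> s aXF v \<noteq> 0}" and "s' \<equiv> run N rank_prog s"
  shows "s' aK 0 = card X" and "\<And>v. v \<in> X \<Longrightarrow> s' aR v = card {w \<in> X. w < v}"
    and "X \<noteq> {} \<Longrightarrow> s' aX0 0 \<in> X"
proof -
  let ?I = "\<lambda>i s'. s' aK 0 = card {w \<in> X. w < i} \<and> (\<forall>v\<in>X. v < i \<longrightarrow> s' aR v = card {w \<in> X. w < v}) \<and>
     ({w \<in> X. w < i} \<noteq> {} \<longrightarrow> s' aX0 0 \<in> X)"
  have fin: "finite X" by (simp add: X_def)
  have "?I N s'"
    unfolding s'_def rank_prog_def
  proof (rule for_rule[where I = ?I], goal_cases)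
    case 1
    then show ?case by simp
  next
    case 2
    then show ?case using z by simp
  next
    case (3 i s')
    have fr: "s' aVtx = s aVtx" "s' aXF = s aXF" using 3(4)[of aVtx] 3(4)[of aXF] by auto
    show ?case
    proof (cases "i \<in> X")
      case True
      then have i: "i < s aVtx 0" "s aXF i \<noteq> 0" by (auto simp: X_def)
      have "{w \<in> X. w < Suc i} = insert i {w \<in> X. w < i}" using True by auto
      then have "card {w \<in> X. w < Suc i} = Suc (card {w \<in> X. w < i})" using fin by simp
      then show ?thesis using 3(2,3) fr i True by (simp add: less_Suc_eq)
    next
      case False
      then have i: "\<not> (i < s aVtx 0 \<and> s aXF i \<noteq> 0)" by (auto simp: X_def)
      have "w < Suc i \<longleftrightarrow> w < i" if "w \<in> X" for w using that False by (auto simp: less_Suc_eq)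
      then have "{w \<in> X. w < Suc i} = {w \<in> X. w < i}" "\<And>v. v \<in> X \<and> v < Suc i \<longleftrightarrow> v \<in> X \<and> v < i" by auto
      then show ?thesis using 3(2,3) fr i by auto
    qed
  qed
  moreover have "{w \<in> X. w < N} = X" using n by (auto simp: X_def)
  moreover have "v < N" if "v \<in> X" for v using that n by (auto simp: X_def)
  ultimately show "s' aK 0 = card X" "\<And>v. v \<in> X \<Longrightarrow> s' aR v = card {w \<in> X. w < v}"
    "X \<noteq> {} \<Longrightarrow> s' aX0 0 \<in> X" by auto
qed

lemma bij_rank:
  fixes X :: "nat set"
  assumes "finite X" "\<And>v. v \<in> X \<Longrightarrow> R v = card {w \<in> X. w < v}"
  shows "bij_betw R X {..<card X}"
proof -
  have mono: "R v < R v'" if "v \<in> X" "v' \<in> X" "v < v'" for v v'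
    using that assms by (auto intro!: psubset_card_mono)
  then have inj: "inj_on R X" by (metis inj_onI linorder_less_linear less_irrefl)
  have "R v < card X" if "v \<in> X" for v
    using that assms by (auto intro!: psubset_card_mono)
  then have "R ` X \<subseteq> {..<card X}" by auto
  then have "R ` X = {..<card X}" using inj by (intro card_subset_eq) (auto simp: card_image)
  with inj show ?thesis by (simp add: bij_betw_def)
qed

text \<open>A degree of at least 2 outside \<open>X\<close> is witnessed by three vertices. This
  turns the condition into a search that three nested loops can perform.\<close>

lemma modulator_iff:
  fixes n :: nat
  assumes "simple_graph {..<n} E" "X \<subseteq> {..<n}"
  shows "deg1_modulator {..<n} E X \<longleftrightarrow> \<not> (\<exists>v a b. v < n \<and> a < n \<and> b < n \<and> v \<notin> X \<and> a \<notin> X \<and> b \<notin> X \<and>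
    a \<noteq> b \<and> {v, a} \<in> E \<and> {v, b} \<in> E)" (is "_ \<longleftrightarrow> \<not> ?bad")
proof -
  have edge: "e \<subseteq> {..<n} \<and> card e = 2" if "e \<in> E" for e using assms(1) that by (simp add: simple_graph_def)
  have "E \<subseteq> Pow {..<n}" using edge by auto
  then have "finite E" by (rule finite_subset) simp
  then have fin: "finite {e \<in> delete_edges E X. v \<in> e}" for v by (simp add: delete_edges_def)
  have bad: "?bad" if v: "v < n" "v \<notin> X" "\<not> degree_in (delete_edges E X) v \<le> 1" for v
  proof -
    from v(3) obtain e e' where e: "e \<in> E" "e \<inter> X = {}" "v \<in> e" "e' \<in> E" "e' \<inter> X = {}" "v \<in> e'" "e \<noteq> e'"
      unfolding degree_in_def One_nat_def card_le_Suc0_iff_eq[OF fin] by (auto simp: delete_edges_def)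
    have other: "\<exists>a. e = {v, a} \<and> a < n" if "e \<in> E" "v \<in> e" for e
      using edge[OF that(1)] that(2) by (auto simp: card_2_iff)
    obtain a a' where "e = {v, a}" "a < n" "e' = {v, a'}" "a' < n" using other e by metis
    then show ?bad using e v by blast
  qed
  have two: "\<not> degree_in (delete_edges E X) v \<le> 1"
    if v: "a \<notin> X" "b \<notin> X" "v \<notin> X" "a \<noteq> b" "{v, a} \<in> E" "{v, b} \<in> E" for v a b
  proof -
    have ne: "{v, a} \<noteq> {v, b}" using v(4) by (auto simp: doubleton_eq_iff)
    have mem: "{v, a} \<in> {e \<in> delete_edges E X. v \<in> e}" "{v, b} \<in> {e \<in> delete_edges E X. v \<in> e}"
      using v by (auto simp: delete_edges_def)
    show ?thesis
    proof
      assume "degree_in (delete_edges E X) v \<le> 1"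
      then have "\<forall>e\<in>{e \<in> delete_edges E X. v \<in> e}. \<forall>e'\<in>{e \<in> delete_edges E X. v \<in> e}. e = e'"
        unfolding degree_in_def One_nat_def card_le_Suc0_iff_eq[OF fin] .
      then have "{v, a} = {v, b}" using mem by (elim ballE) auto
      with ne show False ..
    qed
  qed
  show ?thesis
  proof
    assume m: "deg1_modulator {..<n} E X"
    show "\<not> ?bad"
    proof
      assume ?bad
      then obtain v a b where "v < n" "v \<notin> X" "\<not> degree_in (delete_edges E X) v \<le> 1" using two by metis
      with m show False by (simp add: deg1_modulator_def)
    qed
  next
    assume "\<not> ?bad"
    then have "degree_in (delete_edges E X) v \<le> 1" if "v \<in> {..<n} - X" for v
      using bad[of v] that by (metis DiffE lessThan_iff)
    then show "deg1_modulator {..<n} E X" using assms(2) by (simp add: deg1_modulator_def)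
  qed
qed

lemma simple_graph_edges_of: "simple_graph {..<n} (edges_of es) \<longleftrightarrow> (\<forall>p\<in>set es. good_pair n p)"
proof -
  have *: "{u, v} \<subseteq> {..<n} \<and> card {u, v} = 2 \<longleftrightarrow> good_pair n (u, v)" for u v
    by (cases "u = v") (auto simp: good_pair_def)
  have "simple_graph {..<n} (edges_of es) \<longleftrightarrow>
      (\<forall>u v. (u, v) \<in> set es \<longrightarrow> {u, v} \<subseteq> {..<n} \<and> card {u, v} = 2)"
    unfolding simple_graph_def edges_of_def by blast
  then show ?thesis unfolding * by auto
qed

text \<open>Loop counters run beyond the vertices, where flag cells were never written; without the
  bound such numbers would pass for vertices outside \<open>X\<close>.\<close>

definition offE :: "exp \<Rightarrow> exp" where
  "offE v = AndE (LessE v (Var aVtx)) (NotE (Cell aXF v))"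

definition onE :: "exp \<Rightarrow> exp" where
  "onE v = AndE (LessE v (Var aVtx)) (Cell aXF v)"

lemma eval_offE [simp]: "eval_exp (offE v) s = of_bool (eval_exp v s < s aVtx 0 \<and> s aXF (eval_exp v s) = 0)"
  by (simp add: offE_def)

lemma eval_onE [simp]: "eval_exp (onE v) s = of_bool (eval_exp v s < s aVtx 0 \<and> s aXF (eval_exp v s) \<noteq> 0)"
  by (simp add: onE_def)

definition check_prog :: prog where
  "check_prog = PIf parse_ok (seqs [PAsg aOk (Const 0) (Const 1), edge_prog,
     scan [aA, aB, aC] (AllE [offE (Var aA), offE (Var aB), offE (Var aC), NotE (EqE (Var aB) (Var aC)),
       adjE (Var aA) (Var aB), adjE (Var aA) (Var aC)]) aOk 0,
     rank_prog,
     PIf (EqE (Var aK) (Cell 0 (Const 1))) PSkip (PAsg aOk (Const 0) (Const 0))]) PSkip"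

definition graph_mem :: "nat \<Rightarrow> nat \<Rightarrow> nat set set \<Rightarrow> nat set \<Rightarrow> memory \<Rightarrow> bool" where
  "graph_mem N n E X s \<longleftrightarrow> n \<le> N \<and> s aVtx 0 = n \<and> X = {v. v < n \<and> s aXF v \<noteq> 0} \<and>
     (\<forall>u<N. \<forall>v<N. s aAdj (u * N + v) \<noteq> 0 \<longleftrightarrow> {u, v} \<in> E) \<and>
     bij_betw (s aR) X {..<card X} \<and> s aK 0 = card X \<and> (X \<noteq> {} \<longrightarrow> s aX0 0 \<in> X)"

text \<open>Membership in \<open>q_Coloring\<close> asks for some decoding of the string. As there
  is only one, reasoning about the decoded graph decides membership.\<close>

lemma is_instance_unique:
  assumes "is_instance x k n E X" "x = instance_code n' X' es'" "X' \<subseteq> {..<n'}"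
  shows "n = n'" "E = edges_of es'" "X = X'"
proof -
  obtain es where es: "E = edges_of es" "x = instance_code n X es" and "X \<subseteq> {..<n}"
    using assms(1) by (auto simp: is_instance_def encodes_def edges_of_def deg1_modulator_def)
  then have "instance_code n X es = instance_code n' X' es'" using assms(2) by simp
  note eq = instance_code_inj[OF this]
  show "n = n'" "E = edges_of es'" using es eq by auto
  show "X = X'" using eq assms(3) \<open>X \<subseteq> {..<n}\<close> by blast
qed

lemma if_zero_iff: "a \<noteq> 0 \<Longrightarrow> ((if P then 0 else a) \<noteq> (0::nat)) \<longleftrightarrow> \<not> P"
  by simp

lemma run_check:
  assumes p: "pinv x s" and t: "tables N b s" and N: "length x \<le> N" and k: "s 0 1 = k"
    and z: "s aOk 0 = 0" "\<And>i. s aAdj i = 0" "s aK 0 = 0"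
  defines "s' \<equiv> run N check_prog s"
  shows "s' aOk 0 \<noteq> 0 \<longleftrightarrow> (\<exists>n E X. is_instance x k n E X)"
    and "s' aOk 0 \<noteq> 0 \<Longrightarrow> \<exists>n E X. is_instance x k n E X \<and> graph_mem N n E X s'"
proof -
  have bnd: "s aCnt 0 \<le> N" "s aVtx 0 \<le> N" using pinv_bounds[OF p] N by auto
  have main: "(s' aOk 0 \<noteq> 0 \<longleftrightarrow> (\<exists>n E X. is_instance x k n E X)) \<and>
    (s' aOk 0 \<noteq> 0 \<longrightarrow> (\<exists>n E X. is_instance x k n E X \<and> graph_mem N n E X s'))"
  proof (cases "eval_exp parse_ok s = 0")
    case True
    then have "\<not> (\<exists>n E X. is_instance x k n E X)"
      using parse_ok_complete[OF p t N] by (auto simp: is_instance_def encodes_def)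
    moreover have "s' = s" using True by (simp add: s'_def check_prog_def)
    ultimately show ?thesis using z by simp
  next
    case False
    define n X es where "n = s aVtx 0" and "X = {v. v < n \<and> s aXF v \<noteq> 0}"
      and "es = pairs (s aW) (s aCnt 0 div 2)"
    have x: "x = instance_code n X es"
      using parse_okD[OF p t N False] by (simp add: n_def X_def es_def)
    have Xn: "X \<subseteq> {..<n}" by (auto simp: X_def)
    define s1 where "s1 = setc aOk 0 1 s"
    define s2 where "s2 = run N edge_prog s1"
    define s3 where "s3 = run N (scan [aA, aB, aC] (AllE [offE (Var aA), offE (Var aB), offE (Var aC),
       NotE (EqE (Var aB) (Var aC)), adjE (Var aA) (Var aB), adjE (Var aA) (Var aC)]) aOk 0) s2"
    define s4 where "s4 = run N rank_prog s3"
    have s': "s' = (if s4 aK 0 = s4 0 1 then s4 else setc aOk 0 0 s4)"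
      using False by (simp add: s'_def check_prog_def s1_def s2_def s3_def s4_def)
    have t1: "tables N b s1" using t by (simp add: tables_def s1_def)
    have f2: "s2 a = s1 a" if "a \<notin> {aA, aAdj, aOk}" for a
      unfolding s2_def by (rule run_frame) (use that in \<open>simp add: edge_prog_def Let_def\<close>)
    have f3: "s3 a = s2 a" if "a \<notin> {aA, aB, aC, aOk}" for a
      unfolding s3_def by (rule run_frame) (use that in simp)
    have f4: "s4 a = s3 a" if "a \<notin> {aA, aR, aK, aX0}" for a
      unfolding s4_def by (rule run_frame) (use that in \<open>simp add: rank_prog_def\<close>)
    have e1: "s2 aOk 0 \<noteq> 0 \<longleftrightarrow> (\<forall>p\<in>set es. good_pair n p)"
      and e2: "\<And>u v. u < N \<Longrightarrow> v < N \<Longrightarrow> s2 aAdj (u * N + v) \<noteq> 0 \<longleftrightarrow>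
        (\<exists>p\<in>set es. good_pair n p \<and> {u, v} = {fst p, snd p})"
      using run_edges[OF t1, folded s2_def] bnd z by (auto simp: s1_def n_def es_def)
    let ?Q = "\<lambda>v a b. v < n \<and> a < n \<and> b < n \<and> v \<notin> X \<and> a \<notin> X \<and> b \<notin> X \<and>
       a \<noteq> b \<and> s2 aAdj (v * N + a) \<noteq> 0 \<and> s2 aAdj (v * N + b) \<noteq> 0"
    let ?P = "\<lambda>xs. ?Q (xs ! 0) (xs ! 1) (xs ! 2)"
    have e3: "s3 aOk 0 = (if \<exists>xs. length xs = length [aA, aB, aC] \<and> set xs \<subseteq> {..<N} \<and> ?P xs then 0 else s2 aOk 0)"
      unfolding s3_def
    proof (rule run_scan)
      fix s' assume fr: "\<And>a. a \<notin> insert aOk (set [aA, aB, aC]) \<Longrightarrow> s' a = s2 a"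
      have m: "s' aMul v = v * N" if "v < n" for v
        using fr[of aMul] f2[of aMul] t1 that bnd by (simp add: tables_def n_def)
      have f: "s' aVtx 0 = n" "s' aXF = s aXF" "s' aAdj = s2 aAdj"
        using fr[of aVtx] f2[of aVtx] fr[of aXF] f2[of aXF] fr[of aAdj] by (simp_all add: s1_def n_def)
      show "eval_exp (AllE [offE (Var aA), offE (Var aB), offE (Var aC), NotE (EqE (Var aB) (Var aC)),
          adjE (Var aA) (Var aB), adjE (Var aA) (Var aC)]) s' \<noteq> 0 \<longleftrightarrow> ?P (map (\<lambda>v. s' v 0) [aA, aB, aC])"
        using m by (auto simp: f X_def)
    qed auto
    have good_adj: "s2 aAdj (u * N + v) \<noteq> 0 \<longleftrightarrow> {u, v} \<in> edges_of es"
      if "\<forall>p\<in>set es. good_pair n p" "u < N" "v < N" for u v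
      unfolding e2[OF that(2,3)] edges_of_def mem_Collect_eq
      using that(1) by (metis fst_conv snd_conv prod.collapse)
    have e3': "s3 aOk 0 \<noteq> 0 \<longleftrightarrow> simple_graph {..<n} (edges_of es) \<and> deg1_modulator {..<n} (edges_of es) X"
    proof (cases "\<forall>p\<in>set es. good_pair n p")
      case True
      have lt: "v < N" if "v < n" for v using that bnd by (simp add: n_def)
      have lr: "(\<exists>xs. length xs = length [aA, aB, aC] \<and> set xs \<subseteq> {..<N} \<and> ?P xs) \<longleftrightarrow>
          (\<exists>v a b. v < n \<and> a < n \<and> b < n \<and> v \<notin> X \<and> a \<notin> X \<and> b \<notin> X \<and>
             a \<noteq> b \<and> {v, a} \<in> edges_of es \<and> {v, b} \<in> edges_of es)" (is "?l \<longleftrightarrow> ?r")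
      proof
        assume ?l
        then obtain xs where "?P xs" by blast
        then show ?r using good_adj[OF True] lt by (intro exI[of _ "xs ! 0"] exI[of _ "xs ! 1"] exI[of _ "xs ! 2"]) auto
      next
        assume ?r
        then obtain v a b where *: "v < n \<and> a < n \<and> b < n \<and> v \<notin> X \<and> a \<notin> X \<and> b \<notin> X \<and>
             a \<noteq> b \<and> {v, a} \<in> edges_of es \<and> {v, b} \<in> edges_of es" by blast
        then have "?Q v a b" using good_adj[OF True] lt by auto
        then show ?l using lt by (intro exI[of _ "[v, a, b]"]) auto
      qed
      have "s2 aOk 0 \<noteq> 0" using True e1 by blast
      then have "s3 aOk 0 \<noteq> 0 \<longleftrightarrow> \<not> ?l" unfolding e3 by (rule if_zero_iff)
      then have "s3 aOk 0 \<noteq> 0 \<longleftrightarrow> \<not> ?r" unfolding lr .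
      moreover have sg: "simple_graph {..<n} (edges_of es)" using True by (simp add: simple_graph_edges_of)
      ultimately show ?thesis unfolding modulator_iff[OF sg Xn] by (simp only: sg simp_thms)
    next
      \<comment> \<open>The matrix lacks the ill-formed pairs, but the flag is 0 already and the
        search can only store 0 in it.\<close>
      case False
      then have "\<not> simple_graph {..<n} (edges_of es)" "s2 aOk 0 = 0" using e1 by (auto simp: simple_graph_edges_of)
      then show ?thesis unfolding e3 by simp
    qed
    have vx: "s3 aVtx = s aVtx" "s3 aXF = s aXF" "s3 aK = s aK"
      using f2[of aVtx] f3[of aVtx] f2[of aXF] f3[of aXF] f2[of aK] f3[of aK] by (simp_all add: s1_def)
    have r: "s4 aK 0 = card X" "\<And>v. v \<in> X \<Longrightarrow> s4 aR v = card {w \<in> X. w < v}" "X \<noteq> {} \<Longrightarrow> s4 aX0 0 \<in> X"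
      using run_rank[of s3 N, folded s4_def] bnd z vx by (auto simp: X_def n_def)
    have k4: "s4 0 1 = k" using f4[of 0] f3[of 0] f2[of 0] k by (simp add: s1_def)
    have ok: "s' aOk 0 \<noteq> 0 \<longleftrightarrow> is_instance x k n (edges_of es) X"
    proof -
      have "encodes x n (edges_of es) X" using x by (auto simp: encodes_def edges_of_def)
      then show ?thesis using e3' f4[of aOk] r(1) k4 by (auto simp: is_instance_def s')
    qed
    moreover have "is_instance x k n (edges_of es) X" if "is_instance x k n' E' X'" for n' E' X'
      using is_instance_unique[OF that x Xn] that by simp
    moreover have "graph_mem N n (edges_of es) X s'" if "is_instance x k n (edges_of es) X"
    proof -
      have "s' = s4" using that r k4 by (simp add: s' is_instance_def)
      moreover have "\<forall>p\<in>set es. good_pair n p" using that by (simp add: is_instance_def simple_graph_edges_of)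
      then have "\<forall>u<N. \<forall>v<N. s4 aAdj (u * N + v) \<noteq> 0 \<longleftrightarrow> {u, v} \<in> edges_of es"
        using good_adj f4[of aAdj] f3[of aAdj] by simp
      moreover have "bij_betw (s4 aR) X {..<card X}" using r by (intro bij_rank) (auto simp: X_def)
      ultimately show ?thesis
        using r bnd vx f4[of aVtx] f4[of aXF] by (simp add: graph_mem_def n_def X_def)
    qed
    ultimately show ?thesis by blast
  qed
  then show "s' aOk 0 \<noteq> 0 \<longleftrightarrow> (\<exists>n E X. is_instance x k n E X)"
    "s' aOk 0 \<noteq> 0 \<Longrightarrow> \<exists>n E X. is_instance x k n E X \<and> graph_mem N n E X s'" by blast+
qed

section \<open>Selecting constraints\<close>

abbreviation (input) "aOW \<equiv> 40 :: nat"
abbreviation (input) "aOC \<equiv> 41 :: nat"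
abbreviation (input) "aNV \<equiv> 42 :: nat"
abbreviation (input) "aT \<equiv> 43 :: nat"
abbreviation (input) "aFound \<equiv> 44 :: nat"
abbreviation (input) "aFin \<equiv> 45 :: nat"
abbreviation (input) "aVec \<equiv> 46 :: nat"
abbreviation (input) "aHas \<equiv> 47 :: nat"
abbreviation (input) "aRow \<equiv> 48 :: nat"

definition divE :: "nat \<Rightarrow> exp \<Rightarrow> exp" where
  "divE i e = (Cell aDiv ^^ i) e"

definition digsE :: "nat \<Rightarrow> exp \<Rightarrow> exp list" where
  "digsE m e = map (\<lambda>i. Cell aMod (divE i e)) [0..<m]"

lemma length_digsE [simp]: "length (digsE m e) = m"
  by (simp add: digsE_def)

text \<open>Division by \<open>b ^ i\<close> is \<open>i\<close> table lookups in a row; the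
  intermediate quotients never exceed \<open>N\<close>.\<close>

lemma eval_divE:
  assumes "tables N b s" "eval_exp e s \<le> N"
  shows "eval_exp (divE i e) s = eval_exp e s div b ^ i"
proof (induction i)
  case (Suc i)
  have "eval_exp e s div b ^ i \<le> N" using assms(2) div_le_dividend le_trans by blast
  then show ?case using Suc assms(1) by (simp add: divE_def tables_def mult.commute flip: div_mult2_eq)
qed (simp add: divE_def)

lemma eval_digsE:
  assumes "tables N b s" "eval_exp e s \<le> N"
  shows "map (\<lambda>e. eval_exp e s) (digsE m e) = digs b m (eval_exp e s)"
proof -
  have "eval_exp e s div b ^ i \<le> N" for i using assms(2) div_le_dividend le_trans by blast
  then show ?thesis
    using assms(1) by (simp add: digsE_def digs_def eval_divE[OF assms] tables_def)
qed

lemma reads_divE: "reads (divE i e) \<subseteq> insert aDiv (reads e)"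
  by (induction i) (auto simp: divE_def)

lemma reads_digsE: "d \<in> set (digsE m e) \<Longrightarrow> reads d \<subseteq> {aDiv, aMod} \<union> reads e"
  using reads_divE by (fastforce simp: digsE_def)

definition olist :: "nat list \<Rightarrow> memory \<Rightarrow> bool" where
  "olist ys s \<longleftrightarrow> s aOC 0 = length ys \<and> (\<forall>i<length ys. s aOW i = ys ! i)"

definition pushes :: "exp list \<Rightarrow> prog" where
  "pushes es = seqs (map (\<lambda>e. PSeq (PAsg aOW (Var aOC) e) (PAsg aOC (Const 0) (Inc (Var aOC)))) es)"

lemma writes_pushes: "writes (pushes es) \<subseteq> {aOW, aOC}"
  by (auto simp: pushes_def)

lemma wf_pushes [simp]: "wf_prog aN (pushes es)"
  by (auto simp: pushes_def)

lemma run_pushes: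
  assumes "olist ys s" "\<And>e. e \<in> set es \<Longrightarrow> reads e \<inter> {aOW, aOC} = {}"
  shows "olist (ys @ map (\<lambda>e. eval_exp e s) es) (run N (pushes es) s)"
  using assms
proof (induction es arbitrary: ys s)
  case (Cons e es)
  define s1 where "s1 = setc aOC 0 (Suc (s aOC 0)) (setc aOW (s aOC 0) (eval_exp e s) s)"
  have r: "run N (pushes (e # es)) s = run N (pushes es) s1"
    by (simp add: pushes_def s1_def)
  have "olist (ys @ [eval_exp e s]) s1"
    using Cons.prems(1) by (auto simp: olist_def s1_def nth_append less_Suc_eq)
  then have "olist ((ys @ [eval_exp e s]) @ map (\<lambda>e. eval_exp e s1) es) (run N (pushes es) s1)"
    using Cons.prems(2) by (intro Cons.IH) auto
  moreover have "map (\<lambda>e. eval_exp e s1) es = map (\<lambda>e. eval_exp e s) es"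
  proof (intro map_cong refl eval_cong)
    fix e' a assume "e' \<in> set es" "a \<in> reads e'"
    then show "s1 a = s a" using Cons.prems(2)[of e'] by (auto simp: s1_def)
  qed
  ultimately show ?case unfolding r by simp
qed (simp add: pushes_def)

definition gst :: "nat \<Rightarrow> (nat \<times> nat) list \<Rightarrow> (nat list \<times> nat list) list \<Rightarrow> memory \<Rightarrow> bool" where
  "gst k xes gs s \<longleftrightarrow> olist (flat (xes @ gedges (s aR) k gs)) s \<and> s aNV 0 = k + 2 * length gs"

lemma gst_cong: "s' aR = s aR \<Longrightarrow> s' aOW = s aOW \<Longrightarrow> s' aOC = s aOC \<Longrightarrow> s' aNV = s aNV \<Longrightarrow>
    gst k xes gs s' = gst k xes gs s"
  by (simp add: gst_def olist_def)

definition gadget_prog :: "exp list \<Rightarrow> exp list \<Rightarrow> prog" where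
  "gadget_prog As Bs = PSeq
     (pushes (flat ((Var aNV, Inc (Var aNV)) # map (\<lambda>e. (Var aNV, Cell aR e)) As @
        map (\<lambda>e. (Inc (Var aNV), Cell aR e)) Bs)))
     (PAsg aNV (Const 0) (Inc (Inc (Var aNV))))"

lemma writes_gadget: "writes (gadget_prog As Bs) \<subseteq> {aOW, aOC, aNV}"
  using writes_pushes by (auto simp: gadget_prog_def)

lemma wf_gadget [simp]: "wf_prog aN (gadget_prog As Bs)"
  by (simp add: gadget_prog_def)

lemma map_flat: "map f (flat es) = flat (map (map_prod f f) es)"
  by (induction es) auto

lemma set_flat: "set (flat es) = fst ` set es \<union> snd ` set es"
  by (induction es) auto

text \<open>The expressions do not read the arrays of the output list, so all of them have the
  values of the initial state although they are evaluated between the writes. The counter of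
  vertices moves on only after the last write.\<close>

lemma run_gadget:
  assumes g: "gst k xes gs s"
    and r: "\<And>e. e \<in> set (As @ Bs) \<Longrightarrow> reads e \<inter> {aOW, aOC} = {}"
  shows "gst k xes (gs @ [(map (\<lambda>e. eval_exp e s) As, map (\<lambda>e. eval_exp e s) Bs)])
    (run N (gadget_prog As Bs) s)"
proof -
  let ?f = "\<lambda>e. eval_exp e s"
  let ?es = "(Var aNV, Inc (Var aNV)) # map (\<lambda>e. (Var aNV, Cell aR e)) As @
        map (\<lambda>e. (Inc (Var aNV), Cell aR e)) Bs"
  define s1 where "s1 = run N (pushes (flat ?es)) s"
  have f1: "s1 a = s a" if "a \<notin> {aOW, aOC}" for a
    unfolding s1_def using writes_pushes that by (intro run_frame) blast
  have "olist (flat (xes @ gedges (s aR) k gs) @ map ?f (flat ?es)) s1"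
    unfolding s1_def
  proof (rule run_pushes)
    show "olist (flat (xes @ gedges (s aR) k gs)) s" using g by (simp add: gst_def)
    fix e assume "e \<in> set (flat ?es)"
    then show "reads e \<inter> {aOW, aOC} = {}" unfolding set_flat using r by auto
  qed
  moreover have "flat (gedges (s aR) k gs) @ map ?f (flat ?es) =
      flat (gedges (s aR) k (gs @ [(map ?f As, map ?f Bs)]))"
  proof -
    have "s aNV 0 = k + 2 * length gs" using g by (simp add: gst_def)
    then show ?thesis unfolding gedges_snoc map_flat by (simp add: comp_def)
  qed
  ultimately have "olist (flat (xes @ gedges (s aR) k (gs @ [(map ?f As, map ?f Bs)]))) s1"
    by (metis append_assoc flat_simps(3))
  moreover have "run N (gadget_prog As Bs) s = setc aNV 0 (Suc (Suc (s1 aNV 0))) s1"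
    by (simp add: gadget_prog_def s1_def)
  ultimately show ?thesis
    using g f1[of aNV] f1[of aR] by (simp add: gst_def olist_def)
qed

lemma product_snoc: "List.product (xs @ [x]) ys = List.product xs ys @ map (Pair x) ys"
  by (induction xs) auto

definition xedges_prog :: prog where
  "xedges_prog = PFor aA (PFor aB (PIf (AllE [onE (Var aA), onE (Var aB), adjE (Var aA) (Var aB)])
     (pushes [Cell aR (Var aA), Cell aR (Var aB)]) PSkip))"

text \<open>Vertices are digits in base \<open>b\<close>, and \<open>N\<close> bounds the codes of
  the tuples of length \<open>2q - 2\<close>. It also bounds the size \<open>q * q\<close> of a box,
  because the parity of an occurrence count within a box is found by table lookup.\<close>

locale setting =
  fixes q N b n :: nat and E :: "nat set set" and X :: "nat set"
  assumes q: "q \<ge> 3" and b: "b > 0" "n \<le> b" and N: "b ^ (2 * (q - 1)) \<le> N" "q * q \<le> N"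
    and Xn: "X \<subseteq> {..<n}"
begin

abbreviation "m \<equiv> 2 * (q - 1)"

definition base :: "memory \<Rightarrow> bool" where
  "base s \<longleftrightarrow> tables N b s \<and> graph_mem N n E X s"

definition base_arrays :: "nat set" where
  "base_arrays = {aOdd, aHalf, aMul, aMod, aDiv, aVtx, aXF, aAdj, aR, aK, aX0}"

lemma base_cong: "(\<And>a. a \<in> base_arrays \<Longrightarrow> s' a = s a) \<Longrightarrow> base s' = base s"
  unfolding base_def tables_def graph_mem_def base_arrays_def by simp

lemma bN: "b \<le> N" "n \<le> N" "b ^ q \<le> N"
proof -
  have "b ^ 1 \<le> b ^ m" "b ^ q \<le> b ^ m" using b q by (intro power_increasing; simp)+
  then show "b \<le> N" "n \<le> N" "b ^ q \<le> N" using N b by auto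
qed

lemma finX: "finite X"
  using Xn finite_subset by blast

lemma base_on: "base s \<Longrightarrow> v < s aVtx 0 \<and> s aXF v \<noteq> 0 \<longleftrightarrow> v \<in> X"
  by (auto simp: base_def graph_mem_def)

lemma base_off: "base s \<Longrightarrow> v < s aVtx 0 \<and> s aXF v = 0 \<longleftrightarrow> v < n \<and> v \<notin> X"
  by (auto simp: base_def graph_mem_def)

lemma base_adj: "base s \<Longrightarrow> u < n \<Longrightarrow> v < n \<Longrightarrow> s aAdj (s aMul u + v) \<noteq> 0 \<longleftrightarrow> {u, v} \<in> E"
  using bN by (auto simp: base_def graph_mem_def tables_def)

definition CX :: "nat \<times> nat \<Rightarrow> bool" where
  "CX = (\<lambda>(u, v). u \<in> X \<and> v \<in> X \<and> {u, v} \<in> E)"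

definition xes :: "(nat \<Rightarrow> nat) \<Rightarrow> (nat \<times> nat) list" where
  "xes R = map (map_prod R R) (filter CX (List.product [0..<N] [0..<N]))"

lemma set_xes: "set (xes R) = {(R u, R v) |u v. u \<in> X \<and> v \<in> X \<and> {u, v} \<in> E}"
proof -
  have "u < N" if "u \<in> X" for u using that Xn bN by auto
  then show ?thesis by (force simp: xes_def CX_def)
qed

lemma length_xes: "length (xes R) \<le> card X * card X"
proof -
  have "distinct (filter CX (List.product [0..<N] [0..<N]))" by (simp add: distinct_product)
  then have "length (xes R) = card (set (filter CX (List.product [0..<N] [0..<N])))"
    unfolding xes_def length_map by (rule distinct_card[symmetric])
  also have "\<dots> \<le> card (X \<times> X)" using finX by (intro card_mono) (auto simp: CX_def)
  finally show ?thesis by (simp add: card_cartesian_product)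
qed

lemma run_xedges:
  assumes "base s" "olist [] s"
  shows "olist (flat (xes (s aR))) (run N xedges_prog s)"
proof -
  define R where "R = s aR"
  let ?F = "map (map_prod R R)"
  let ?A = "\<lambda>i. filter CX (List.product [0..<i] [0..<N])"
  have "olist (flat (?F (?A N))) (run N xedges_prog s)"
    unfolding xedges_prog_def
  proof (rule for_rule[where I = "\<lambda>i s'. olist (flat (?F (?A i))) s'"], goal_cases)
    case 1
    then show ?case using writes_pushes[of "[Cell aR (Var aA), Cell aR (Var aB)]"] by auto
  next
    case 2
    then show ?case using assms by (simp add: olist_def)
  next
    case (3 i s')
    let ?B = "\<lambda>j. ?A i @ filter CX (map (Pair i) [0..<j])"
    have fr: "s' a = s a" if "a \<notin> {aA, aB, aOW, aOC}" for a
      using 3(4)[of a] that writes_pushes[of "[Cell aR (Var aA), Cell aR (Var aB)]"] by auto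
    have "olist (flat (?F (?B N))) (run N (PFor aB (PIf (AllE [onE (Var aA), onE (Var aB), adjE (Var aA) (Var aB)])
     (pushes [Cell aR (Var aA), Cell aR (Var aB)]) PSkip)) s')"
    proof (rule for_rule[where I = "\<lambda>j s'. olist (flat (?F (?B j))) s'"], goal_cases)
      case 1
      then show ?case using writes_pushes[of "[Cell aR (Var aA), Cell aR (Var aB)]"] by auto
    next
      case 2
      then show ?case using 3(2) by (simp add: olist_def)
    next
      case (3 j s'')
      have fr2: "s'' a = s' a" if "a \<notin> {aB, aOW, aOC}" for a
        using 3(4)[of a] that writes_pushes[of "[Cell aR (Var aA), Cell aR (Var aB)]"] by auto
      have "base s'' = base s" by (rule base_cong) (auto simp: base_arrays_def fr fr2)
      then have "base s''" using assms(1) by simp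
      moreover have A: "s'' aA 0 = i" using fr2[of aA] \<open>s' aA 0 = i\<close> by simp
      ultimately have cond: "eval_exp (AllE [onE (Var aA), onE (Var aB), adjE (Var aA) (Var aB)]) s'' \<noteq> 0 \<longleftrightarrow> CX (i, j)"
        using base_on[of s'' i] base_on[of s'' j] base_adj[of s'' i j] 3(3) Xn by (auto simp: CX_def)
      show ?case
      proof (cases "CX (i, j)")
        case False
        then show ?thesis using 3(2) cond by (simp add: olist_def)
      next
        case True
        have "olist (flat (?F (?B j)) @ map (\<lambda>e. eval_exp e s'') [Cell aR (Var aA), Cell aR (Var aB)])
            (run N (pushes [Cell aR (Var aA), Cell aR (Var aB)]) s'')"
          using 3(2) by (intro run_pushes) auto
        moreover have "s'' aR = R" using fr[of aR] fr2[of aR] by (simp add: R_def)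
        ultimately show ?thesis using cond True A 3(3) by (simp add: olist_def)
      qed
    qed
    then show ?case by (simp add: product_snoc olist_def)
  qed
  then show ?thesis by (simp add: xes_def R_def)
qed

definition C1 :: "nat \<Rightarrow> bool" where
  "C1 t \<longleftrightarrow> t < b ^ q \<and> set (digs b q t) \<subseteq> X \<and> (\<exists>v<n. v \<notin> X \<and> (\<forall>y\<in>set (digs b q t). {v, y} \<in> E))"

text \<open>The loop passes \<open>b ^ q\<close>, and from there on the lowest \<open>q\<close>
  digits repeat earlier tuples; the test that the quotient by \<open>b ^ q\<close> is 0 prevents
  duplicates.\<close>

definition t1_prog :: prog where
  "t1_prog = PFor aT (seqs [PAsg aFound (Const 0) (Const 0),
     scan [aA] (AllE ([NotE (divE q (Var aT)), offE (Var aA)] @ map onE (digsE q (Var aT)) @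
       map (adjE (Var aA)) (digsE q (Var aT)))) aFound 1,
     PIf (Var aFound) (gadget_prog (digsE q (Var aT)) []) PSkip])"

lemma Ball_digsE:
  assumes "tables N b s" "eval_exp e s \<le> N"
  shows "(\<forall>d\<in>set (digsE k e). P (eval_exp d s)) \<longleftrightarrow> (\<forall>y\<in>set (digs b k (eval_exp e s)). P y)"
proof -
  have "set (digs b k (eval_exp e s)) = (\<lambda>d. eval_exp d s) ` set (digsE k e)"
    unfolding eval_digsE[OF assms, symmetric] by simp
  then show ?thesis by simp
qed

lemma div_eq_0: "t div b ^ i = 0 \<longleftrightarrow> t < b ^ i"
  using b by (simp add: div_eq_0_iff)

lemma run_t1:
  assumes s: "base s" "gst k xs [] s"
  shows "gst k xs (map (\<lambda>t. (digs b q t, [])) (filter C1 [0..<N])) (run N t1_prog s)"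
proof -
  let ?gs = "\<lambda>i. map (\<lambda>t. (digs b q t, [])) (filter C1 [0..<i])"
  show ?thesis
    unfolding t1_prog_def
  proof (rule for_rule[where I = "\<lambda>i s'. gst k xs (?gs i) s'"], goal_cases)
    case 1
    then show ?case using writes_gadget[of "digsE q (Var aT)" "[]"] by auto
  next
    case 2
    then show ?case using s(2) by (simp add: gst_def olist_def)
  next
    case (3 i s')
    let ?e = "AllE ([NotE (divE q (Var aT)), offE (Var aA)] @ map onE (digsE q (Var aT)) @
       map (adjE (Var aA)) (digsE q (Var aT)))"
    define s1 where "s1 = setc aFound 0 0 s'"
    define s2 where "s2 = run N (scan [aA] ?e aFound 1) s1"
    have fr: "s' a = s a" if "a \<notin> {aT, aFound, aA, aOW, aOC, aNV}" for a
      using 3(4)[of a] that writes_gadget[of "digsE q (Var aT)" "[]"] by auto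
    have fr2: "s2 a = s' a" if "a \<notin> {aFound, aA}" for a
      unfolding s2_def using that by (subst run_frame) (auto simp: s1_def)
    let ?P = "\<lambda>xs. i < b ^ q \<and> xs ! 0 < n \<and> xs ! 0 \<notin> X \<and> (\<forall>y\<in>set (digs b q i). y \<in> X) \<and>
       (\<forall>y\<in>set (digs b q i). {xs ! 0, y} \<in> E)"
    have "s2 aFound 0 = (if \<exists>xs. length xs = length [aA] \<and> set xs \<subseteq> {..<N} \<and> ?P xs then 1 else s1 aFound 0)"
      unfolding s2_def
    proof (rule run_scan)
      fix s'' assume fr3: "\<And>a. a \<notin> insert aFound (set [aA]) \<Longrightarrow> s'' a = s1 a"
      have "base s'' = base s" by (rule base_cong) (auto simp: base_arrays_def fr fr3 s1_def)
      then have bs: "base s''" using s(1) by simp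
      have T: "s'' aT 0 = i" using fr3[of aT] 3(3) by (simp add: s1_def)
      then have tb: "tables N b s''" "eval_exp (Var aT) s'' \<le> N" using bs 3(1) by (simp_all add: base_def)
      have adj: "s'' aAdj (s'' aMul v + y) \<noteq> 0 \<longleftrightarrow> {v, y} \<in> E" if "v < n" "y \<in> X" for v y
        using base_adj[OF bs that(1), of y] that(2) Xn by auto
      have "eval_exp ?e s'' \<noteq> 0 \<longleftrightarrow> i < b ^ q \<and> (s'' aA 0 < n \<and> s'' aA 0 \<notin> X) \<and>
          (\<forall>d\<in>set (digsE q (Var aT)). eval_exp d s'' \<in> X) \<and>
          (\<forall>d\<in>set (digsE q (Var aT)). s'' aAdj (s'' aMul (s'' aA 0) + eval_exp d s'') \<noteq> 0)"
        using eval_divE[OF tb, of q] T by (simp add: base_on[OF bs, simplified] base_off[OF bs] div_eq_0 ball_Un) blast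
      also have "\<dots> \<longleftrightarrow> ?P (map (\<lambda>v. s'' v 0) [aA])"
        unfolding Ball_digsE[OF tb, of _ "\<lambda>y. y \<in> X"]
          Ball_digsE[OF tb, of _ "\<lambda>y. s'' aAdj (s'' aMul (s'' aA 0) + y) \<noteq> 0"]
        using T adj by auto
      finally show "eval_exp ?e s'' \<noteq> 0 \<longleftrightarrow> ?P (map (\<lambda>v. s'' v 0) [aA])" .
    qed auto
    moreover have "(\<exists>xs. length xs = length [aA] \<and> set xs \<subseteq> {..<N} \<and> ?P xs) \<longleftrightarrow> C1 i"
    proof
      assume "\<exists>xs. length xs = length [aA] \<and> set xs \<subseteq> {..<N} \<and> ?P xs"
      then show "C1 i" unfolding C1_def by blast
    next
      assume "C1 i"
      then obtain v where "v < n" "?P [v]" by (auto simp: C1_def)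
      then show "\<exists>xs. length xs = length [aA] \<and> set xs \<subseteq> {..<N} \<and> ?P xs"
        using bN by (intro exI[of _ "[v]"]) auto
    qed
    ultimately have found: "s2 aFound 0 \<noteq> 0 \<longleftrightarrow> C1 i" by (simp add: s1_def)
    have g2: "gst k xs (?gs i) s2" using 3(2) gst_cong[of s2 s'] fr2 by simp
    have run: "run N (seqs [PAsg aFound (Const 0) (Const 0), scan [aA] ?e aFound 1,
       PIf (Var aFound) (gadget_prog (digsE q (Var aT)) []) PSkip]) s' =
       (if C1 i then run N (gadget_prog (digsE q (Var aT)) []) s2 else s2)"
      using found by (simp add: s1_def s2_def)
    show ?case
    proof (cases "C1 i")
      case False
      then show ?thesis unfolding run using g2 by (simp add: gst_def olist_def)
    next
      case True
      have "base s2 = base s" by (rule base_cong) (auto simp: base_arrays_def fr fr2)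
      then have bs: "base s2" using s(1) by simp
      have T: "s2 aT 0 = i" using fr2[of aT] 3(3) by simp
      then have "map (\<lambda>e. eval_exp e s2) (digsE q (Var aT)) = digs b q i"
        using eval_digsE[of N b s2 "Var aT" q] bs 3(1) by (simp add: base_def)
      moreover have "gst k xs (?gs i @ [(map (\<lambda>e. eval_exp e s2) (digsE q (Var aT)), map (\<lambda>e. eval_exp e s2) [])])
          (run N (gadget_prog (digsE q (Var aT)) []) s2)"
        using g2 reads_digsE[of _ q "Var aT"] by (intro run_gadget) fastforce+
      ultimately show ?thesis unfolding run using True by (simp add: gst_def olist_def)
    qed
  qed
qed

section \<open>Gaussian elimination over the field with two elements\<close>

definition Crd :: "nat \<Rightarrow> nat set" where
  "Crd x0 = {t. t < b ^ m \<and> set (digs b m t) \<subseteq> X \<and> x0 \<in> set (digs b m t)}"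

definition has :: "memory \<Rightarrow> nat \<Rightarrow> bool" where
  "has s p \<longleftrightarrow> s aHas p \<noteq> 0"

definition row :: "memory \<Rightarrow> nat \<Rightarrow> nat \<Rightarrow> nat" where
  "row s p c = s aRow (p * N + c)"

text \<open>Row echelon form, with each row stored at the index of its leading entry. Leading
  entries lie in \<open>Crd x0\<close>, so there are never more rows than tuples that contain
  \<open>x0\<close>.\<close>

definition basis :: "nat \<Rightarrow> memory \<Rightarrow> bool" where
  "basis x0 s \<longleftrightarrow> (\<forall>p<N. has s p \<longrightarrow> p \<in> Crd x0 \<and> row s p p = 1 \<and> (\<forall>c<p. row s p c = 0) \<and>
     (\<forall>c<N. row s p c \<le> 1 \<and> (row s p c \<noteq> 0 \<longrightarrow> c \<in> Crd x0)))"

text \<open>The sum of the members of the box other than the tuple itself, that is, the expression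
  of the tuple with code \<open>t\<close> by tuples that contain \<open>x0\<close>.\<close>

definition rel :: "nat \<Rightarrow> nat \<Rightarrow> nat \<Rightarrow> nat" where
  "rel x0 t = phi b m (tl (boxes (q - 1) x0 (digs b m t)))"

text \<open>Here \<open>boxes\<close> acts on lists of expressions when the program is written down:
  a box has constant size and is unrolled. By \<open>map_boxes\<close>, evaluation turns it into the
  box of the actual tuple.\<close>

definition vec_prog :: prog where
  "vec_prog = PFor aA (PAsg aVec (Var aA) (AndE (NotE (divE m (Var aA)))
     (Cell aOdd (SumE (map (\<lambda>w. AllE (map2 EqE (digsE m (Var aA)) w))
        (tl (boxes (q - 1) (Var aX0) (digsE m (Var aT)))))))))"

lemma length_tl_boxes: "length (tl (boxes (q - 1) x0 (s :: 'z list))) \<le> q * q" if "length s = m"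
proof -
  have "length (concat (map (\<lambda>s1. map (\<lambda>s2. s1 @ s2) B) A)) = length A * length B" for A B :: "'z list list"
    by (induction A) auto
  then have "length (boxes (q - 1) x0 s) = length (subs x0 (take (q - 1) s)) * length (subs x0 (drop (q - 1) s))"
    by (simp only: boxes_def)
  also have "\<dots> = q * q"
  proof -
    have "length (take (q - 1) s) = q - 1" "length (drop (q - 1) s) = q - 1" "Suc (q - 1) = q"
      using that q by auto
    then show ?thesis by (simp only: subs_def list.size length_map length_upt diff_zero add_Suc_right add_0_right)
  qed
  finally have "length (boxes (q - 1) x0 s) = q * q" .
  then show ?thesis by simp
qed

lemma AllE_EqE:
  assumes "length ds = length w"
  shows "eval_exp (AllE (map2 EqE ds w)) s =
    of_bool (map (\<lambda>e. eval_exp e s) ds = map (\<lambda>e. eval_exp e s) w)"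
  using assms by (induction ds w rule: list_induct2) (auto simp: AllE_def)

lemma sum_list_count: "sum_list (map (\<lambda>w. of_bool (d = f w)) W) = count_list (map f W) d"
  by (induction W) auto

lemma run_vec:
  assumes s: "base s" and t: "s aT 0 < N" and c: "c < N"
  shows "run N vec_prog s aVec c = rel (s aX0 0) (s aT 0) c"
proof -
  let ?x = "s aX0 0" and ?t = "s aT 0"
  have "\<forall>c<N. run N vec_prog s aVec c = rel ?x ?t c"
    unfolding vec_prog_def
  proof (rule for_rule[where I = "\<lambda>i s'. \<forall>c<i. s' aVec c = rel ?x ?t c"], goal_cases)
    case (3 i s')
    have "base s' = base s" by (rule base_cong) (auto simp: base_arrays_def 3(4))
    then have tb: "tables N b s'" using s by (simp add: base_def)
    have fr: "s' aT = s aT" "s' aX0 = s aX0" using 3(4)[of aT] 3(4)[of aX0] by auto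
    let ?f = "\<lambda>e. eval_exp e s'"
    let ?W = "tl (boxes (q - 1) (Var aX0) (digsE m (Var aT)))"
    have dig_i: "map ?f (digsE m (Var aA)) = digs b m i"
      using eval_digsE[OF tb, of "Var aA"] 3(1,3) by simp
    have dig_t: "map ?f (digsE m (Var aT)) = digs b m ?t"
      using eval_digsE[OF tb, of "Var aT"] t fr by simp
    have W: "map (map ?f) ?W = tl (boxes (q - 1) ?x (digs b m ?t))"
      unfolding map_tl map_boxes dig_t using fr by simp
    have len: "length w = m" if "w \<in> set ?W" for w
    proof -
      have "w \<in> set (boxes (q - 1) (Var aX0) (digsE m (Var aT)))"
        using that by (subst boxes_eq_Cons) auto
      then show ?thesis using length_boxes by fastforce
    qed
    have eq: "eval_exp (AllE (map2 EqE (digsE m (Var aA)) w)) s' = of_bool (digs b m i = map ?f w)"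
      if "w \<in> set ?W" for w
      unfolding AllE_EqE[OF trans[OF length_digsE len[OF that, symmetric]]] dig_i ..
    have "eval_exp (SumE (map (\<lambda>w. AllE (map2 EqE (digsE m (Var aA)) w)) ?W)) s' =
        sum_list (map (\<lambda>w. of_bool (digs b m i = map ?f w)) ?W)"
      unfolding eval_SumE map_map comp_def
      by (intro arg_cong[of _ _ sum_list] map_cong refl eq)
    also have "\<dots> = count_list (map (map ?f) ?W) (digs b m i)" by (rule sum_list_count)
    finally have sum: "eval_exp (SumE (map (\<lambda>w. AllE (map2 EqE (digsE m (Var aA)) w)) ?W)) s' =
        count_list (tl (boxes (q - 1) ?x (digs b m ?t))) (digs b m i)" unfolding W .
    \<comment> \<open>The parity comes from a table with entries up to \<open>N\<close>; this is the
      use of \<open>q * q\<close> \<le> \<open>N\<close>.\<close>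
    have "count_list (tl (boxes (q - 1) ?x (digs b m ?t))) (digs b m i) \<le> N"
      using count_le_length[of "tl (boxes (q - 1) ?x (digs b m ?t))"] length_tl_boxes[of "digs b m ?t" ?x] N
      by (meson le_trans length_digs)
    then have "s' aOdd (count_list (tl (boxes (q - 1) ?x (digs b m ?t))) (digs b m i)) =
        count_list (tl (boxes (q - 1) ?x (digs b m ?t))) (digs b m i) mod 2"
      using tb by (simp add: tables_def)
    moreover have "eval_exp (divE m (Var aA)) s' = i div b ^ m"
      using eval_divE[OF tb, of "Var aA" m] 3(1,3) by simp
    moreover define S where "S = AndE (NotE (divE m (Var aA)))
     (Cell aOdd (SumE (map (\<lambda>w. AllE (map2 EqE (digsE m (Var aA)) w)) ?W)))"
    ultimately have "eval_exp S s' = rel ?x ?t i"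
      unfolding S_def rel_def phi_def eval_AndE eval_NotE eval_exp.simps sum
      by (simp only: div_eq_0 of_bool_eq_0_iff not_not odd_iff_mod_2_eq_one) simp
    then show ?case unfolding S_def[symmetric] using 3(2,3) by (simp add: less_Suc_eq)
  qed auto
  then show ?thesis using c by simp
qed

text \<open>On \<open>{0, 1}\<close>, addition modulo 2 is the sum of the two truncated differences. The program \<open>G\<close>,
  which emits a gadget, runs only if the vector is independent of the rows stored so far.\<close>

definition elim_body :: "prog \<Rightarrow> prog" where
  "elim_body G = PIf (AndE (NotE (Var aFin)) (Cell aVec (Var aB)))
     (PIf (Cell aHas (Var aB))
       (PFor aA (PAsg aVec (Var aA)
         (let v = Cell aVec (Var aA); r = Cell aRow (Add (Cell aMul (Var aB)) (Var aA))
          in Add (Sub v r) (Sub r v))))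
       (seqs [PAsg aHas (Var aB) (Const 1),
         PFor aA (PAsg aRow (Add (Cell aMul (Var aB)) (Var aA)) (Cell aVec (Var aA))),
         PAsg aFin (Const 0) (Const 1), G])) PSkip"

lemma run_xor:
  assumes "base s" "s aB 0 < N" "c < N"
  shows "run N (PFor aA (PAsg aVec (Var aA)
         (let v = Cell aVec (Var aA); r = Cell aRow (Add (Cell aMul (Var aB)) (Var aA))
          in Add (Sub v r) (Sub r v)))) s aVec c =
     (s aVec c - row s (s aB 0) c) + (row s (s aB 0) c - s aVec c)"
proof -
  let ?f = "\<lambda>c. (s aVec c - row s (s aB 0) c) + (row s (s aB 0) c - s aVec c)"
  have "\<forall>c. run N (PFor aA (PAsg aVec (Var aA)
         (let v = Cell aVec (Var aA); r = Cell aRow (Add (Cell aMul (Var aB)) (Var aA))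
          in Add (Sub v r) (Sub r v)))) s aVec c = (if c < N then ?f c else s aVec c)"
  proof (rule for_rule[where I = "\<lambda>i s'. \<forall>c. s' aVec c = (if c < i then ?f c else s aVec c)"], goal_cases)
    case (3 i s')
    have "s' aB = s aB" "s' aRow = s aRow" "s' aMul = s aMul"
      using 3(4)[of aB] 3(4)[of aRow] 3(4)[of aMul] by (auto simp: Let_def)
    moreover have "s aMul (s aB 0) = s aB 0 * N"
      using assms by (simp add: base_def tables_def)
    ultimately show ?case using 3(2,3) by (auto simp: Let_def row_def less_Suc_eq)
  qed (auto simp: Let_def)
  then show ?thesis using assms(3) by simp
qed

lemma run_copy:
  assumes "base s" "s aB 0 < N" "p < N" "c < N"
  shows "row (run N (PFor aA (PAsg aRow (Add (Cell aMul (Var aB)) (Var aA)) (Cell aVec (Var aA)))) s) p c =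
     (if p = s aB 0 then s aVec c else row s p c)"
proof -
  have "\<forall>p<N. \<forall>c<N. row (run N (PFor aA (PAsg aRow (Add (Cell aMul (Var aB)) (Var aA)) (Cell aVec (Var aA)))) s) p c =
     (if p = s aB 0 \<and> c < N then s aVec c else row s p c)"
  proof (rule for_rule[where I = "\<lambda>i s'. \<forall>p<N. \<forall>c<N. row s' p c =
      (if p = s aB 0 \<and> c < i then s aVec c else row s p c)"], goal_cases)
    case (3 i s')
    have "s' aB = s aB" "s' aVec = s aVec" "s' aMul = s aMul"
      using 3(4)[of aB] 3(4)[of aVec] 3(4)[of aMul] by auto
    moreover have "s aMul (s aB 0) = s aB 0 * N"
      using assms by (simp add: base_def tables_def)
    ultimately show ?case using 3(1-3) index_inj by (auto simp: row_def less_Suc_eq)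
  qed (auto simp: row_def)
  then show ?thesis using assms(3,4) by simp
qed


definition elim_prog :: "prog \<Rightarrow> prog" where
  "elim_prog G = PSeq (PAsg aFin (Const 0) (Const 0)) (PFor aB (elim_body G))"

text \<open>\<open>l\<close> vanishes on all stored rows. Linear dependence is treated by duality
  only: a vector depends on the rows if every such \<open>l\<close> vanishes on it, and no
  coefficients are ever kept.\<close>

definition spans :: "memory \<Rightarrow> (nat \<Rightarrow> nat) \<Rightarrow> bool" where
  "spans s l \<longleftrightarrow> (\<forall>p<N. has s p \<longrightarrow> ev N l (row s p))"

text \<open>The outcome of an elimination that stores a row: the reduced vector occupies a free
  leading position \<open>p0\<close> and agrees with \<open>v\<close> modulo the old rows. The last
  clause says that the output changed by one run of \<open>G\<close>, started in a state that
  differs from \<open>s\<close> only in rows and scratch arrays.\<close>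

definition inserted :: "prog \<Rightarrow> nat \<Rightarrow> memory \<Rightarrow> (nat \<Rightarrow> nat) \<Rightarrow> memory \<Rightarrow> bool" where
  "inserted G x0 s v s' \<longleftrightarrow> (\<exists>p0<N. \<not> has s p0 \<and> (\<forall>p<N. has s' p \<longleftrightarrow> has s p \<or> p = p0) \<and>
     (\<forall>p<N. p \<noteq> p0 \<longrightarrow> (\<forall>c<N. row s' p c = row s p c)) \<and> basis x0 s' \<and>
     (\<forall>l. spans s l \<longrightarrow> (ev N l (row s' p0) \<longleftrightarrow> ev N l v)) \<and>
     (\<exists>s1. (\<forall>a. a \<notin> {aFin, aB, aA, aVec, aHas, aRow} \<longrightarrow> s1 a = s a) \<and>
        (\<forall>a\<in>{aOW, aOC, aNV, aR}. s' a = run N G s1 a)))"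

lemma inserted_cong:
  assumes "\<And>a. a \<in> {aHas, aRow, aOW, aOC, aNV, aR} \<Longrightarrow> s'' a = s' a"
  shows "inserted G x0 s v s'' = inserted G x0 s v s'"
proof -
  have "has s'' = has s'" "row s'' = row s'" using assms by (simp_all add: has_def row_def fun_eq_iff)
  then show ?thesis using assms unfolding inserted_def basis_def by simp
qed

text \<open>As long as nothing has been stored, the entries below the current column are 0 and the
  vector has changed only by rows, which no functional in \<open>spans s\<close> can see. A nonzero
  entry at a column with a row is cleared by that row; at a column without one, the vector itself
  becomes the row.\<close>

lemma run_elim:
  assumes base: "base s" and bas: "basis x0 s"
    and v: "\<And>c. c < N \<Longrightarrow> s aVec c \<le> 1 \<and> (s aVec c \<noteq> 0 \<longrightarrow> c \<in> Crd x0)"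
    and G: "writes G \<subseteq> {aOW, aOC, aNV}"
  defines "s' \<equiv> run N (elim_prog G) s"
  shows "((\<forall>a. a \<notin> {aFin, aB, aA, aVec} \<longrightarrow> s' a = s a) \<and> (\<forall>l. spans s l \<longrightarrow> ev N l (s aVec))) \<or>
    inserted G x0 s (s aVec) s'"
proof -
  let ?F = "\<lambda>s'. \<forall>a. a \<notin> {aFin, aB, aA, aVec} \<longrightarrow> s' a = s a"
  let ?V = "\<lambda>i s'. (\<forall>c<N. s' aVec c \<le> 1 \<and> (s' aVec c \<noteq> 0 \<longrightarrow> c \<in> Crd x0)) \<and>
     (\<forall>c<N. c < i \<longrightarrow> s' aVec c = 0) \<and> (\<forall>l. spans s l \<longrightarrow> (ev N l (s' aVec) \<longleftrightarrow> ev N l (s aVec)))"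
  let ?I = "\<lambda>i s'. if s' aFin 0 = 0 then ?F s' \<and> ?V i s' else inserted G x0 s (s aVec) s'"
  define s0 where "s0 = setc aFin 0 0 s"
  define P where "P = PFor aA (PAsg aVec (Var aA)
     (let v = Cell aVec (Var aA); r = Cell aRow (Add (Cell aMul (Var aB)) (Var aA))
      in Add (Sub v r) (Sub r v)))"
  define Q where "Q = PFor aA (PAsg aRow (Add (Cell aMul (Var aB)) (Var aA)) (Cell aVec (Var aA)))"
  have body: "elim_body G = PIf (AndE (NotE (Var aFin)) (Cell aVec (Var aB)))
     (PIf (Cell aHas (Var aB)) P
       (seqs [PAsg aHas (Var aB) (Const 1), Q, PAsg aFin (Const 0) (Const 1), G])) PSkip"
    by (simp add: elim_body_def P_def Q_def)
  have I_cong: "?I i (setc aB 0 j s') = ?I i s'" for i j s'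
  proof -
    have "inserted G x0 s w (setc aB 0 j s') = inserted G x0 s w s'" for w
      by (rule inserted_cong) auto
    then show ?thesis by simp
  qed
  have "?I N (run N (PFor aB (elim_body G)) s0)"
  proof (rule for_rule[where I = ?I], goal_cases)
    case 1
    then show ?case using G by (auto simp: elim_body_def Let_def)
  next
    case 2
    then show ?case unfolding I_cong using v by (simp add: s0_def)
  next
    case (3 i s')
    have "?I (Suc i) (run N (elim_body G) s')"
    proof (cases "s' aFin 0 = 0")
      case False
      then show ?thesis using 3(2) by (simp add: elim_body_def)
    next
      case fin: True
      then have F: "\<And>a. a \<notin> {aFin, aB, aA, aVec} \<Longrightarrow> s' a = s a" and V: "?V i s'" using 3(2) by simp_all
      have hr: "has s' = has s" "row s' = row s" using F by (simp_all add: has_def row_def fun_eq_iff)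
      have h: "s' aHas i = 0 \<longleftrightarrow> \<not> has s i" unfolding hr(1)[symmetric] by (simp add: has_def)
      have "base s' = base s" by (rule base_cong) (auto simp: base_arrays_def F)
      then have b': "base s'" using base by simp
      show ?thesis
      proof (cases "s' aVec i = 0")
        case True
        then have "run N (elim_body G) s' = s'" using 3(3) by (simp add: elim_body_def)
        then show ?thesis using fin F V True by (simp add: less_Suc_eq)
      next
        case vi: False
        then have vi1: "s' aVec i = 1" "i \<in> Crd x0" using V 3(1) by (auto simp: le_Suc_eq)
        show ?thesis
        proof (cases "has s i")
          case True
          have r: "row s i i = 1" "\<And>c. c < i \<Longrightarrow> row s i c = 0"
            "\<And>c. c < N \<Longrightarrow> row s i c \<le> 1 \<and> (row s i c \<noteq> 0 \<longrightarrow> c \<in> Crd x0)"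
            using bas True 3(1) by (auto simp: basis_def)
          define s2 where "s2 = run N P s'"
          have run: "run N (elim_body G) s' = s2"
            using fin vi True 3(3) h by (simp add: body s2_def)
          have x: "s2 aVec c = (s' aVec c - row s i c) + (row s i c - s' aVec c)" if "c < N" for c
            using run_xor[OF b' _ that] 3(1,3) hr(2) by (simp add: s2_def P_def)
          have f2: "s2 a = s' a" if "a \<notin> {aA, aVec}" for a
            unfolding s2_def P_def by (rule run_frame) (use that in \<open>simp add: Let_def\<close>)
          \<comment> \<open>The row has entry 1 at \<open>i\<close> and 0 before it, so adding it
            clears entry \<open>i\<close> and keeps the earlier zeros.\<close>
          have "?V (Suc i) s2"
          proof (intro conjI allI impI)
            fix c assume "c < N"
            then show "s2 aVec c \<le> 1" using x V r(3)[of c] by (auto simp: le_Suc_eq)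
            assume "s2 aVec c \<noteq> 0"
            then show "c \<in> Crd x0" using x V r(3)[of c] \<open>c < N\<close> by fastforce
          next
            fix c assume "c < N" "c < Suc i"
            then show "s2 aVec c = 0" using x V r vi1 by (cases "c = i") auto
          next
            fix l assume sp: "spans s l"
            have "ev N l (s2 aVec) = ev N l (\<lambda>c. (s' aVec c - row s i c) + (row s i c - s' aVec c))"
              by (rule ev_cong) (rule x)
            also have "\<dots> = (ev N l (s' aVec) = ev N l (row s i))"
              by (rule ev_xor) (use V r(3) in auto)
            finally have "ev N l (s2 aVec) = (ev N l (s' aVec) = ev N l (row s i))" .
            moreover have "ev N l (row s i)" using sp True 3(1) by (simp add: spans_def)
            moreover have "ev N l (s' aVec) = ev N l (s aVec)" using V sp by blast
            ultimately show "ev N l (s2 aVec) = ev N l (s aVec)" by simp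
          qed
          then show ?thesis unfolding run using f2 F fin by simp
        next
          case False
          \<comment> \<open>All entries before \<open>i\<close> are cleared, so the vector has its
            leading entry at \<open>i\<close> and fits the echelon form as it stands.\<close>
          define s1 where "s1 = setc aHas i 1 s'"
          define s2 where "s2 = run N Q s1"
          define s3 where "s3 = setc aFin 0 1 s2"
          have run: "run N (elim_body G) s' = run N G s3"
            using fin vi False 3(3) h by (simp add: body s3_def s2_def s1_def)
          have "base s1 = base s'" by (rule base_cong) (auto simp: base_arrays_def s1_def)
          then have "base s1" using b' by simp
          have "row s1 = row s'" by (simp add: row_def s1_def fun_eq_iff)
          then have s1f: "s1 aB 0 = i" "s1 aVec = s' aVec" "row s1 = row s"
            using 3(3) hr(2) by (simp_all add: s1_def)
          have cp: "row s2 p c = (if p = i then s' aVec c else row s p c)" if "p < N" "c < N" for p c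
            using run_copy[OF \<open>base s1\<close> _ that, folded Q_def, folded s2_def] 3(1) unfolding s1f by simp
          have f2: "s2 a = s1 a" if "a \<notin> {aA, aRow}" for a
            unfolding s2_def Q_def by (rule run_frame) (use that in simp)
          have fG: "run N G s3 a = s3 a" if "a \<notin> {aOW, aOC, aNV}" for a
            using G that by (intro run_frame) blast
          let ?r = "run N G s3"
          have row: "row ?r p c = (if p = i then s' aVec c else row s p c)" if "p < N" "c < N" for p c
            using cp[OF that] fG[of aRow] by (simp add: row_def s3_def)
          have hs: "has ?r p \<longleftrightarrow> has s p \<or> p = i" for p
            using fG[of aHas] f2[of aHas] hr(1) by (auto simp: has_def s3_def s1_def fun_eq_iff)
          have fin1: "?r aFin 0 = 1" using fG[of aFin] by (simp add: s3_def)
          have "inserted G x0 s (s aVec) ?r"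
            unfolding inserted_def
          proof (intro exI[of _ i] conjI allI impI)
            show "basis x0 ?r"
              unfolding basis_def
            proof (intro allI impI, goal_cases)
              case (1 p)
              show ?case
              proof (cases "p = i")
                case True
                then show ?thesis using row 1 vi1 V by simp
              next
                case False
                then have "has s p" using 1 hs by simp
                then show ?thesis using row 1 False bas unfolding basis_def by simp
              qed
            qed
            fix l assume sp: "spans s l"
            have "ev N l (row ?r i) = ev N l (s' aVec)"
              by (rule ev_cong) (use row 3(1) in simp)
            then show "ev N l (row ?r i) = ev N l (s aVec)" using V sp by simp
          next
            show "\<exists>s1. (\<forall>a. a \<notin> {aFin, aB, aA, aVec, aHas, aRow} \<longrightarrow> s1 a = s a) \<and>
                (\<forall>a\<in>{aOW, aOC, aNV, aR}. ?r a = run N G s1 a)"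
              using f2 F by (intro exI[of _ s3]) (simp add: s3_def s1_def)
          qed (use 3(1) False hs row in auto)
          then show ?thesis unfolding run using fin1 by simp
        qed
      qed
    qed
    then show ?case unfolding I_cong .
  qed
  moreover have "s' = run N (PFor aB (elim_body G)) s0" by (simp add: s'_def elim_prog_def s0_def)
  ultimately have I: "?I N s'" by (simp only:)
  show ?thesis
  proof (cases "s' aFin 0 = 0")
    case True
    then have "?F s'" "?V N s'" using I by simp_all
    moreover have "ev N l (s' aVec)" for l
    proof -
      \<comment> \<open>Every column has been cleared without storing a row. The reduced vector is
        0, hence the original one depends on the rows.\<close>
      have "ev N l (s' aVec) = ev N l (\<lambda>_. 0)" by (rule ev_cong) (use \<open>?V N s'\<close> in simp)
      then show ?thesis by (simp add: ev_def)
    qed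
    ultimately show ?thesis by simp
  next
    case False
    then show ?thesis using I by simp
  qed
qed

section \<open>Constraints of the second kind\<close>

definition C2 :: "nat \<Rightarrow> bool" where
  "C2 t \<longleftrightarrow> t < b ^ m \<and> set (digs b m t) \<subseteq> X \<and> (\<exists>u<n. \<exists>v<n. u \<notin> X \<and> v \<notin> X \<and> {u, v} \<in> E \<and>
     (\<forall>y\<in>set (take (q - 1) (digs b m t)). {u, y} \<in> E) \<and> (\<forall>y\<in>set (drop (q - 1) (digs b m t)). {v, y} \<in> E))"

definition e2 :: exp where
  "e2 = AllE ([NotE (divE m (Var aT)), offE (Var aA), offE (Var aB), adjE (Var aA) (Var aB)] @
     map onE (digsE m (Var aT)) @
     map (adjE (Var aA)) (take (q - 1) (digsE m (Var aT))) @
     map (adjE (Var aB)) (drop (q - 1) (digsE m (Var aT))))"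

definition G2 :: prog where
  "G2 = gadget_prog (take (q - 1) (digsE m (Var aT))) (drop (q - 1) (digsE m (Var aT)))"

definition t2_prog :: prog where
  "t2_prog = PFor aT (seqs [PAsg aFound (Const 0) (Const 0), scan [aA, aB] e2 aFound 1,
     PIf (Var aFound) (PSeq vec_prog (elim_prog G2)) PSkip])"

lemma eval_e2:
  assumes bs: "base s" and t: "s aT 0 < N" and A: "s aA 0 = u" and B: "s aB 0 = v"
  defines "d \<equiv> digs b m (s aT 0)"
  shows "eval_exp e2 s \<noteq> 0 \<longleftrightarrow> s aT 0 < b ^ m \<and> u < n \<and> u \<notin> X \<and> v < n \<and> v \<notin> X \<and> {u, v} \<in> E \<and>
    set d \<subseteq> X \<and> (\<forall>y\<in>set (take (q - 1) d). {u, y} \<in> E) \<and> (\<forall>y\<in>set (drop (q - 1) d). {v, y} \<in> E)"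
proof -
  have tb: "tables N b s" "eval_exp (Var aT) s \<le> N" using bs t by (simp_all add: base_def)
  let ?D = "digsE m (Var aT)"
  have D: "map (\<lambda>e. eval_exp e s) ?D = d" using eval_digsE[OF tb, of m] by (simp add: d_def)
  have set_D: "set d = (\<lambda>e. eval_exp e s) ` set ?D"
    "set (take (q - 1) d) = (\<lambda>e. eval_exp e s) ` set (take (q - 1) ?D)"
    "set (drop (q - 1) d) = (\<lambda>e. eval_exp e s) ` set (drop (q - 1) ?D)"
    unfolding D[symmetric] take_map drop_map by simp_all
  have "eval_exp e2 s \<noteq> 0 \<longleftrightarrow> s aT 0 < b ^ m \<and> (u < s aVtx 0 \<and> s aXF u = 0) \<and> (v < s aVtx 0 \<and> s aXF v = 0) \<and>
     s aAdj (s aMul u + v) \<noteq> 0 \<and> (\<forall>y\<in>set d. y < s aVtx 0 \<and> s aXF y \<noteq> 0) \<and>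
     (\<forall>y\<in>set (take (q - 1) d). s aAdj (s aMul u + y) \<noteq> 0) \<and>
     (\<forall>y\<in>set (drop (q - 1) d). s aAdj (s aMul v + y) \<noteq> 0)"
    unfolding set_D
    by (simp add: e2_def A B ball_Un eval_divE[OF tb] div_eq_0) blast
  also have "\<dots> \<longleftrightarrow> s aT 0 < b ^ m \<and> (u < n \<and> u \<notin> X) \<and> (v < n \<and> v \<notin> X) \<and>
     s aAdj (s aMul u + v) \<noteq> 0 \<and> (\<forall>y\<in>set d. y \<in> X) \<and>
     (\<forall>y\<in>set (take (q - 1) d). s aAdj (s aMul u + y) \<noteq> 0) \<and>
     (\<forall>y\<in>set (drop (q - 1) d). s aAdj (s aMul v + y) \<noteq> 0)"
    unfolding base_on[OF bs] base_off[OF bs] ..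
  also have "\<dots> \<longleftrightarrow> s aT 0 < b ^ m \<and> (u < n \<and> u \<notin> X) \<and> (v < n \<and> v \<notin> X) \<and>
     {u, v} \<in> E \<and> (\<forall>y\<in>set d. y \<in> X) \<and>
     (\<forall>y\<in>set (take (q - 1) d). {u, y} \<in> E) \<and> (\<forall>y\<in>set (drop (q - 1) d). {v, y} \<in> E)"
  proof -
    have "s aAdj (s aMul w + y) \<noteq> 0 \<longleftrightarrow> {w, y} \<in> E" if "w < n" "y \<in> X" for w y
      using base_adj[OF bs that(1), of y] that(2) Xn by auto
    moreover have "y \<in> set d" if "y \<in> set (take (q - 1) d) \<or> y \<in> set (drop (q - 1) d)" for y
      using that by (meson in_set_takeD in_set_dropD)
    moreover have "s aAdj (s aMul u + v) \<noteq> 0 \<longleftrightarrow> {u, v} \<in> E" if "u < n" "v < n"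
      using base_adj[OF bs that] .
    ultimately show ?thesis by (intro conj_cong refl ball_cong) blast+
  qed
  finally show ?thesis by blast
qed

text \<open>Members of a box use only \<open>x0\<close> and entries of the tuple, and all of them
  except the head contain \<open>x0\<close>; so the vector lives on the coordinates
  \<open>Crd x0\<close>.\<close>

lemma rel_props:
  assumes "C2 t" "x0 \<in> X"
  shows "rel x0 t c \<le> 1" "rel x0 t c \<noteq> 0 \<Longrightarrow> c \<in> Crd x0"
proof -
  show "rel x0 t c \<le> 1" by (simp add: rel_def phi_def)
  assume "rel x0 t c \<noteq> 0"
  then have c: "c < b ^ m" "odd (count_list (tl (boxes (q - 1) x0 (digs b m t))) (digs b m c))"
    by (auto simp: rel_def phi_def split: if_splits)
  then have w: "digs b m c \<in> set (tl (boxes (q - 1) x0 (digs b m t)))"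
    by (metis count_notin even_zero)
  then have "digs b m c \<in> set (boxes (q - 1) x0 (digs b m t))" by (subst boxes_eq_Cons) simp
  from set_boxes[OF this] tl_boxes_mem[OF w] c(1) assms show "c \<in> Crd x0"
    by (auto simp: Crd_def C2_def)
qed

text \<open>\<open>mk\<close> lists the codes whose gadgets have been emitted, one for each stored
  row. The last two clauses are span inclusions in dual form: the rows lie in the span of the
  relations of \<open>mk\<close>, and the relations of all candidates below \<open>i\<close> lie in
  the span of the rows.\<close>

definition t2_inv :: "nat \<Rightarrow> (nat \<times> nat) list \<Rightarrow> (nat list \<times> nat list) list \<Rightarrow> nat \<Rightarrow> nat \<Rightarrow> nat list \<Rightarrow> memory \<Rightarrow> bool" where
  "t2_inv k xs gs x0 i mk s \<longleftrightarrow>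
     gst k xs (gs @ map (\<lambda>t. (take (q - 1) (digs b m t), drop (q - 1) (digs b m t))) mk) s \<and>
     basis x0 s \<and> set mk \<subseteq> {t. t < i \<and> C2 t} \<and> card {p. p < N \<and> has s p} = length mk \<and>
     (\<forall>l. (\<forall>t\<in>set mk. ev N l (rel x0 t)) \<longrightarrow> spans s l) \<and>
     (\<forall>l. spans s l \<longrightarrow> (\<forall>t<i. C2 t \<longrightarrow> ev N l (rel x0 t)))"

lemma t2_inv_cong:
  assumes "\<And>a. a \<in> {aHas, aRow, aOW, aOC, aNV, aR} \<Longrightarrow> s' a = s a"
  shows "t2_inv k xs gs x0 i mk s' = t2_inv k xs gs x0 i mk s"
proof -
  have "has s' = has s" "row s' = row s" using assms by (simp_all add: has_def row_def fun_eq_iff)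
  moreover have "gst k xs g s' = gst k xs g s" for g using assms by (intro gst_cong) auto
  ultimately show ?thesis unfolding t2_inv_def basis_def spans_def by simp
qed

lemma t2_step:
  assumes inv: "t2_inv k xs gs x0 i mk s" and bs: "base s" and T: "s aT 0 = i" and i: "i < N"
    and x0: "s aX0 0 = x0" and C: "C2 i"
  shows "\<exists>mk'. t2_inv k xs gs x0 (Suc i) mk' (run N (PSeq vec_prog (elim_prog G2)) s)"
proof -
  define s1 where "s1 = run N vec_prog s"
  define s2 where "s2 = run N (elim_prog G2) s1"
  have f1: "s1 a = s a" if "a \<notin> {aA, aVec}" for a
    unfolding s1_def by (rule run_frame) (use that in \<open>simp add: vec_prog_def\<close>)
  have hr1: "has s1 = has s" "row s1 = row s" using f1 by (simp_all add: has_def row_def fun_eq_iff)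
  have sp1: "spans s1 = spans s" by (simp add: spans_def hr1 fun_eq_iff)
  have vec: "s1 aVec c = rel x0 i c" if "c < N" for c
    using run_vec[OF bs _ that] T i x0 by (simp add: s1_def)
  have "base s1 = base s" by (rule base_cong) (auto simp: base_arrays_def f1)
  then have b1: "base s1" using bs by simp
  \<comment> \<open>A candidate is a nonempty tuple over \<open>X\<close>, so \<open>X\<close> is
    nonempty and the stored \<open>x0\<close> belongs to it.\<close>
  have "set (digs b m i) \<noteq> {}" using q by (cases m) (auto simp: digs_Suc)
  then have "X \<noteq> {}" using C by (auto simp: C2_def)
  then have xX: "x0 \<in> X" using bs x0 unfolding base_def graph_mem_def by blast
  have wG: "writes G2 \<subseteq> {aOW, aOC, aNV}" unfolding G2_def by (rule writes_gadget)
  have "t2_inv k xs gs x0 i mk s1 = t2_inv k xs gs x0 i mk s" by (rule t2_inv_cong) (auto simp: f1)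
  then have inv1: "t2_inv k xs gs x0 i mk s1" using inv by simp
  have ev_vec: "ev N l (s1 aVec) = ev N l (rel x0 i)" for l by (rule ev_cong) (rule vec)
  have run: "run N (PSeq vec_prog (elim_prog G2)) s = s2" by (simp add: s2_def s1_def)
  have "((\<forall>a. a \<notin> {aFin, aB, aA, aVec} \<longrightarrow> s2 a = s1 a) \<and> (\<forall>l. spans s1 l \<longrightarrow> ev N l (s1 aVec))) \<or>
    inserted G2 x0 s1 (s1 aVec) s2"
    unfolding s2_def
  proof (rule run_elim[OF b1 _ _ wG])
    show "basis x0 s1" using inv1 by (simp add: t2_inv_def)
    show "s1 aVec c \<le> 1 \<and> (s1 aVec c \<noteq> 0 \<longrightarrow> c \<in> Crd x0)" if "c < N" for c
      unfolding vec[OF that] using rel_props[OF C xX] by blast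
  qed
  then show ?thesis
  proof
    assume A: "(\<forall>a. a \<notin> {aFin, aB, aA, aVec} \<longrightarrow> s2 a = s1 a) \<and> (\<forall>l. spans s1 l \<longrightarrow> ev N l (s1 aVec))"
    then have "t2_inv k xs gs x0 i mk s2 = t2_inv k xs gs x0 i mk s1" by (intro t2_inv_cong) auto
    then have "t2_inv k xs gs x0 i mk s2" using inv1 by simp
    moreover have "has s2 = has s1" "row s2 = row s1" using A by (simp_all add: has_def row_def fun_eq_iff)
    then have "spans s2 = spans s1" unfolding spans_def[abs_def] by simp
    ultimately have "t2_inv k xs gs x0 (Suc i) mk s2"
      using A ev_vec unfolding t2_inv_def by (auto simp: less_Suc_eq)
    then show ?thesis unfolding run ..
  next
    assume "inserted G2 x0 s1 (s1 aVec) s2"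
    from this[unfolded inserted_def] obtain p0 where P: "p0 < N" "\<not> has s1 p0"
      "\<forall>p<N. has s2 p \<longleftrightarrow> has s1 p \<or> p = p0"
      "\<forall>p<N. p \<noteq> p0 \<longrightarrow> (\<forall>c<N. row s2 p c = row s1 p c)" "basis x0 s2"
      "\<forall>l. spans s1 l \<longrightarrow> (ev N l (row s2 p0) \<longleftrightarrow> ev N l (s1 aVec))"
      "\<exists>s3. (\<forall>a. a \<notin> {aFin, aB, aA, aVec, aHas, aRow} \<longrightarrow> s3 a = s1 a) \<and>
        (\<forall>a\<in>{aOW, aOC, aNV, aR}. s2 a = run N G2 s3 a)"
      by (elim exE conjE) (rule that, assumption+, rule exI, rule conjI, assumption+)
    from P(7) obtain s3 where s3: "\<And>a. a \<notin> {aFin, aB, aA, aVec, aHas, aRow} \<Longrightarrow> s3 a = s1 a"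
      and G: "\<And>a. a \<in> {aOW, aOC, aNV, aR} \<Longrightarrow> s2 a = run N G2 s3 a" by blast
    have p0: "p0 < N" "\<not> has s1 p0" and h2: "\<And>p. p < N \<Longrightarrow> has s2 p \<longleftrightarrow> has s1 p \<or> p = p0"
      and r2: "\<And>p c. p < N \<Longrightarrow> p \<noteq> p0 \<Longrightarrow> c < N \<Longrightarrow> row s2 p c = row s1 p c" and bas: "basis x0 s2"
      and ev0: "\<And>l. spans s1 l \<Longrightarrow> ev N l (row s2 p0) \<longleftrightarrow> ev N l (s1 aVec)"
      using P by auto
    \<comment> \<open>Modulo the old rows the new row equals \<open>rel x0 i\<close>, so the
      functionals that vanish on the new set of rows are those that vanish on the old rows and on
      this relation.\<close>
    have sp2: "spans s2 l \<longleftrightarrow> spans s1 l \<and> ev N l (rel x0 i)" for l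
    proof -
      have "ev N l (row s2 p) = ev N l (row s1 p)" if "p < N" "p \<noteq> p0" for p
        by (rule ev_cong) (use r2 that in blast)
      then have "spans s2 l \<longleftrightarrow> spans s1 l \<and> ev N l (row s2 p0)"
        using h2 p0 unfolding spans_def by metis
      then show ?thesis using ev0 ev_vec by blast
    qed
    let ?g = "\<lambda>mk. gs @ map (\<lambda>t. (take (q - 1) (digs b m t), drop (q - 1) (digs b m t))) mk"
    have "gst k xs (?g mk) s3" using inv1 gst_cong[of s3 s1] s3 by (simp add: t2_inv_def)
    then have "gst k xs (?g mk @ [(map (\<lambda>e. eval_exp e s3) (take (q - 1) (digsE m (Var aT))),
        map (\<lambda>e. eval_exp e s3) (drop (q - 1) (digsE m (Var aT))))]) (run N G2 s3)"
      unfolding G2_def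
    proof (rule run_gadget)
      fix e assume "e \<in> set (take (q - 1) (digsE m (Var aT)) @ drop (q - 1) (digsE m (Var aT)))"
      then have "e \<in> set (digsE m (Var aT))" by (simp add: append_take_drop_id)
      from reads_digsE[OF this] show "reads e \<inter> {aOW, aOC} = {}" by auto
    qed
    moreover have "map (\<lambda>e. eval_exp e s3) (digsE m (Var aT)) = digs b m i"
    proof -
      have "base s3 = base s1" by (rule base_cong) (auto simp: base_arrays_def s3)
      then have "tables N b s3" using b1 by (simp add: base_def)
      moreover have "s3 aT 0 = i" using s3[of aT] f1[of aT] T by simp
      ultimately show ?thesis using eval_digsE[of N b s3 "Var aT" m] i by simp
    qed
    ultimately have "gst k xs (?g (mk @ [i])) (run N G2 s3)"
      by (simp add: take_map[symmetric] drop_map[symmetric])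
    then have "gst k xs (?g (mk @ [i])) s2" using gst_cong[of s2 "run N G2 s3"] G by simp
    moreover have "card {p. p < N \<and> has s2 p} = Suc (length mk)"
    proof -
      have "{p. p < N \<and> has s2 p} = insert p0 {p. p < N \<and> has s1 p}" using h2 p0 by auto
      then show ?thesis using p0 inv1 by (simp add: t2_inv_def)
    qed
    ultimately have "t2_inv k xs gs x0 (Suc i) (mk @ [i]) s2"
      using inv1 bas C sp2 unfolding t2_inv_def by (auto simp: less_Suc_eq)
    then show ?thesis unfolding run ..
  qed
qed

lemma run_t2:
  assumes s: "base s" "gst k xs gs s" and z: "\<And>i. s aHas i = 0"
  shows "\<exists>mk. t2_inv k xs gs (s aX0 0) N mk (run N t2_prog s)"
proof -
  let ?x = "s aX0 0"
  have wG: "writes G2 \<subseteq> {aOW, aOC, aNV}" unfolding G2_def by (rule writes_gadget)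
  have wp: "writes (PSeq vec_prog (elim_prog G2)) \<subseteq> {aA, aB, aVec, aFin, aHas, aRow, aOW, aOC, aNV}"
    using wG by (auto simp: vec_prog_def elim_prog_def elim_body_def Let_def)
  show ?thesis
    unfolding t2_prog_def
  proof (rule for_rule[where I = "\<lambda>i s'. \<exists>mk. t2_inv k xs gs ?x i mk s'"], goal_cases)
    case 1
    then show ?case using wp by auto
  next
    case 2
    have "t2_inv k xs gs ?x 0 [] s"
      using s(2) z by (simp add: t2_inv_def basis_def has_def spans_def)
    moreover have "t2_inv k xs gs ?x 0 [] (setc aT 0 0 s) = t2_inv k xs gs ?x 0 [] s"
      by (rule t2_inv_cong) auto
    ultimately show ?case by blast
  next
    case (3 i s')
    then obtain mk where inv: "t2_inv k xs gs ?x i mk s'" by blast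
    have fr: "s' a = s a" if "a \<notin> {aT, aFound, aA, aB, aVec, aFin, aHas, aRow, aOW, aOC, aNV}" for a
      using 3(4)[of a] that wp by auto
    define s1 where "s1 = setc aFound 0 0 s'"
    define s2 where "s2 = run N (scan [aA, aB] e2 aFound 1) s1"
    have f2: "s2 a = s' a" if "a \<notin> {aA, aB, aFound}" for a
      unfolding s2_def using that by (subst run_frame) (auto simp: s1_def)
    let ?d = "digs b m i"
    let ?Q = "\<lambda>u v. i < b ^ m \<and> u < n \<and> u \<notin> X \<and> v < n \<and> v \<notin> X \<and> {u, v} \<in> E \<and>
      set ?d \<subseteq> X \<and> (\<forall>y\<in>set (take (q - 1) ?d). {u, y} \<in> E) \<and> (\<forall>y\<in>set (drop (q - 1) ?d). {v, y} \<in> E)"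
    have "s2 aFound 0 = (if \<exists>xs. length xs = length [aA, aB] \<and> set xs \<subseteq> {..<N} \<and> ?Q (xs ! 0) (xs ! 1) then 1 else s1 aFound 0)"
      unfolding s2_def
    proof (rule run_scan)
      fix s'' assume fr3: "\<And>a. a \<notin> insert aFound (set [aA, aB]) \<Longrightarrow> s'' a = s1 a"
      have "base s'' = base s" by (rule base_cong) (auto simp: base_arrays_def fr fr3 s1_def)
      then have bs: "base s''" using s(1) by simp
      have T: "s'' aT 0 = i" using fr3[of aT] 3(3) by (simp add: s1_def)
      show "eval_exp e2 s'' \<noteq> 0 \<longleftrightarrow> ?Q (map (\<lambda>v. s'' v 0) [aA, aB] ! 0) (map (\<lambda>v. s'' v 0) [aA, aB] ! 1)"
        using eval_e2[OF bs _ refl refl] T 3(1) by simp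
    qed auto
    moreover have "(\<exists>xs. length xs = length [aA, aB] \<and> set xs \<subseteq> {..<N} \<and> ?Q (xs ! 0) (xs ! 1)) \<longleftrightarrow> C2 i"
    proof
      assume "\<exists>xs. length xs = length [aA, aB] \<and> set xs \<subseteq> {..<N} \<and> ?Q (xs ! 0) (xs ! 1)"
      then show "C2 i" unfolding C2_def by blast
    next
      assume "C2 i"
      then obtain u v where uv: "?Q u v" unfolding C2_def by blast
      then show "\<exists>xs. length xs = length [aA, aB] \<and> set xs \<subseteq> {..<N} \<and> ?Q (xs ! 0) (xs ! 1)"
        using bN by (intro exI[of _ "[u, v]"]) simp
    qed
    ultimately have found: "s2 aFound 0 \<noteq> 0 \<longleftrightarrow> C2 i" by (simp add: s1_def)
    have run: "run N (seqs [PAsg aFound (Const 0) (Const 0), scan [aA, aB] e2 aFound 1,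
       PIf (Var aFound) (PSeq vec_prog (elim_prog G2)) PSkip]) s' =
       (if C2 i then run N (PSeq vec_prog (elim_prog G2)) s2 else s2)"
      using found by (simp add: s1_def s2_def)
    have "t2_inv k xs gs ?x i mk s2 = t2_inv k xs gs ?x i mk s'" by (rule t2_inv_cong) (auto simp: f2)
    then have inv2: "t2_inv k xs gs ?x i mk s2" using inv by simp
    have "\<exists>mk'. t2_inv k xs gs ?x (Suc i) mk' (if C2 i then run N (PSeq vec_prog (elim_prog G2)) s2 else s2)"
    proof (cases "C2 i")
      case False
      then have "t2_inv k xs gs ?x (Suc i) mk s2" using inv2 unfolding t2_inv_def by (auto simp: less_Suc_eq)
      then show ?thesis using False by auto
    next
      case True
      have "base s2 = base s" by (rule base_cong) (auto simp: base_arrays_def fr f2)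
      then have "base s2" using s(1) by simp
      moreover have "s2 aT 0 = i" "s2 aX0 0 = ?x" using f2[of aT] f2[of aX0] fr[of aX0] 3(3) by simp_all
      ultimately show ?thesis using t2_step[OF inv2] True 3(1) by simp
    qed
    moreover have "t2_inv k xs gs ?x (Suc i) mk (setc aT 0 (Suc i) s'') = t2_inv k xs gs ?x (Suc i) mk s''" for mk s''
      by (rule t2_inv_cong) auto
    ultimately show ?case unfolding run by simp
  qed
qed

text \<open>Emitted constraints correspond to rows, and rows to distinct leading positions among the
  tuples that contain \<open>x0\<close>.\<close>

lemma t2_length:
  assumes "t2_inv k xs gs x0 i mk s"
  shows "length mk \<le> m * card X ^ (m - 1)"
proof -
  have "{p. p < N \<and> has s p} \<subseteq> Crd x0" using assms by (auto simp: t2_inv_def basis_def)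
  moreover have "finite (Crd x0)" by (rule finite_subset[of _ "{..<b ^ m}"]) (auto simp: Crd_def)
  ultimately have "card {p. p < N \<and> has s p} \<le> card (Crd x0)" by (intro card_mono)
  also have "\<dots> \<le> m * card X ^ (m - 1)"
    unfolding Crd_def by (rule card_codes_with) (use finX b in auto)
  finally show ?thesis using assms by (simp add: t2_inv_def)
qed

text \<open>The colouring \<open>c\<close> and the colours \<open>a1\<close>, \<open>a2\<close>
  define a functional \<open>l\<close>, the indicator of violation. By
  \<open>odd_pviol_boxes\<close>, its value at \<open>rel x0 t\<close> tells whether
  \<open>t\<close> itself is violated. If no selected tuple is violated, \<open>l\<close> vanishes
  on all rows, hence on the relation of every candidate.\<close>

lemma t2_implied:
  assumes inv: "t2_inv k xs gs x0 N mk s" and x0: "x0 \<in> X"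
    and c: "\<And>x. x \<in> X \<Longrightarrow> c x < q" and a: "a1 < q" "a2 < q" "a1 \<noteq> a2"
    and mk: "\<forall>t\<in>set mk. \<not> (pviol q c a1 (digs b m t) \<or> pviol q c a2 (digs b m t))"
    and t: "C2 t"
  shows "\<not> (pviol q c a1 (digs b m t) \<or> pviol q c a2 (digs b m t))"
proof -
  let ?P = "\<lambda>w. pviol q c a1 w \<or> pviol q c a2 w"
  define l where "l = (\<lambda>t. of_bool (?P (digs b m t)) :: nat)"
  have ev: "ev N l (rel x0 t) \<longleftrightarrow> \<not> ?P (digs b m t)" if "C2 t" for t
  proof -
    let ?W = "tl (boxes (q - 1) x0 (digs b m t))"
    have sub: "set (digs b m t) \<subseteq> X" using that by (simp add: C2_def)
    have "length w = m \<and> set w \<subseteq> {..<b}" if "w \<in> set ?W" for w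
    proof -
      have w: "w \<in> set (boxes (q - 1) x0 (digs b m t))" using that by (subst boxes_eq_Cons) simp
      have "X \<subseteq> {..<b}" using Xn b by auto
      then show ?thesis using length_boxes[OF w] set_boxes[OF w] sub x0 by auto
    qed
    then have "ev N l (rel x0 t) \<longleftrightarrow> even (length (filter ?P ?W))"
      unfolding l_def rel_def by (intro ev_phi[OF b(1) N(1)])
    moreover have "odd (length (filter ?P ?W)) \<longleftrightarrow> ?P (digs b m t)"
      by (rule odd_pviol_boxes) (use q sub x0 c a in auto)
    ultimately show ?thesis by blast
  qed
  have "\<forall>t\<in>set mk. ev N l (rel x0 t)" using inv mk ev by (auto simp: t2_inv_def)
  then have "spans s l" using inv by (simp add: t2_inv_def)
  moreover have "t < N" using t N(1) by (auto simp: C2_def)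
  ultimately have "ev N l (rel x0 t)" using inv t by (simp add: t2_inv_def)
  then show ?thesis using ev[OF t] by simp
qed

end

section \<open>Writing the output\<close>

abbreviation (input) "aRest \<equiv> 49 :: nat"

definition put :: "exp \<Rightarrow> prog" where
  "put e = PSeq (PAsg 1 (Var 0) e) (PAsg 0 (Const 0) (Inc (Var 0)))"

definition ost :: "bool list \<Rightarrow> memory \<Rightarrow> bool" where
  "ost ys s \<longleftrightarrow> s 0 0 = length ys \<and> (\<forall>i<length ys. s 1 i = of_bool (ys ! i))"

lemma writes_put [simp]: "writes (put e) = {0, 1}"
  by (auto simp: put_def)

lemma wf_put [simp]: "wf_prog aN (put e)"
  by (simp add: put_def)

lemma run_put: "ost ys s \<Longrightarrow> eval_exp e s = of_bool b \<Longrightarrow> ost (ys @ [b]) (run N (put e) s)"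
  by (auto simp: ost_def put_def nth_append less_Suc_eq)

definition nat_prog :: prog where
  "nat_prog = PSeq (PFor aB (PIf (Var aRest)
     (seqs [put (Const 1), put (Cell aOdd (Var aRest)), PAsg aRest (Const 0) (Cell aHalf (Var aRest))]) PSkip))
     (put (Const 0))"

lemma writes_nat_prog [simp]: "writes nat_prog = {0, 1, aB, aRest}"
  by (auto simp: nat_prog_def)

text \<open>Halving decreases a nonzero rest by at least 1, so \<open>N\<close> iterations reach 0;
  the digits written and the code of the rest always form the code of the number.\<close>

lemma run_nat_prog:
  assumes o: "ost ys s" and t: "tables N b s" and r: "s aRest 0 \<le> N"
  shows "ost (ys @ nat_code (s aRest 0)) (run N nat_prog s)"
proof -
  let ?r = "s aRest 0" and ?c = "\<lambda>bs. concat (map (\<lambda>b. [True, b]) bs)"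
  let ?I = "\<lambda>i s'. \<exists>Z. ost (ys @ Z) s' \<and> Z @ ?c (bits (s' aRest 0)) = ?c (bits ?r) \<and>
     (s' aRest 0 = 0 \<or> s' aRest 0 + i \<le> ?r)"
  define body where "body = PIf (Var aRest)
     (seqs [put (Const 1), put (Cell aOdd (Var aRest)), PAsg aRest (Const 0) (Cell aHalf (Var aRest))]) PSkip"
  define s1 where "s1 = run N (PFor aB body) s"
  have wb: "writes body = {0, 1, aRest}" by (auto simp: body_def)
  have I_cong: "?I i (setc aB 0 j s') = ?I i s'" for i j s' by (simp add: ost_def)
  have "?I N s1"
    unfolding s1_def
  proof (rule for_rule[where I = ?I], goal_cases)
    case 1
    then show ?case by (simp add: wb)
  next
    case 2
    then show ?case unfolding I_cong using o by simp
  next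
    case (3 i s')
    have tb: "tables N b s'"
      using t 3(4)[of aOdd] 3(4)[of aHalf] 3(4)[of aMul] 3(4)[of aMod] 3(4)[of aDiv] by (simp add: tables_def wb)
    obtain Z where Z: "ost (ys @ Z) s'" "Z @ ?c (bits (s' aRest 0)) = ?c (bits ?r)"
      "s' aRest 0 = 0 \<or> s' aRest 0 + i \<le> ?r" using 3(2) by blast
    show ?case
      unfolding I_cong
    proof (cases "s' aRest 0 = 0")
      case True
      then show "?I (Suc i) (run N body s')" using Z by (auto simp: body_def)
    next
      case False
      let ?r' = "s' aRest 0"
      have r': "?r' \<le> N" using False Z(3) r by linarith
      define s2 where "s2 = run N (put (Const 1)) s'"
      define s3 where "s3 = run N (put (Cell aOdd (Var aRest))) s2"
      have f: "s2 a = s' a" "s3 a = s' a" if "a \<notin> {0, 1}" for a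
        using that by (simp_all add: s3_def s2_def run_frame)
      have run: "run N body s' = setc aRest 0 (?r' div 2) s3"
      proof -
        have "run N body s' = setc aRest 0 (s3 aHalf (s3 aRest 0)) s3"
          using False by (simp add: body_def s2_def s3_def)
        moreover have "s3 aRest = s' aRest" "s3 aHalf = s' aHalf" using f by simp_all
        ultimately show ?thesis using r' tb by (simp add: tables_def)
      qed
      have "ost ((ys @ Z) @ [True]) s2" unfolding s2_def by (rule run_put) (use Z in auto)
      then have "ost (((ys @ Z) @ [True]) @ [odd ?r']) s3"
        unfolding s3_def by (rule run_put) (use f r' tb in \<open>auto simp: tables_def odd_iff_mod_2_eq_one\<close>)
      then have "ost (ys @ (Z @ [True, odd ?r'])) (run N body s')" unfolding run by (simp add: ost_def)
      moreover have "bits ?r' = odd ?r' # bits (?r' div 2)" using False by (subst bits.simps) simp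
      then have "(Z @ [True, odd ?r']) @ ?c (bits (?r' div 2)) = ?c (bits ?r)" using Z(2) by simp
      moreover have "?r' div 2 = 0 \<or> ?r' div 2 + Suc i \<le> ?r" using False Z(3) by linarith
      ultimately show "?I (Suc i) (run N body s')"
        by (intro exI[of _ "Z @ [True, odd ?r']"]) (simp add: run)
    qed
  qed
  then obtain Z where Z: "ost (ys @ Z) s1" "Z @ ?c (bits (s1 aRest 0)) = ?c (bits ?r)"
    "s1 aRest 0 = 0 \<or> s1 aRest 0 + N \<le> ?r" by blast
  have "s1 aRest 0 = 0" using Z(3) r by linarith
  then have "Z = ?c (bits ?r)" using Z(2) by (simp add: bits.simps[of 0])
  then have "ost ((ys @ ?c (bits ?r)) @ [False]) (run N (put (Const 0)) s1)"
    using Z(1) by (intro run_put) auto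
  then show ?thesis by (simp add: nat_prog_def nat_code_def s1_def body_def)
qed

text \<open>The output overwrites the input in arrays 0 and 1, whose content lives in other arrays
  by now. The new modulator consists of the first \<open>aK\<close> vertices, so its characteristic
  vector is a comparison with \<open>aK\<close>.\<close>

definition enc_prog :: prog where
  "enc_prog = seqs [PAsg 0 (Const 0) (Const 0), PAsg 0 (Const 1) (Var aK),
     PFor aA (PIf (LessE (Var aA) (Var aNV)) (put (Const 1)) PSkip),
     put (Const 0),
     PFor aA (PIf (LessE (Var aA) (Var aNV)) (put (LessE (Var aA) (Var aK))) PSkip),
     PFor aA (PIf (LessE (Var aA) (Var aOC)) (PSeq (PAsg aRest (Const 0) (Cell aOW (Var aA))) nat_prog) PSkip)]"

lemma run_put_loop:
  assumes o: "ost ys s" and n: "s aNV 0 \<le> N"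
    and e: "\<And>s' i. i < s aNV 0 \<Longrightarrow> s' aA 0 = i \<Longrightarrow> (\<And>a. a \<notin> {0, 1, aA} \<Longrightarrow> s' a = s a) \<Longrightarrow>
      eval_exp e s' = of_bool (f i)"
  shows "ost (ys @ map f [0..<s aNV 0]) (run N (PFor aA (PIf (LessE (Var aA) (Var aNV)) (put e) PSkip)) s)"
proof -
  have "ost (ys @ map f [0..<min N (s aNV 0)]) (run N (PFor aA (PIf (LessE (Var aA) (Var aNV)) (put e) PSkip)) s)"
  proof (rule for_rule[where I = "\<lambda>i s'. ost (ys @ map f [0..<min i (s aNV 0)]) s'"], goal_cases)
    case 2
    then show ?case using o by (simp add: ost_def)
  next
    case (3 i s')
    have nv: "s' aNV = s aNV" using 3(4)[of aNV] by simp
    have upd: "ost z (setc aA 0 j t) = ost z t" for z j t by (simp add: ost_def)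
    show ?case
    proof (cases "i < s aNV 0")
      case True
      have "eval_exp e s' = of_bool (f i)" using True 3(3) by (rule e[of i s']) (use 3(4) in simp)
      then have "ost ((ys @ map f [0..<min i (s aNV 0)]) @ [f i]) (run N (put e) s')"
        using 3(2) by (intro run_put) auto
      then show ?thesis unfolding upd using True nv 3(3) by (simp add: min_def)
    next
      case False
      then show ?thesis unfolding upd using 3(2,3) nv by (simp add: min_absorb2 not_less)
    qed
  qed auto
  then show ?thesis using n by (simp add: min_absorb2)
qed

lemma run_enc:
  assumes t: "tables N b s" and o: "olist (flat es) s" and n: "s aNV 0 = n" "n \<le> N" and k: "s aK 0 = k"
    and es: "2 * length es \<le> N" "\<And>y. y \<in> set (flat es) \<Longrightarrow> y \<le> N"
  shows "output_string (run N enc_prog s) = instance_code n {..<k} es"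
    and "output_param (run N enc_prog s) = k"
proof -
  define s1 where "s1 = setc 0 1 k (setc 0 0 0 s)"
  define s2 where "s2 = run N (PFor aA (PIf (LessE (Var aA) (Var aNV)) (put (Const 1)) PSkip)) s1"
  define s3 where "s3 = run N (put (Const 0)) s2"
  define s4 where "s4 = run N (PFor aA (PIf (LessE (Var aA) (Var aNV)) (put (LessE (Var aA) (Var aK))) PSkip)) s3"
  define body where "body = PIf (LessE (Var aA) (Var aOC)) (PSeq (PAsg aRest (Const 0) (Cell aOW (Var aA))) nat_prog) PSkip"
  define s5 where "s5 = run N (PFor aA body) s4"
  have wb: "writes body = {0, 1, aB, aRest}" by (auto simp: body_def)
  have run: "run N enc_prog s = s5"
    using k by (simp add: enc_prog_def s1_def s2_def s3_def s4_def s5_def body_def)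
  have f1: "s1 a = s a" if "a \<noteq> 0" for a using that by (simp add: s1_def)
  have f2: "s2 a = s1 a" if "a \<notin> {0, 1, aA}" for a unfolding s2_def using that by (intro run_frame) simp
  have f3: "s3 a = s2 a" if "a \<notin> {0, 1}" for a unfolding s3_def using that by (intro run_frame) simp
  have f4: "s4 a = s3 a" if "a \<notin> {0, 1, aA}" for a unfolding s4_def using that by (intro run_frame) simp
  have f14: "s4 a = s a" if "a \<notin> {0, 1, aA}" for a using that f1 f2 f3 f4 by simp
  have nv: "s1 aNV 0 = n" "s3 aNV 0 = n" "s3 aK 0 = k" using n k f1 f2 f3 by auto
  have "ost ([] @ map (\<lambda>_. True) [0..<s1 aNV 0]) s2"
    unfolding s2_def by (rule run_put_loop) (use nv n in \<open>auto simp: ost_def s1_def\<close>)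
  then have "ost (replicate n True) s2" using nv by (simp add: map_replicate_const)
  then have "ost (replicate n True @ [False]) s3" unfolding s3_def by (intro run_put) auto
  then have "ost ((replicate n True @ [False]) @ map (\<lambda>v. v \<in> {..<k}) [0..<s3 aNV 0]) s4"
    unfolding s4_def by (rule run_put_loop) (use nv n in auto)
  then have o4: "ost (replicate n True @ [False] @ map (\<lambda>v. v \<in> {..<k}) [0..<n]) s4" using nv by simp
  let ?h = "replicate n True @ [False] @ map (\<lambda>v. v \<in> {..<k}) [0..<n]"
  let ?w = "flat es"
  have "ost (?h @ concat (map nat_code (take N ?w))) s5"
    unfolding s5_def
  proof (rule for_rule[where I = "\<lambda>i s'. ost (?h @ concat (map nat_code (take i ?w))) s'"], goal_cases)
    case 1
    then show ?case by (simp add: wb)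
  next
    case 2
    then show ?case using o4 by (simp add: ost_def)
  next
    case (3 i s')
    have upd: "ost z (setc aA 0 j t) = ost z t" for z j t by (simp add: ost_def)
    have fr: "s' a = s a" if "a \<notin> {0, 1, aA, aB, aRest}" for a
      using 3(4)[of a] f14[of a] that wb by simp
    have oc: "s' aOC 0 = length ?w" "\<And>i. i < length ?w \<Longrightarrow> s' aOW i = ?w ! i"
      using o fr[of aOC] fr[of aOW] by (simp_all add: olist_def)
    show ?case
    proof (cases "i < length ?w")
      case True
      define s'' where "s'' = setc aRest 0 (?w ! i) s'"
      have "tables N b s''"
        using t fr[of aOdd] fr[of aHalf] fr[of aMul] fr[of aMod] fr[of aDiv] by (simp add: tables_def s''_def)
      moreover have "ost (?h @ concat (map nat_code (take i ?w))) s''" using 3(2) by (simp add: ost_def s''_def)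
      moreover have "s'' aRest 0 = ?w ! i" by (simp add: s''_def)
      ultimately have "ost ((?h @ concat (map nat_code (take i ?w))) @ nat_code (?w ! i)) (run N nat_prog s'')"
        using run_nat_prog[of "?h @ concat (map nat_code (take i ?w))" s'' N b] es(2) True by simp
      moreover have "run N body s' = run N nat_prog s''"
        using True oc 3(3) by (simp add: body_def s''_def)
      ultimately show ?thesis unfolding upd using True by (simp add: take_Suc_conv_app_nth)
    next
      case False
      then show ?thesis unfolding upd using 3(2,3) oc by (simp add: body_def)
    qed
  qed
  then have o5: "ost (instance_code n {..<k} es) s5"
    using es(1) by (simp add: instance_code_flat)
  then show "output_string (run N enc_prog s) = instance_code n {..<k} es"
    unfolding run output_string_def ost_def
    by (intro nth_equalityI) (auto simp: of_bool_def split: if_splits)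
  have p1: "s1 0 1 = k" by (simp add: s1_def)
  \<comment> \<open>\<open>run_frame\<close> treats arrays as a whole, and array 0 changes in its
    length cell; that its cell 1, the parameter, survives has to be followed separately.\<close>
  have param_put: "run N (put e) t 0 1 = t 0 1" for e t by (simp add: put_def)
  note param_put' = param_put[unfolded One_nat_def]
  have param_loop: "run N (PFor v p) t 0 1 = t 0 1"
    if "v \<notin> writes p" "v \<noteq> 0" "\<And>t. run N p t 0 1 = t 0 1" for v p t
    by (rule for_rule[where I = "\<lambda>i t'. t' 0 1 = t 0 1"]) (use that in auto)
  have param_nat: "run N nat_prog t 0 1 = t 0 1" for t
    unfolding nat_prog_def run.simps(3) param_put by (rule param_loop) (auto simp: param_put')
  have "s2 0 1 = s1 0 1" unfolding s2_def by (rule param_loop) (auto simp: param_put')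
  moreover have "s4 0 1 = s3 0 1" unfolding s4_def by (rule param_loop) (auto simp: param_put')
  moreover have "s5 0 1 = s4 0 1"
    unfolding s5_def by (rule param_loop) (use wb in \<open>auto simp: body_def param_nat[unfolded One_nat_def]\<close>)
  ultimately show "output_param (run N enc_prog s) = k"
    unfolding run output_param_def using p1 by (simp add: s3_def param_put')
qed

text \<open>The complete graph on \<open>q + 1\<close> vertices is the output for strings that encode no instance.\<close>

definition kedges :: "nat \<Rightarrow> (nat \<times> nat) list" where
  "kedges n = filter (\<lambda>(u, v). u \<noteq> v) (List.product [0..<n] [0..<n])"

lemma set_kedges: "set (kedges n) = {(u, v). u < n \<and> v < n \<and> u \<noteq> v}"
  by (auto simp: kedges_def)

lemma length_kedges: "length (kedges n) \<le> n * n"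
  unfolding kedges_def by (rule order_trans[OF length_filter_le]) simp

lemma kedges_not_colorable: "\<not> colorable q {..<Suc q} (edges_of (kedges (Suc q)))"
proof
  assume "colorable q {..<Suc q} (edges_of (kedges (Suc q)))"
  then obtain c where "proper_coloring q {..<Suc q} (edges_of (kedges (Suc q))) c"
    unfolding colorable_def by blast
  then have c: "\<And>v. v < Suc q \<Longrightarrow> c v < q" "\<And>u v. u < Suc q \<Longrightarrow> v < Suc q \<Longrightarrow> u \<noteq> v \<Longrightarrow> c u \<noteq> c v"
    unfolding proper_edges_of set_kedges by auto
  have "card {..<Suc q} \<le> card {..<q}"
    by (rule card_inj_on_le[of c]) (use c in \<open>auto simp: inj_on_def\<close>)
  then show False by simp
qed

lemma kedges_instance: "is_instance (instance_code n {..<n} (kedges n)) n n (edges_of (kedges n)) {..<n}"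
proof -
  have "simple_graph {..<n} (edges_of (kedges n))"
    unfolding simple_graph_edges_of by (auto simp: set_kedges good_pair_def)
  then show ?thesis
    by (auto simp: is_instance_def encodes_def edges_of_def deg1_modulator_def)
qed

section \<open>The kernel\<close>

lemma length_gedges:
  "(\<And>g. g \<in> set gs \<Longrightarrow> length (fst g) + length (snd g) \<le> w) \<Longrightarrow>
    length (gedges R k gs) \<le> length gs * Suc w"
proof (induction gs rule: rev_induct)
  case (snoc g gs)
  have "length (gedges R k gs) \<le> length gs * Suc w" using snoc.prems by (intro snoc.IH) auto
  moreover have "length (fst g) + length (snd g) \<le> w" using snoc.prems[of g] by simp
  ultimately show ?case by (simp add: gedges_snoc)
qed simp

text \<open>Outside the locale these programs still take \<open>q\<close> as their only argument:
  one program works for all graphs and all loop bounds.\<close>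

definition select_prog :: "nat \<Rightarrow> prog" where
  "select_prog q = seqs [PAsg aNV (Const 0) (Var aK), xedges_prog, setting.t1_prog q, setting.t2_prog q]"

context setting
begin

lemma writes_xedges: "writes xedges_prog \<subseteq> {aA, aB, aOW, aOC}"
  using writes_pushes[of "[Cell aR (Var aA), Cell aR (Var aB)]"] by (auto simp: xedges_prog_def)

lemma writes_t1: "writes t1_prog \<subseteq> {aT, aFound, aA, aOW, aOC, aNV}"
  using writes_gadget[of "digsE q (Var aT)" "[]"] by (auto simp: t1_prog_def)

lemma writes_t2: "writes t2_prog \<subseteq> {aT, aFound, aA, aB, aVec, aFin, aHas, aRow, aOW, aOC, aNV}"
  using writes_gadget[of "take (q - 1) (digsE m (Var aT))" "drop (q - 1) (digsE m (Var aT))"]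
  by (auto simp: t2_prog_def vec_prog_def elim_prog_def elim_body_def G2_def Let_def)

lemma wf_select: "wf_prog aN (select_prog q)"
proof -
  have "wf_prog aN xedges_prog"
    using writes_pushes[of "[Cell aR (Var aA), Cell aR (Var aB)]"] by (auto simp: xedges_prog_def)
  moreover have "wf_prog aN t1_prog"
    using writes_gadget[of "digsE q (Var aT)" "[]"] by (auto simp: t1_prog_def)
  moreover have "wf_prog aN t2_prog"
    using writes_gadget[of "take (q - 1) (digsE m (Var aT))" "drop (q - 1) (digsE m (Var aT))"]
    by (auto simp: t2_prog_def vec_prog_def elim_prog_def elim_body_def G2_def Let_def)
  ultimately show ?thesis by (simp add: select_prog_def)
qed

text \<open>Vertices of \<open>X\<close> are below \<open>b\<close>, so every list over
  \<open>X\<close> has a code below \<open>b ^ j\<close>, and the loop over codes meets every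
  candidate.\<close>

lemma digs_image:
  assumes "\<And>t. C t \<longleftrightarrow> t < b ^ j \<and> P (digs b j t)" "b ^ j \<le> N" "\<And>s. P s \<Longrightarrow> set s \<subseteq> X"
  shows "set (map (digs b j) (filter C [0..<N])) = {s. length s = j \<and> P s}"
proof (intro equalityI subsetI)
  fix s assume "s \<in> {s. length s = j \<and> P s}"
  then have s: "length s = j" "P s" "set s \<subseteq> X" using assms(3) by auto
  then have "set s \<subseteq> {..<b}" using Xn b by force
  then obtain t where t: "t < b ^ j" "digs b j t = s" using digs_surj[OF b(1), of s] s(1) by blast
  then have "C t" using s(2) assms(1)[of t] by simp
  moreover have "t < N" using t(1) assms(2) by (rule less_le_trans)
  ultimately show "s \<in> set (map (digs b j) (filter C [0..<N]))" using t(2) by force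
next
  fix s assume "s \<in> set (map (digs b j) (filter C [0..<N]))"
  then obtain t where "s = digs b j t" "C t" by auto
  then show "s \<in> {s. length s = j \<and> P s}" using assms(1)[of t] by simp
qed

lemma run_select:
  assumes s: "base s" "olist [] s" "\<And>i. s aHas i = 0"
    and graph: "simple_graph {..<n} E" "deg1_modulator {..<n} E X"
  defines "k \<equiv> card X" and "s' \<equiv> run N (select_prog q) s"
  shows "\<exists>es n'. olist (flat es) s' \<and> s' aNV 0 = n' \<and> s' aK 0 = k \<and> tables N b s' \<and> k \<le> n' \<and>
    simple_graph {..<n'} (edges_of es) \<and> deg1_modulator {..<n'} (edges_of es) {..<k} \<and>
    (colorable q {..<n'} (edges_of es) \<longleftrightarrow> colorable q {..<n} E) \<and>
    n' \<le> k + 2 * (k ^ q + m * k ^ (m - 1)) \<and>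
    length es \<le> k * k + (k ^ q + m * k ^ (m - 1)) * Suc m"
proof -
  define s4 where "s4 = setc aNV 0 (s aK 0) s"
  define s5 where "s5 = run N xedges_prog s4"
  define s6 where "s6 = run N t1_prog s5"
  define s7 where "s7 = run N t2_prog s6"
  have s': "s' = s7" by (simp add: s'_def select_prog_def s4_def s5_def s6_def s7_def)
  have f4: "s4 a = s a" if "a \<noteq> aNV" for a using that by (simp add: s4_def)
  have f5: "s5 a = s4 a" if "a \<notin> {aA, aB, aOW, aOC}" for a
    unfolding s5_def using writes_xedges that by (intro run_frame) blast
  have f6: "s6 a = s5 a" if "a \<notin> {aT, aFound, aA, aOW, aOC, aNV}" for a
    unfolding s6_def using writes_t1 that by (intro run_frame) blast
  have f7: "s7 a = s6 a" if "a \<notin> {aT, aFound, aA, aB, aVec, aFin, aHas, aRow, aOW, aOC, aNV}" for a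
    unfolding s7_def using writes_t2 that by (intro run_frame) blast
  define R where "R = s aR"
  have R: "s4 aR = R" "s5 aR = R" "s6 aR = R" "s7 aR = R" using f4 f5 f6 f7 by (simp_all add: R_def)
  have "base s4 = base s" by (rule base_cong) (auto simp: base_arrays_def f4)
  moreover have "base s5 = base s4" by (rule base_cong) (auto simp: base_arrays_def f5)
  moreover have "base s6 = base s5" by (rule base_cong) (auto simp: base_arrays_def f6)
  moreover have "base s7 = base s6" by (rule base_cong) (auto simp: base_arrays_def f7)
  ultimately have base: "base s4" "base s5" "base s6" "base s7" using s(1) by simp_all
  have kK: "s aK 0 = k" "bij_betw R X {..<k}" "X \<noteq> {} \<Longrightarrow> s aX0 0 \<in> X"
    using s(1) by (auto simp: base_def graph_mem_def k_def R_def)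
  have "olist (flat (xes R)) s5"
    using run_xedges[OF base(1)] s(2) R unfolding s5_def by (simp add: olist_def s4_def)
  then have "gst k (xes R) [] s5" using f5[of aNV] kK by (simp add: gst_def s4_def)
  then have g6: "gst k (xes R) (map (\<lambda>t. (digs b q t, [])) (filter C1 [0..<N])) s6"
    unfolding s6_def by (rule run_t1[OF base(2)])
  have has: "s6 aHas i = 0" for i using f6[of aHas] f5[of aHas] f4[of aHas] s(3) by simp
  have X0: "s6 aX0 0 = s aX0 0" using f6[of aX0] f5[of aX0] f4[of aX0] by simp
  obtain mk where inv: "t2_inv k (xes R) (map (\<lambda>t. (digs b q t, [])) (filter C1 [0..<N])) (s aX0 0) N mk s7"
    using run_t2[OF base(3) g6 has] unfolding s7_def X0 by blast
  define sel1 where "sel1 = map (digs b q) (filter C1 [0..<N])"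
  define sel2 where "sel2 = map (digs b m) mk"
  define cand2 where "cand2 = map (digs b m) (filter C2 [0..<N])"
  interpret red: reduction q n E X k R "xes R" sel1 sel2 cand2
  proof
    show "3 \<le> q" "simple_graph {..<n} E" "deg1_modulator {..<n} E X" "bij_betw R X {..<k}"
      using q graph kK by simp_all
    show "set (xes R) = {(R u, R v) |u v. u \<in> X \<and> v \<in> X \<and> {u, v} \<in> E}" by (rule set_xes)
    show "set sel1 = {s. length s = q \<and> set s \<subseteq> X \<and> (\<exists>v<n. v \<notin> X \<and> (\<forall>y\<in>set s. {v, y} \<in> E))}"
      unfolding sel1_def by (rule digs_image) (use bN in \<open>auto simp: C1_def\<close>)
    show "set cand2 = {s. length s = 2 * (q - 1) \<and> set s \<subseteq> X \<and>
      (\<exists>u<n. \<exists>v<n. u \<notin> X \<and> v \<notin> X \<and> {u, v} \<in> E \<and>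
        (\<forall>y\<in>set (take (q - 1) s). {u, y} \<in> E) \<and> (\<forall>y\<in>set (drop (q - 1) s). {v, y} \<in> E))}"
      unfolding cand2_def by (rule digs_image) (use N in \<open>auto simp: C2_def\<close>)
    show "set sel2 \<subseteq> set cand2" using inv by (auto simp: sel2_def cand2_def t2_inv_def)
    fix c a1 a2
    assume c: "\<And>x. x \<in> X \<Longrightarrow> c x < q" and a: "a1 < q" "a2 < q" "a1 \<noteq> a2"
      and sel: "\<forall>s\<in>set sel2. \<not> (pviol q c a1 s \<or> pviol q c a2 s)"
    show "\<forall>s\<in>set cand2. \<not> (pviol q c a1 s \<or> pviol q c a2 s)"
    proof
      fix w assume "w \<in> set cand2"
      then obtain t where t: "C2 t" "w = digs b m t" by (auto simp: cand2_def)
      have "set (digs b m t) \<noteq> {}" using q by (cases m) (auto simp: digs_Suc)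
      then have "X \<noteq> {}" using t(1) by (auto simp: C2_def)
      then have "s aX0 0 \<in> X" by (rule kK(3))
      moreover have "\<forall>t\<in>set mk. \<not> (pviol q c a1 (digs b m t) \<or> pviol q c a2 (digs b m t))"
        using sel by (simp add: sel2_def)
      ultimately show "\<not> (pviol q c a1 w \<or> pviol q c a2 w)"
        unfolding t(2) using t2_implied[where c = c, OF inv _ c a _ t(1)] by blast
    qed
  qed
  have gs: "map (\<lambda>t. (digs b q t, [])) (filter C1 [0..<N]) @
      map (\<lambda>t. (take (q - 1) (digs b m t), drop (q - 1) (digs b m t))) mk = red.gadgets"
    unfolding red.gadgets_def unfolding sel1_def sel2_def map_map comp_def ..
  have g7: "gst k (xes R) red.gadgets s7" using inv unfolding t2_inv_def gs by blast
  have len1: "length (filter C1 [0..<N]) \<le> k ^ q"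
  proof -
    have "length (filter C1 [0..<N]) = card (set (filter C1 [0..<N]))"
      by (rule distinct_card[symmetric]) simp
    also have "\<dots> \<le> card {t. t < b ^ q \<and> set (digs b q t) \<subseteq> X}"
      by (rule card_mono) (auto simp: C1_def)
    also have "\<dots> \<le> k ^ q" unfolding k_def by (rule card_codes) (use finX b in auto)
    finally show ?thesis .
  qed
  have len2: "length mk \<le> m * k ^ (m - 1)" using t2_length[OF inv] by (simp add: k_def)
  have lg: "length red.gadgets \<le> k ^ q + m * k ^ (m - 1)"
    unfolding gs[symmetric] using len1 len2 by simp
  have "length (fst g) + length (snd g) \<le> m" if "g \<in> set red.gadgets" for g
    using that q unfolding gs[symmetric] by auto
  then have "length (gedges R k red.gadgets) \<le> length red.gadgets * Suc m" by (rule length_gedges)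
  also have "\<dots> \<le> (k ^ q + m * k ^ (m - 1)) * Suc m" using lg by (rule mult_right_mono) simp
  finally have "length (gedges R k red.gadgets) \<le> (k ^ q + m * k ^ (m - 1)) * Suc m" .
  then have le: "length red.out_edges \<le> k * k + (k ^ q + m * k ^ (m - 1)) * Suc m"
    unfolding red.out_edges_def length_append by (rule add_mono[OF length_xes[folded k_def]])
  have "olist (flat red.out_edges) s7" "s7 aNV 0 = k + 2 * length red.gadgets"
    unfolding red.out_edges_def using g7 R by (simp_all add: gst_def)
  moreover have "s7 aK 0 = k" using base(4) by (simp add: base_def graph_mem_def k_def)
  moreover have "tables N b s7" using base(4) by (simp add: base_def)
  moreover have "colorable q {..<k + 2 * length red.gadgets} (edges_of red.out_edges) \<longleftrightarrow> colorable q {..<n} E"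
    using red.colorable_out_imp red.colorable_imp_out by blast
  ultimately show ?thesis
    unfolding s' using red.out_graph red.out_modulator lg le
    by (intro exI[of _ red.out_edges] exI[of _ "k + 2 * length red.gadgets"]) simp
qed

end

definition main_prog :: "nat \<Rightarrow> prog" where
  "main_prog q = seqs [tables_prog, parse_prog, check_prog,
     PIf (Var aOk) (select_prog q)
       (seqs [pushes (map Const (flat (kedges (Suc q)))), PAsg aNV (Const 0) (Const (Suc q)),
          PAsg aK (Const 0) (Const (Suc q))]),
     enc_prog]"

lemma writes_tables: "writes tables_prog = {aI, aOdd, aHalf, aMul, aMod, aDiv}"
  by (auto simp: tables_prog_def)

lemma writes_pstep: "writes pstep = {aMode, aVtx, aXI, aXF, aVal, aPow, aCanon, aDig, aW, aCnt, aBad}"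
  by (auto simp: pstep_def)

lemma writes_parse: "writes parse_prog = {aMode, aVtx, aXI, aXF, aVal, aPow, aCanon, aDig, aW, aCnt, aBad, aPos}"
  by (auto simp: parse_prog_def writes_pstep)

lemma writes_check: "writes check_prog = {aOk, aAdj, aA, aB, aC, aK, aR, aX0}"
  by (auto simp: check_prog_def edge_prog_def rank_prog_def Let_def)

lemma wf_main:
  assumes "q \<ge> 3"
  shows "wf_prog aN (main_prog q)"
proof -
  \<comment> \<open>\<open>wf_select\<close> was shown in the locale but concerns \<open>q\<close>
    alone; the empty graph with base 1 supplies an instance.\<close>
  interpret setting q "(q * q) ^ (2 * (q - 1))" 1 0 "{}" "{}"
  proof
    have "(q * q) ^ 1 \<le> (q * q) ^ (2 * (q - 1))" using assms by (intro power_increasing) auto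
    then show "q * q \<le> (q * q) ^ (2 * (q - 1))" by simp
  qed (use assms in auto)
  have "wf_prog aN tables_prog" by (simp add: tables_prog_def)
  moreover have "wf_prog aN parse_prog" by (simp add: parse_prog_def writes_pstep) (simp add: pstep_def)
  moreover have "wf_prog aN check_prog" by (simp add: check_prog_def edge_prog_def rank_prog_def Let_def)
  moreover have "wf_prog aN enc_prog" by (simp add: enc_prog_def) (simp add: nat_prog_def)
  ultimately show ?thesis using wf_select by (simp add: main_prog_def)
qed

text \<open>By \<open>q\<close> \<ge> 3, the exponents 1, 2, \<open>q\<close> and
  \<open>m - 1\<close> are at most \<open>2q - 3\<close>; \<open>k + 1\<close> in place of
  \<open>k\<close> makes the powers increasing even for \<open>k = 0\<close>. The factors are
  \<open>1 + 2 * (1 + m) = 4q - 1\<close> for the vertices and \<open>1 + (1 + m)^2\<close> for the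
  edges, the latter at most \<open>4q^2\<close>.\<close>

lemma size_bounds:
  fixes k q :: nat
  assumes "q \<ge> 3"
  defines "M \<equiv> (k + 1) ^ (2 * q - 3)" and "m \<equiv> 2 * (q - 1)"
  shows "k + 2 * (k ^ q + m * k ^ (m - 1)) \<le> 4 * q * M"
    and "k * k + (k ^ q + m * k ^ (m - 1)) * Suc m \<le> 4 * q * q * M"
proof -
  have pw: "k ^ j \<le> M" if "j \<le> 2 * q - 3" for j
  proof -
    have "k ^ j \<le> (k + 1) ^ j" by (rule power_mono) auto
    also have "\<dots> \<le> M" unfolding M_def using that by (intro power_increasing) auto
    finally show ?thesis .
  qed
  have 1: "k \<le> M" "k * k \<le> M" "k ^ q \<le> M" "k ^ (m - 1) \<le> M"
    using pw[of 1] pw[of 2] pw[of q] pw[of "m - 1"] assms(1) by (auto simp: power2_eq_square m_def)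
  obtain p where p: "q = p + 1" using assms(1) by (metis add.commute le_add_diff_inverse2 le_trans one_le_numeral)
  have g: "k ^ q + m * k ^ (m - 1) \<le> (2 * p + 1) * M"
  proof -
    have "k ^ q + m * k ^ (m - 1) \<le> M + m * M" using add_mono[OF 1(3) mult_le_mono2[OF 1(4)]] .
    also have "\<dots> = (2 * p + 1) * M" by (simp add: m_def p)
    finally show ?thesis .
  qed
  show "k + 2 * (k ^ q + m * k ^ (m - 1)) \<le> 4 * q * M"
    using g 1(1) by (simp add: p algebra_simps)
  have "(k ^ q + m * k ^ (m - 1)) * Suc m \<le> (2 * p + 1) * M * Suc m"
    using g by (rule mult_right_mono) simp
  then show "k * k + (k ^ q + m * k ^ (m - 1)) * Suc m \<le> 4 * q * q * M"
    using 1(2) by (simp add: p m_def algebra_simps)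
qed

lemma run_main:
  fixes q k :: nat and x :: "bool list"
  assumes q: "q \<ge> 3" and b_def: "b = length x + 4 * q" and N_def: "N = (length x + 4 * q) ^ (2 * q - 1)"
    and s: "s 0 0 = length x" "s 0 1 = k" "\<And>i. i < length x \<Longrightarrow> s 1 i = of_bool (x ! i)"
      "s aN 0 = N" "s aBase 0 = b" "\<And>a i. a \<ge> 10 \<Longrightarrow> s a i = 0"
  defines "M \<equiv> (k + 1) ^ (2 * q - 3)"
    and "s' \<equiv> run N (main_prog q) s"
  shows "\<exists>n' es k'. output_string s' = instance_code n' {..<k'} es \<and> output_param s' = k' \<and>
    is_instance (instance_code n' {..<k'} es) k' n' (edges_of es) {..<k'} \<and>
    (colorable q {..<n'} (edges_of es) \<longleftrightarrow> (x, k) \<in> q_Coloring q) \<and>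
    n' \<le> 4 * q * M \<and> length es \<le> 4 * q * q * M \<and> k' \<le> k + Suc q"
proof -
  have b: "b \<ge> 4 * q" "b > 0" "length x \<le> b" using q by (auto simp: b_def)
  have Nb: "N = b ^ (2 * q - 1)" by (simp add: N_def b_def)
  have Nj: "b ^ j \<le> N" if "j \<le> 2 * q - 1" for j
    unfolding Nb using b that by (intro power_increasing) auto
  have bN: "b \<le> N" using Nj[of 1] q by simp
  have qN: "q * q \<le> N"
  proof -
    have "q * q \<le> b * b" using b by (intro mult_le_mono) auto
    also have "\<dots> \<le> N" using Nj[of 2] q by (simp add: power2_eq_square)
    finally show ?thesis .
  qed
  \<comment> \<open>This fixes the exponent \<open>2q - 1\<close> of \<open>N\<close>: the list of
    edge ends has at most \<open>8 * q * q * M\<close> entries, and \<open>8 * q * q\<close> \<le>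
    \<open>b * b\<close> leaves \<open>b ^ (2q - 3)\<close> for \<open>M\<close>.\<close>
  have N8: "8 * q * q * (j + 1) ^ (2 * q - 3) \<le> N" if "j \<le> length x" for j
  proof -
    have "8 * q * q \<le> b * b" using mult_le_mono[OF b(1) b(1)] by simp
    moreover have "(j + 1) ^ (2 * q - 3) \<le> b ^ (2 * q - 3)"
      using that q by (intro power_mono) (auto simp: b_def)
    ultimately have "8 * q * q * (j + 1) ^ (2 * q - 3) \<le> b * b * b ^ (2 * q - 3)" by (rule mult_le_mono)
    also have "\<dots> = b ^ (2 + (2 * q - 3))" by (simp add: power_add power2_eq_square)
    also have "2 + (2 * q - 3) = 2 * q - 1" using q by simp
    finally show ?thesis by (simp add: Nb)
  qed
  define s1 where "s1 = run N tables_prog s"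
  define s2 where "s2 = run N parse_prog s1"
  define s3 where "s3 = run N check_prog s2"
  have f1: "s1 a = s a" if "a \<notin> {aI, aOdd, aHalf, aMul, aMod, aDiv}" for a
    unfolding s1_def using that by (intro run_frame) (simp add: writes_tables)
  have f2: "s2 a = s1 a" if "a \<notin> {aMode, aVtx, aXI, aXF, aVal, aPow, aCanon, aDig, aW, aCnt, aBad, aPos}" for a
    unfolding s2_def using that by (intro run_frame) (simp add: writes_parse)
  have f3: "s3 a = s2 a" if "a \<notin> {aOk, aAdj, aA, aB, aC, aK, aR, aX0}" for a
    unfolding s3_def using that by (intro run_frame) (simp add: writes_check)
  have t1: "tables N b s1" unfolding s1_def by (rule run_tables) (use s b in auto)
  have t2: "tables N b s2" using t1 f2 by (simp add: tables_def)
  have t3: "tables N b s3" using t2 f3 by (simp add: tables_def)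
  have p: "pinv x s2"
    unfolding s2_def by (rule run_parse) (use s f1 b bN in auto)
  have x: "length x \<le> N" using b bN by simp
  have in2: "s2 0 1 = k" "s2 aOk 0 = 0" "\<And>i. s2 aAdj i = 0" "s2 aK 0 = 0"
    using s f1 f2 by simp_all
  note check = run_check[OF p t2 x in2(1,2,3,4), folded s3_def]
  have oc: "s3 aOC 0 = 0" "\<And>i. s3 aHas i = 0" using s f1 f2 f3 by simp_all
  then have ol: "olist [] s3" by (simp add: olist_def)
  define s4 where "s4 = (if s3 aOk 0 \<noteq> 0 then run N (select_prog q) s3 else
     setc aK 0 (Suc q) (setc aNV 0 (Suc q) (run N (pushes (map Const (flat (kedges (Suc q))))) s3)))"
  have s': "s' = run N enc_prog s4"
    by (simp add: s'_def main_prog_def s1_def s2_def s3_def s4_def)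
  have main: "\<exists>es n' k'. olist (flat es) s4 \<and> s4 aNV 0 = n' \<and> s4 aK 0 = k' \<and> tables N b s4 \<and> k' \<le> n' \<and>
    simple_graph {..<n'} (edges_of es) \<and> deg1_modulator {..<n'} (edges_of es) {..<k'} \<and>
    (colorable q {..<n'} (edges_of es) \<longleftrightarrow> (x, k) \<in> q_Coloring q) \<and>
    n' \<le> 4 * q * M \<and> length es \<le> 4 * q * q * M \<and> k' \<le> k + Suc q \<and>
    n' \<le> N \<and> 2 * length es \<le> N"
  proof (cases "s3 aOk 0 = 0")
    case True
    \<comment> \<open>A string that encodes no instance may come with any \<open>k\<close>, so the
      output has constant size; its parameter \<open>q + 1\<close> explains the bound
      \<open>k + Suc q\<close>.\<close>
    define n' where "n' = Suc q"
    have no: "(x, k) \<notin> q_Coloring q" using check(1) True by (auto simp: q_Coloring_def)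
    have "olist ([] @ map (\<lambda>e. eval_exp e s3) (map Const (flat (kedges n')))) (run N (pushes (map Const (flat (kedges n')))) s3)"
      by (rule run_pushes[OF ol]) auto
    then have ol4: "olist (flat (kedges n')) s4"
      using True by (simp add: s4_def olist_def n'_def comp_def)
    have f4: "s4 a = s3 a" if "a \<notin> {aOW, aOC, aNV, aK}" for a
      using True that run_frame[of a "pushes (map Const (flat (kedges (Suc q))))" N s3]
        writes_pushes[of "map Const (flat (kedges (Suc q)))"] by (auto simp: s4_def)
    have t4: "tables N b s4" using t3 f4 by (simp add: tables_def)
    have inst: "simple_graph {..<n'} (edges_of (kedges n'))" "deg1_modulator {..<n'} (edges_of (kedges n')) {..<n'}"
      using kedges_instance[of n'] by (simp_all add: is_instance_def)
    have M1: "M \<ge> 1" by (simp add: M_def)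
    have "n' \<le> 4 * q * 1" "n' * n' \<le> 4 * q * q * 1"
    proof -
      show "n' \<le> 4 * q * 1" using q by (simp add: n'_def)
      have "n' * n' \<le> (2 * q) * (2 * q)" using q by (intro mult_le_mono) (auto simp: n'_def)
      then show "n' * n' \<le> 4 * q * q * 1" by simp
    qed
    moreover have "4 * q * 1 \<le> 4 * q * M" "4 * q * q * 1 \<le> 4 * q * q * M"
      using M1 by (intro mult_le_mono2; simp)+
    moreover have "8 * q * q \<le> N" using N8[of 0] by simp
    moreover have "4 * q \<le> 8 * q * q" using q by simp
    moreover have "n' \<le> 4 * q" using q by (simp add: n'_def)
    ultimately have bd: "n' \<le> 4 * q * M" "length (kedges n') \<le> 4 * q * q * M" "n' \<le> N"
      "2 * length (kedges n') \<le> N"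
      using length_kedges[of n'] by linarith+
    have "s4 aNV 0 = n'" "s4 aK 0 = n'" using True by (simp_all add: s4_def n'_def)
    moreover have "n' \<le> k + Suc q" by (simp add: n'_def)
    moreover have "\<not> colorable q {..<n'} (edges_of (kedges n'))"
      unfolding n'_def by (rule kedges_not_colorable)
    ultimately show ?thesis using ol4 t4 inst no bd by blast
  next
    case False
    then obtain n E X where inst: "is_instance x k n E X" and gm: "graph_mem N n E X s3"
      using check(2) by blast
    have k: "card X = k" and gr: "simple_graph {..<n} E" "deg1_modulator {..<n} E X"
      using inst by (auto simp: is_instance_def)
    have Xn: "X \<subseteq> {..<n}" using gr by (simp add: deg1_modulator_def)
    have "s3 aVtx = s2 aVtx" using f3 by simp
    then have nL: "n \<le> length x" using gm pinv_bounds[OF p] by (simp add: graph_mem_def)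
    interpret setting q N b n E X
    proof
      show "n \<le> b" using nL b(3) by simp
      show "b ^ (2 * (q - 1)) \<le> N" by (rule Nj) simp
    qed (rule q b(2) qN Xn)+
    have "base s3" using t3 gm by (simp add: base_def)
    then obtain es n' where r: "olist (flat es) s4" "s4 aNV 0 = n'" "s4 aK 0 = k" "tables N b s4" "k \<le> n'"
      "simple_graph {..<n'} (edges_of es)" "deg1_modulator {..<n'} (edges_of es) {..<k}"
      "colorable q {..<n'} (edges_of es) \<longleftrightarrow> colorable q {..<n} E"
      "n' \<le> k + 2 * (k ^ q + m * k ^ (m - 1))"
      "length es \<le> k * k + (k ^ q + m * k ^ (m - 1)) * Suc m"
      using run_select[OF _ ol oc(2) gr] False unfolding s4_def k by auto
    have bd: "n' \<le> 4 * q * M" "length es \<le> 4 * q * q * M"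
      using r(9,10) size_bounds[OF q, of k] unfolding M_def by linarith+
    \<comment> \<open>In an instance \<open>k\<close> is at most the length of the string, which
      turns bounds in \<open>k\<close> into bounds by \<open>N\<close>.\<close>
    have "card X \<le> card {..<n}" using Xn by (rule card_mono[rotated]) simp
    then have "k \<le> length x" using nL k by simp
    then have "8 * q * q * M \<le> N" unfolding M_def by (rule N8)
    moreover have "4 * q * M \<le> 8 * q * q * M" using q by (intro mult_le_mono1) simp
    ultimately have "n' \<le> N" "2 * length es \<le> N" using bd by linarith+
    moreover have "(x, k) \<in> q_Coloring q \<longleftrightarrow> colorable q {..<n} E"
    proof
      assume "(x, k) \<in> q_Coloring q"
      then obtain n1 E1 X1 where 1: "is_instance x k n1 E1 X1" "colorable q {..<n1} E1"
        by (auto simp: q_Coloring_def)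
      obtain es' where "E = edges_of es'" "x = instance_code n X es'"
        using inst by (auto simp: is_instance_def encodes_def edges_of_def)
      then have "n1 = n" "E1 = E" using is_instance_unique[OF 1(1) _ Xn] by auto
      then show "colorable q {..<n} E" using 1 by simp
    next
      assume "colorable q {..<n} E"
      then show "(x, k) \<in> q_Coloring q" using inst by (auto simp: q_Coloring_def)
    qed
    ultimately show ?thesis using r bd by (intro exI[of _ es] exI[of _ n'] exI[of _ k]) auto
  qed
  then obtain es n' k' where r: "olist (flat es) s4" "s4 aNV 0 = n'" "s4 aK 0 = k'" "tables N b s4" "k' \<le> n'"
    "simple_graph {..<n'} (edges_of es)" "deg1_modulator {..<n'} (edges_of es) {..<k'}"
    "colorable q {..<n'} (edges_of es) \<longleftrightarrow> (x, k) \<in> q_Coloring q"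
    "n' \<le> 4 * q * M" "length es \<le> 4 * q * q * M" "k' \<le> k + Suc q" "n' \<le> N" "2 * length es \<le> N" by blast
  have lt: "\<forall>p\<in>set es. good_pair n' p" using r(6) unfolding simple_graph_edges_of .
  have "y \<le> N" if "y \<in> set (flat es)" for y
    using that lt r(12) unfolding set_flat by (fastforce simp: good_pair_def)
  from run_enc[OF r(4,1,2,12,3,13) this]
  have "output_string s' = instance_code n' {..<k'} es" "output_param s' = k'" unfolding s' by auto
  moreover have "is_instance (instance_code n' {..<k'} es) k' n' (edges_of es) {..<k'}"
    using r(6,7) by (auto simp: is_instance_def encodes_def edges_of_def)
  ultimately show ?thesis using r by blast
qed

section \<open>Size of the kernel\<close>

text \<open>Adding up a number in a loop as long as the base multiplies by the base. The arrays in
  use lie below 10, because the main program expects all arrays from 10 on to be 0.\<close>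

fun pow_prog :: "nat \<Rightarrow> prog" where
  "pow_prog 0 = PAsg 4 (Const 0) (Const 1)"
| "pow_prog (Suc j) = seqs [pow_prog j, PAsg 5 (Const 0) (Const 0),
     PFor 6 (PAsg 5 (Const 0) (Add (Var 5) (Var 4))), PAsg 4 (Const 0) (Var 5)]"

lemma writes_pow: "writes (pow_prog j) \<subseteq> {4, 5, 6}"
  by (induction j) auto

lemma wf_pow [simp]: "wf_prog aBase (pow_prog j)"
  by (induction j) auto

lemma run_sum_loop:
  assumes "s 5 0 = 0"
  shows "run N (PFor 6 (PAsg 5 (Const 0) (Add (Var 5) (Var 4)))) s 5 0 = N * s 4 0"
proof (rule for_rule[where I = "\<lambda>i s'. s' 5 0 = i * s 4 0"], goal_cases)
  case (3 i s')
  then show ?case using 3(4)[of 4] by simp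
qed (use assms in auto)

lemma run_pow: "run N (pow_prog j) s 4 0 = N ^ j"
proof (induction j)
  case (Suc j)
  define s1 where "s1 = setc 5 0 0 (run N (pow_prog j) s)"
  have "run N (PFor 6 (PAsg 5 (Const 0) (Add (Var 5) (Var 4)))) s1 5 0 = N * N ^ j"
    using run_sum_loop[of s1 N] Suc by (simp add: s1_def del: run.simps(5))
  moreover have "run N (pow_prog (Suc j)) s 4 0 =
      run N (PFor 6 (PAsg 5 (Const 0) (Add (Var 5) (Var 4)))) s1 5 0"
    by (simp add: s1_def)
  ultimately show ?case by simp
qed simp

definition blen :: "nat \<Rightarrow> nat" where
  "blen z = (LEAST j. z < 2 ^ j)"

lemma blen_eqI: "z < 2 ^ j \<Longrightarrow> j = 0 \<or> 2 ^ (j - 1) \<le> z \<Longrightarrow> blen z = j"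
  unfolding blen_def
proof (rule Least_equality)
  fix i assume j: "j = 0 \<or> 2 ^ (j - 1) \<le> z" and i: "z < 2 ^ i"
  show "j \<le> i"
  proof (rule ccontr)
    assume "\<not> j \<le> i"
    then have "(2::nat) ^ i \<le> 2 ^ (j - 1)" by (intro power_increasing) auto
    moreover have "2 ^ (j - 1) \<le> z" using j \<open>\<not> j \<le> i\<close> by auto
    ultimately show False using i by linarith
  qed
qed

lemma less_blen: "z < 2 ^ blen z"
  unfolding blen_def by (rule LeastI[of _ z]) simp

lemma blen_le: "blen z \<le> z"
  unfolding blen_def by (rule Least_le) simp

lemma blen_pow_le: "z > 0 \<Longrightarrow> 2 ^ (blen z - 1) \<le> z"
proof (rule ccontr)
  assume "z > 0" "\<not> 2 ^ (blen z - 1) \<le> z"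
  then have "blen z \<le> blen z - 1" unfolding blen_def by (intro Least_le) simp
  then have "blen z = 0" by simp
  then show False using less_blen[of z] \<open>z > 0\<close> by simp
qed

text \<open>A kernel size must be computable, hence given by a program. One loop doubles until the
  base is exceeded, for which \<open>z\<close> iterations suffice by \<open>z < 2 ^ z\<close>, and
  counts the doublings; another adds \<open>z ^ j\<close> once per doubling.\<close>

definition size_prog :: "nat \<Rightarrow> prog" where
  "size_prog j = seqs [pow_prog j, PAsg 7 (Const 0) (Const 1), PAsg 8 (Const 0) (Const 0),
     PFor 6 (PIf (LessE (Var 7) (Inc (Var aBase)))
       (PSeq (PAsg 7 (Const 0) (Add (Var 7) (Var 7))) (PAsg 8 (Const 0) (Inc (Var 8)))) PSkip),
     PAsg 5 (Const 0) (Const 0),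
     PFor 6 (PIf (LessE (Var 6) (Var 8)) (PAsg 5 (Const 0) (Add (Var 5) (Var 4))) PSkip),
     PAsg 0 (Const 1) (Var 5)]"

lemma wf_size: "wf_prog aBase (size_prog j)"
  by (simp add: size_prog_def)

lemma run_size:
  assumes "s aBase 0 = z"
  shows "run z (size_prog j) s 0 1 = z ^ j * blen z"
proof -
  define A where "A = PFor 6 (PIf (LessE (Var 7) (Inc (Var aBase)))
       (PSeq (PAsg 7 (Const 0) (Add (Var 7) (Var 7))) (PAsg 8 (Const 0) (Inc (Var 8)))) PSkip)"
  define B where "B = PFor 6 (PIf (LessE (Var 6) (Var 8)) (PAsg 5 (Const 0) (Add (Var 5) (Var 4))) PSkip)"
  define s1 where "s1 = setc 8 0 0 (setc 7 0 1 (run z (pow_prog j) s))"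
  define s2 where "s2 = run z A s1"
  define s3 where "s3 = setc 5 0 0 s2"
  define s4 where "s4 = run z B s3"
  have "size_prog j = seqs [pow_prog j, PAsg 7 (Const 0) (Const 1), PAsg 8 (Const 0) (Const 0), A,
     PAsg 5 (Const 0) (Const 0), B, PAsg 0 (Const 1) (Var 5)]"
    by (simp add: size_prog_def A_def B_def)
  then have run: "run z (size_prog j) s 0 1 = s4 5 0"
    by (simp add: s1_def s2_def s3_def s4_def)
  have s1: "s1 4 0 = z ^ j" "s1 7 0 = 1" "s1 8 0 = 0" "s1 aBase 0 = z"
  proof -
    have "run z (pow_prog j) s aBase = s aBase" using writes_pow[of j] by (intro run_frame) auto
    then show "s1 4 0 = z ^ j" "s1 7 0 = 1" "s1 8 0 = 0" "s1 aBase 0 = z"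
      using run_pow[of z j s] assms by (simp_all add: s1_def)
  qed
  let ?I = "\<lambda>i s'. s' 7 0 = 2 ^ s' 8 0 \<and> s' 8 0 \<le> i \<and> (s' 7 0 \<le> z \<longrightarrow> s' 8 0 = i) \<and>
      (s' 8 0 = 0 \<or> 2 ^ (s' 8 0 - 1) \<le> z)"
  have "?I z s2"
    unfolding s2_def A_def
  proof (rule for_rule[where I = ?I], goal_cases)
    case (3 i s')
    then show ?case using 3(4)[of aBase] s1 by auto
  qed (use s1 in auto)
  moreover have "z < 2 ^ z" by simp
  ultimately have "z < 2 ^ s2 8 0" "s2 8 0 = 0 \<or> 2 ^ (s2 8 0 - 1) \<le> z" by (metis not_le)+
  then have len: "s2 8 0 = blen z" using blen_eqI by simp
  have "s2 4 = s1 4" unfolding s2_def by (rule run_frame) (simp add: A_def)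
  then have s3: "s3 8 0 = blen z" "s3 4 0 = z ^ j" "s3 5 0 = 0" using len s1 by (simp_all add: s3_def)
  have "s4 5 0 = min z (blen z) * z ^ j"
    unfolding s4_def B_def
  proof (rule for_rule[where I = "\<lambda>i s'. s' 5 0 = min i (blen z) * z ^ j"], goal_cases)
    case (3 i s')
    then show ?case using 3(4)[of 8] 3(4)[of 4] s3 by (auto simp: min_def le_Suc_eq not_less)
  qed (use s3 in auto)
  then show ?thesis using run blen_le[of z] by (simp add: min_absorb2)
qed

text \<open>\<open>blen\<close> stands in for the logarithm, being computable and at least 1 for
  positive arguments. The factor \<open>4 * q\<close> inside the power absorbs the constants of the
  size estimate.\<close>

definition kernel_size :: "nat \<Rightarrow> nat \<Rightarrow> nat" where
  "kernel_size q k = (4 * q * (k + 1)) ^ (2 * q - 3) * blen (4 * q * (k + 1))"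

lemma computable_kernel_size: "computable (kernel_size q)"
proof -
  define e where "e = SumE (replicate (4 * q) (Inc (Cell 0 (Const 1))))"
  define K where "K = Seq (Assign aBase (Const 0) e) (compile aBase (size_prog (2 * q - 3)))"
  have "\<exists>t x'. runs_to K [] k t x' (kernel_size q k)" for k
  proof -
    let ?s = "input_memory [] k" and ?z = "4 * q * (k + 1)"
    have e: "eval_exp e ?s = ?z"
      by (simp add: e_def input_memory_def sum_list_replicate algebra_simps)
    obtain t where t: "exec (compile aBase (size_prog (2 * q - 3))) (setc aBase 0 ?z ?s) t
        (run ?z (size_prog (2 * q - 3)) (setc aBase 0 ?z ?s))"
      using exec_compile[OF wf_size, of "setc aBase 0 ?z ?s" ?z] by auto
    have "exec K ?s (1 + t) (run ?z (size_prog (2 * q - 3)) (setc aBase 0 ?z ?s))"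
      using exec.Seq[OF exec.Assign[of aBase "Const 0" e ?s]] t e unfolding K_def by simp
    moreover have "run ?z (size_prog (2 * q - 3)) (setc aBase 0 ?z ?s) 0 1 = kernel_size q k"
      using run_size[of "setc aBase 0 ?z ?s" ?z] by (simp add: kernel_size_def)
    ultimately show ?thesis unfolding runs_to_def output_param_def by blast
  qed
  then show ?thesis unfolding computable_def by blast
qed

text \<open>With \<open>p = 2q - 3\<close> and \<open>l = blen z\<close>, vertex names are below
  \<open>z ^ p < 2 ^ (p * l)\<close>, so an edge costs at most \<open>4 * p * l + 2\<close> bits;
  header and flags cost \<open>2 * n + 1\<close>. The collected constant is at most
  \<open>(4 * q) ^ 3\<close>, hence at most \<open>(4 * q) ^ p\<close>, as \<open>p\<close> \<ge>
  3.\<close>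

lemma output_length_le:
  fixes q k :: nat
  assumes q: "q \<ge> 3"
    and inst: "is_instance (instance_code n {..<k'} es) k' n (edges_of es) {..<k'}"
    and n: "n \<le> 4 * q * (k + 1) ^ (2 * q - 3)" and es: "length es \<le> 4 * q * q * (k + 1) ^ (2 * q - 3)"
    and k': "k' \<le> k + Suc q"
  shows "length (instance_code n {..<k'} es) + k' \<le> kernel_size q k"
proof -
  define p M z l where "p = 2 * q - 3" and "M = (k + 1) ^ p" and "z = 4 * q * (k + 1)" and "l = blen z"
  have z: "z > 0" using q by (simp add: z_def)
  have p: "p \<ge> 3" using q by (simp add: p_def)
  have l: "l \<ge> 1" using less_blen[of z] z by (cases "blen z") (auto simp: l_def)
  have zp: "z ^ p = (4 * q) ^ p * M" unfolding z_def M_def by (rule power_mult_distrib)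
  have nM: "n \<le> 4 * q * M" using n unfolding M_def p_def .
  also have "4 * q * M \<le> (4 * q) ^ p * M"
    using self_le_power[of "4 * q" p] q p by (intro mult_le_mono1) auto
  also have "\<dots> = z ^ p" by (rule zp[symmetric])
  also have "z ^ p < 2 ^ (p * l)"
    using power_strict_mono[OF less_blen[of z], of p] p by (simp add: l_def mult.commute flip: power_mult)
  finally have nl: "n < 2 ^ (p * l)" .
  have good: "\<forall>e\<in>set es. good_pair n e" using inst by (simp add: is_instance_def simple_graph_edges_of)
  have len: "length (instance_code n {..<k'} es) \<le> 2 * n + 1 + length es * (4 * (p * l) + 2)"
    by (rule length_instance_code) (use good nl in \<open>force simp: good_pair_def\<close>)
  have M: "k + 1 \<le> M" "1 \<le> M" using self_le_power[of "k + 1" p] p by (auto simp: M_def)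
  have Ml: "M \<le> M * l" "1 \<le> M * l" using l M by auto
  have "length es * (4 * (p * l) + 2) \<le> 4 * q * q * M * (4 * (p * l) + 2)"
    using es by (intro mult_le_mono1) (simp add: M_def p_def)
  also have "\<dots> = 16 * q * q * p * (M * l) + 8 * q * q * M" by (simp add: algebra_simps)
  finally have "length (instance_code n {..<k'} es) + k' \<le>
      8 * q * M + 1 + 16 * q * q * p * (M * l) + 8 * q * q * M + k + Suc q"
    using len nM k' by linarith
  also have "\<dots> \<le> (16 * q * q * p + 8 * q * q + 8 * q + q + 2) * (M * l)"
  proof -
    have "8 * q * M \<le> 8 * q * (M * l)" "8 * q * q * M \<le> 8 * q * q * (M * l)" "q * 1 \<le> q * (M * l)"
      using Ml by (intro mult_le_mono2; simp)+
    moreover have "k + 1 \<le> M * l" using M(1) Ml(1) by (rule order_trans)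
    ultimately have "8 * q * M + 1 + 16 * q * q * p * (M * l) + 8 * q * q * M + k + Suc q \<le>
        16 * q * q * p * (M * l) + 8 * q * q * (M * l) + 8 * q * (M * l) + q * (M * l) + 2 * (M * l)"
      using Ml by linarith
    then show ?thesis by (simp only: distrib_right)
  qed
  also have "\<dots> \<le> (4 * q) ^ 3 * (M * l)"
  proof (rule mult_le_mono1)
    obtain r where r: "q = r + 3" using q by (metis add.commute le_add_diff_inverse)
    show "16 * q * q * p + 8 * q * q + 8 * q + q + 2 \<le> (4 * q) ^ 3"
      unfolding p_def r by (simp add: power3_eq_cube algebra_simps)
  qed
  also have "\<dots> \<le> (4 * q) ^ p * (M * l)"
    using p q by (intro mult_le_mono1 power_increasing) auto
  also have "\<dots> = kernel_size q k"
    using zp by (simp add: kernel_size_def l_def z_def p_def mult.assoc)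
  finally show ?thesis .
qed

lemma poly_nat_mono: "a \<le> b \<Longrightarrow> poly P a \<le> poly P b" for P :: "nat poly"
  by (induction P) (auto intro!: add_mono mult_mono)

text \<open>The number \<open>N = (|x| + 4q)\<^bsup>2q - 1\<^esup>\<close> bounds the codes of all tuples in use as well as the number
  of vertices and of edge ends in the output.\<close>

definition kernel :: "nat \<Rightarrow> com" where
  "kernel q = Seq (Assign aBase (Const 0) (Add (Var 0) (Const (4 * q))))
     (Seq (compile aBase (PSeq (pow_prog (2 * q - 1)) (PAsg aN (Const 0) (Var 4))))
          (compile aN (main_prog q)))"

text \<open>The loop bound of the main program is itself computed with loops, of length
  \<open>b\<close>; the two stages are compiled with different bound cells, and the first leaves all
  arrays from 10 on untouched.\<close>

lemma kernel_run:
  fixes q k :: nat and x :: "bool list"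
  assumes q: "q \<ge> 3"
  defines "b \<equiv> length x + 4 * q" and "M \<equiv> (k + 1) ^ (2 * q - 3)"
  shows "\<exists>t n' es k'. runs_to (kernel q) x k t (instance_code n' {..<k'} es) k' \<and>
    t \<le> 1 + cost b (PSeq (pow_prog (2 * q - 1)) (PAsg aN (Const 0) (Var 4))) + cost (b ^ (2 * q - 1)) (main_prog q) \<and>
    is_instance (instance_code n' {..<k'} es) k' n' (edges_of es) {..<k'} \<and>
    (colorable q {..<n'} (edges_of es) \<longleftrightarrow> (x, k) \<in> q_Coloring q) \<and>
    n' \<le> 4 * q * M \<and> length es \<le> 4 * q * q * M \<and> k' \<le> k + Suc q"
proof -
  define pre where "pre = PSeq (pow_prog (2 * q - 1)) (PAsg aN (Const 0) (Var 4))"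
  define N where "N = b ^ (2 * q - 1)"
  define s0 where "s0 = input_memory x k"
  define s1 where "s1 = setc aBase 0 b s0"
  define s2 where "s2 = run b pre s1"
  define s3 where "s3 = run N (main_prog q) s2"
  have f2: "s2 a = s1 a" if "a \<notin> {2, 4, 5, 6}" for a
    unfolding s2_def using that writes_pow by (intro run_frame) (auto simp: pre_def)
  have N2: "s2 aN 0 = N" using run_pow by (simp add: s2_def pre_def N_def)
  have e0: "exec (Assign aBase (Const 0) (Add (Var 0) (Const (4 * q)))) s0 1 s1"
  proof -
    have "eval_exp (Add (Var 0) (Const (4 * q))) s0 = b" by (simp add: s0_def input_memory_def b_def)
    then show ?thesis using exec.Assign[of aBase "Const 0" "Add (Var 0) (Const (4 * q))" s0] by (simp add: s1_def)
  qed
  have "wf_prog aBase pre" by (simp add: pre_def)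
  then obtain t1 where t1: "t1 \<le> cost b pre" "exec (compile aBase pre) s1 t1 s2"
    using exec_compile[of aBase pre s1 b] by (auto simp: s1_def s2_def)
  obtain t2 where t2: "t2 \<le> cost N (main_prog q)" "exec (compile aN (main_prog q)) s2 t2 s3"
    using exec_compile[OF wf_main[OF q], of s2 N] N2 unfolding s3_def by blast
  have ex: "exec (kernel q) s0 (1 + (t1 + t2)) s3"
    unfolding kernel_def pre_def[symmetric] by (rule exec.Seq[OF e0 exec.Seq[OF t1(2) t2(2)]])
  have "s2 0 0 = length x" "s2 0 1 = k" "\<And>i. i < length x \<Longrightarrow> s2 1 i = of_bool (x ! i)"
    "s2 aBase 0 = b" "\<And>a i. a \<ge> 10 \<Longrightarrow> s2 a i = 0"
    using f2 by (auto simp: s1_def s0_def input_memory_def)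
  note s2 = this
  have "b = length x + 4 * q" "N = (length x + 4 * q) ^ (2 * q - 1)" by (simp_all add: N_def b_def)
  from run_main[OF q this s2(1-3) N2 s2(4,5)]
  obtain n' es k' where r: "output_string s3 = instance_code n' {..<k'} es" "output_param s3 = k'"
    "is_instance (instance_code n' {..<k'} es) k' n' (edges_of es) {..<k'}"
    "colorable q {..<n'} (edges_of es) \<longleftrightarrow> (x, k) \<in> q_Coloring q"
    "n' \<le> 4 * q * M" "length es \<le> 4 * q * q * M" "k' \<le> k + Suc q"
    unfolding s3_def M_def by blast
  have "runs_to (kernel q) x k (1 + (t1 + t2)) (instance_code n' {..<k'} es) k'"
    unfolding runs_to_def using ex r(1,2) unfolding s0_def by blast
  moreover have "1 + (t1 + t2) \<le> 1 + cost b pre + cost N (main_prog q)" using t1(1) t2(1) by simp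
  ultimately show ?thesis using r unfolding pre_def N_def by blast
qed

lemma kernel_size_le: "kernel_size q k \<le> (4 * q * (k + 1)) ^ Suc (2 * q - 3)"
  unfolding kernel_size_def power_Suc2 by (rule mult_le_mono2) (rule blen_le)

lemma is_kernel_kernel:
  assumes q: "q \<ge> 3"
  shows "is_kernel (kernel q) (q_Coloring q) (kernel_size q)"
proof -
  let ?pre = "PSeq (pow_prog (2 * q - 1)) (PAsg aN (Const 0) (Var 4))"
  obtain P1 P2 :: "nat poly" where P: "\<And>N. cost N ?pre = poly P1 N" "\<And>N. cost N (main_prog q) = poly P2 N"
    using cost_poly by metis
  \<comment> \<open>The time bound depends on the length of \<open>x\<close> only and the size bound
    on \<open>k\<close> only. Polynomials with natural coefficients are monotone, so everything may
    be evaluated at \<open>length x + k\<close>.\<close>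
  define P where "P = 1 + pcompose P1 [:4 * q, 1:] + pcompose P2 ([:4 * q, 1:] ^ (2 * q - 1)) +
      [:4 * q, 4 * q:] ^ Suc (2 * q - 3)"
  have "\<exists>t x' k'. runs_to (kernel q) x k t x' k' \<and> t + length x' \<le> poly P (length x + k) \<and>
      ((x, k) \<in> q_Coloring q \<longleftrightarrow> (x', k') \<in> q_Coloring q) \<and> length x' + k' \<le> kernel_size q k" for x k
  proof -
    let ?b = "length x + 4 * q" and ?y = "length x + k"
    obtain t n' es k' where r: "runs_to (kernel q) x k t (instance_code n' {..<k'} es) k'"
      "t \<le> 1 + cost ?b ?pre + cost (?b ^ (2 * q - 1)) (main_prog q)"
      "is_instance (instance_code n' {..<k'} es) k' n' (edges_of es) {..<k'}"
      "colorable q {..<n'} (edges_of es) \<longleftrightarrow> (x, k) \<in> q_Coloring q"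
      "n' \<le> 4 * q * (k + 1) ^ (2 * q - 3)" "length es \<le> 4 * q * q * (k + 1) ^ (2 * q - 3)" "k' \<le> k + Suc q"
      using kernel_run[OF q, of x k] by blast
    let ?x' = "instance_code n' {..<k'} es"
    have size: "length ?x' + k' \<le> kernel_size q k" by (rule output_length_le[OF q r(3,5,6,7)])
    have "cost ?b ?pre \<le> poly P1 (poly [:4 * q, 1:] ?y)"
      unfolding P by (rule poly_nat_mono) simp
    moreover have "cost (?b ^ (2 * q - 1)) (main_prog q) \<le> poly P2 (poly ([:4 * q, 1:] ^ (2 * q - 1)) ?y)"
      unfolding P poly_power by (intro poly_nat_mono power_mono) auto
    moreover have "kernel_size q k \<le> poly ([:4 * q, 4 * q:] ^ Suc (2 * q - 3)) ?y"
      unfolding poly_power by (rule order_trans[OF kernel_size_le power_mono]) (auto simp: algebra_simps)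
    ultimately have "t + length ?x' \<le> poly P ?y"
      using r(2) size unfolding P_def poly_add poly_pcompose poly_1 by linarith
    moreover have "(x, k) \<in> q_Coloring q \<longleftrightarrow> (?x', k') \<in> q_Coloring q"
    proof -
      have "colorable q {..<n1} E1 \<longleftrightarrow> colorable q {..<n'} (edges_of es)"
        if "is_instance ?x' k' n1 E1 X1" for n1 E1 X1
      proof -
        have "{..<k'} \<subseteq> {..<n'}" using r(3) by (simp add: is_instance_def deg1_modulator_def)
        from is_instance_unique[OF that refl this] show ?thesis by simp
      qed
      then have "(?x', k') \<in> q_Coloring q \<longleftrightarrow> colorable q {..<n'} (edges_of es)"
        using r(3) unfolding q_Coloring_def by blast
      then show ?thesis using r(4) by simp
    qed
    ultimately show ?thesis using r(1) size by blast
  qed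
  then show ?thesis unfolding is_kernel_def using computable_kernel_size by blast
qed

section \<open>Asymptotic bounds\<close>

lemma Suc_power_le: "k \<ge> 1 \<Longrightarrow> real (k + 1) ^ p \<le> 2 ^ p * real k ^ p"
proof -
  assume "k \<ge> 1"
  then have "real (k + 1) ^ p \<le> (2 * real k) ^ p" by (intro power_mono) auto
  then show ?thesis by (simp add: power_mult_distrib)
qed

lemma vertex_bound_bigo: "(\<lambda>k. real (4 * q * (k + 1) ^ p)) \<in> O(\<lambda>k. real k ^ p)"
proof (rule bigoI[where c = "4 * real q * 2 ^ p"])
  show "\<forall>\<^sub>F k in sequentially. norm (real (4 * q * (k + 1) ^ p)) \<le> 4 * real q * 2 ^ p * norm (real k ^ p)"
  proof (rule eventually_mono[OF eventually_ge_at_top[of 1]])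
    fix k :: nat assume "k \<ge> 1"
    from Suc_power_le[OF this, of p] have "4 * real q * real (k + 1) ^ p \<le> 4 * real q * (2 ^ p * real k ^ p)"
      by (intro mult_left_mono) auto
    then show "norm (real (4 * q * (k + 1) ^ p)) \<le> 4 * real q * 2 ^ p * norm (real k ^ p)"
      by (simp add: mult.assoc)
  qed
qed

text \<open>For \<open>k\<close> \<ge> \<open>8q\<close> the argument is at most
  \<open>8 * q * k\<close> \<le> \<open>k * k\<close>, so the bit length is at most
  \<open>2 log k + 1\<close> with logarithm to base 2; the summand 1 is at most \<open>log k\<close>
  because \<open>k\<close> \<ge> 2, which gives the constant 3.\<close>

lemma blen_le_ln:
  assumes "k \<ge> 8 * q" "q \<ge> 1" "k \<ge> 2"
  shows "real (blen (4 * q * (k + 1))) \<le> 3 / ln 2 * ln (real k)"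
proof -
  let ?z = "4 * q * (k + 1)" and ?l = "blen (4 * q * (k + 1))"
  have "?z \<le> 8 * q * k" using assms by simp
  also have "\<dots> \<le> k * k" using assms by (intro mult_le_mono1)
  finally have "2 ^ (?l - 1) \<le> k * k" using blen_pow_le[of ?z] assms by simp
  then have "real (2 ^ (?l - 1)) \<le> real (k * k)" by (rule of_nat_mono)
  then have "ln (2 ^ (?l - 1)) \<le> ln (real k * real k)"
    using assms by (subst ln_le_cancel_iff) auto
  then have "real (?l - 1) * ln 2 \<le> 2 * ln (real k)"
    using assms by (simp add: ln_realpow ln_mult)
  moreover have "ln 2 \<le> ln (real k)" using assms by simp
  moreover have "real ?l \<le> real (?l - 1) + 1" by simp
  then have "real ?l * ln 2 \<le> (real (?l - 1) + 1) * ln 2" by (rule mult_right_mono) simp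
  ultimately have "real ?l * ln 2 \<le> 3 * ln (real k)" by (simp add: algebra_simps)
  then show ?thesis by (simp add: field_simps)
qed

lemma kernel_size_bigo:
  assumes "q \<ge> 1"
  shows "(\<lambda>k. real (kernel_size q k)) \<in> O(\<lambda>k. real k ^ (2 * q - 3) * ln (real k))"
proof -
  let ?p = "2 * q - 3" and ?C = "(4 * real q) ^ (2 * q - 3) * 2 ^ (2 * q - 3) * (3 / ln 2)"
  have "\<forall>\<^sub>F k in sequentially. norm (real (kernel_size q k)) \<le> ?C * norm (real k ^ ?p * ln (real k))"
  proof (rule eventually_mono[OF eventually_ge_at_top[of "8 * q + 2"]])
    fix k :: nat assume k: "k \<ge> 8 * q + 2"
    have ln: "ln (real k) \<ge> 0" using k by simp
    have "real (kernel_size q k) = (4 * real q) ^ ?p * real (k + 1) ^ ?p * real (blen (4 * q * (k + 1)))"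
      by (simp only: kernel_size_def of_nat_mult of_nat_power of_nat_numeral power_mult_distrib)
    also have "\<dots> \<le> (4 * real q) ^ ?p * (2 ^ ?p * real k ^ ?p) * (3 / ln 2 * ln (real k))"
      using Suc_power_le[of k ?p] blen_le_ln[of q k] k assms ln
      by (intro mult_mono mult_left_mono mult_nonneg_nonneg) auto
    also have "\<dots> = ?C * norm (real k ^ ?p * ln (real k))" using ln by (simp add: abs_mult)
    finally show "norm (real (kernel_size q k)) \<le> ?C * norm (real k ^ ?p * ln (real k))" by simp
  qed
  then show ?thesis by (rule bigoI)
qed

theorem theorem1p1:
  fixes q :: nat
  assumes "q \<ge> 3"
  shows "\<exists>(K :: com) (f :: nat \<Rightarrow> nat) (g :: nat \<Rightarrow> nat).
    is_kernel K (q_Coloring q) f \<and>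
    (\<forall>x k t x' k'. runs_to K x k t x' k' \<longrightarrow>
       (\<exists>n' E' X'. is_instance x' k' n' E' X' \<and> n' \<le> g k)) \<and>
    (\<lambda>k. real (g k)) \<in> O(\<lambda>k. real k ^ (2 * q - 3)) \<and>
    (\<lambda>k. real (f k)) \<in> O(\<lambda>k. real k ^ (2 * q - 3) * ln (real k))"
proof (rule exI[of _ "kernel q"], rule exI[of _ "kernel_size q"],
    rule exI[of _ "\<lambda>k. 4 * q * (k + 1) ^ (2 * q - 3)"], intro conjI allI impI)
  show "is_kernel (kernel q) (q_Coloring q) (kernel_size q)"
    using assms by (rule is_kernel_kernel)
  show "(\<lambda>k. real (4 * q * (k + 1) ^ (2 * q - 3))) \<in> O(\<lambda>k. real k ^ (2 * q - 3))"
    by (rule vertex_bound_bigo)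
  show "(\<lambda>k. real (kernel_size q k)) \<in> O(\<lambda>k. real k ^ (2 * q - 3) * ln (real k))"
    using assms by (intro kernel_size_bigo) simp
  fix x k t x' k'
  assume run: "runs_to (kernel q) x k t x' k'"
  obtain t1 n1 es k1 where r: "runs_to (kernel q) x k t1 (instance_code n1 {..<k1} es) k1"
    "is_instance (instance_code n1 {..<k1} es) k1 n1 (edges_of es) {..<k1}"
    "n1 \<le> 4 * q * (k + 1) ^ (2 * q - 3)"
    using kernel_run[OF assms, of x k] by blast
  \<comment> \<open>The claim is about every run; by determinism it is the run already
    constructed.\<close>
  have "x' = instance_code n1 {..<k1} es \<and> k' = k1"
    using run r(1) exec_deterministic unfolding runs_to_def by metis
  then show "\<exists>n' E' X'. is_instance x' k' n' E' X' \<and> n' \<le> 4 * q * (k + 1) ^ (2 * q - 3)"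
    using r by blast
qed

end
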